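(* For every real $q>1$ there is a constant $c_q>0$ depending on $q$ only such that the following holds. Let $n\ge2$ be even, let $m_1,\dots,m_{n/2}$ be positive integers with $\frac{m_{k+1}}{m_k}\ge q$ for all $1\le k<n/2$, and let $X=(X_1,\dots,X_n)$ be the random vector on $\Omega=(-\pi,\pi)$ with the probability measure $d\mathbb{P}(t)=\frac1{2\pi}dt$ with components $$X_{2k-1}(t)=\sqrt2\cos(m_kt),\qquad X_{2k}(t)=\sqrt2\sin(m_kt),\qquad k=1,\dots,n/2 .$$ Then $$\mathbb{E}_\theta\,\omega^2(F_\theta,\Phi)\le\frac{c_q}{n^2},\qquad \mathbb{E}_\theta\,\rho^2(F_\theta,\Phi)\le\frac{c_q(\log n)^2}{n^2}.$$
   Context: $\langle\cdot,\cdot\rangle$ is the Euclidean inner product on $\mathbb{R}^n$. $\mathbb{E}_\theta$ denotes integration over $\theta$ in the unit sphere $\mathbb{S}^{n-1}$ with respect to the uniform probability measure $\mathfrak{s}_{n-1}$. For $\theta\in\mathbb{S}^{n-1}$, $F_\theta(x)=\mathbb{P}\{\langle X,\theta\rangle\le x\}$, and $\Phi$ is the standard normal distribution function. For distribution functions $U,V$ on $\mathbb{R}$, $\rho(U,V)=\sup_x|U(x)-V(x)|$ and $\omega(U,V)=\big(\int_{-\infty}^\infty (U(x)-V(x))^2dx\big)^{1/2}$. *)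

theory Defs
  imports "HOL-Probability.Probability"
begin

text \<open>
  The dimension \<open>n\<close> is quantified inside the statement (after the constant), so it cannot be a
  type. Points of \<open>\<real>\<^sup>n\<close> are the elements \<open>x\<close> of \<open>{1..n} \<rightarrow>\<^sub>E \<real>\<close>, the space of the product
  measure \<open>PiM {1..n} (\<lambda>_. lborel)\<close>, which is \<open>n\<close>-dimensional Lebesgue measure.
\<close>

definition euclid_inner :: "nat \<Rightarrow> (nat \<Rightarrow> real) \<Rightarrow> (nat \<Rightarrow> real) \<Rightarrow> real" where
  "euclid_inner n x y = (\<Sum>i=1..n. x i * y i)"

definition euclid_norm :: "nat \<Rightarrow> (nat \<Rightarrow> real) \<Rightarrow> real" where
  "euclid_norm n x = sqrt (euclid_inner n x x)"

definition unit_ball :: "nat \<Rightarrow> (nat \<Rightarrow> real) set" where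
  "unit_ball n = {x \<in> {1..n} \<rightarrow>\<^sub>E UNIV. euclid_norm n x \<le> 1}"

definition unit_sphere :: "nat \<Rightarrow> (nat \<Rightarrow> real) set" where
  "unit_sphere n = {x \<in> {1..n} \<rightarrow>\<^sub>E UNIV. euclid_norm n x = 1}"

text \<open>
  The uniform probability measure on the sphere is the normalised cone measure: the law of
  \<open>x / |x|\<close> for \<open>x\<close> uniformly distributed in the unit ball. The value of the projection at the
  origin is irrelevant, since the origin is a null set for \<open>n \<ge> 1\<close>.
\<close>

definition radial_proj :: "nat \<Rightarrow> (nat \<Rightarrow> real) \<Rightarrow> nat \<Rightarrow> real" where
  "radial_proj n x = (\<lambda>i\<in>{1..n}. x i / euclid_norm n x)"

definition sphere_measure :: "nat \<Rightarrow> (nat \<Rightarrow> real) measure" where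
  "sphere_measure n =
     restrict_space
       (distr (uniform_measure (PiM {1..n} (\<lambda>_. lborel)) (unit_ball n))
              (PiM {1..n} (\<lambda>_. borel)) (radial_proj n))
       (unit_sphere n)"

definition proj_cdf ::
  "'a measure \<Rightarrow> nat \<Rightarrow> (nat \<Rightarrow> 'a \<Rightarrow> real) \<Rightarrow> (nat \<Rightarrow> real) \<Rightarrow> real \<Rightarrow> real" where
  "proj_cdf P n X \<theta> x = measure P {t \<in> space P. euclid_inner n (\<lambda>i. X i t) \<theta> \<le> x}"

definition std_normal_cdf :: "real \<Rightarrow> real" where
  "std_normal_cdf = cdf std_normal_distribution"

definition unif_circle :: "real measure" where
  "unif_circle = density (restrict_space lborel {-pi<..<pi}) (\<lambda>_. ennreal (1 / (2 * pi)))"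

text \<open>
  Both distances take values in \<open>[0, \<infinity>]\<close>, so that a divergent integral or an unbounded supremum
  has the value \<open>\<infinity>\<close> rather than a default real number.
\<close>

definition ennreal_sqrt :: "ennreal \<Rightarrow> ennreal" where
  "ennreal_sqrt a = (if a = \<infinity> then \<infinity> else ennreal (sqrt (enn2real a)))"

definition rho_dist :: "(real \<Rightarrow> real) \<Rightarrow> (real \<Rightarrow> real) \<Rightarrow> ennreal" where
  "rho_dist U V = (SUP x. ennreal \<bar>U x - V x\<bar>)"

definition omega_dist :: "(real \<Rightarrow> real) \<Rightarrow> (real \<Rightarrow> real) \<Rightarrow> ennreal" where
  "omega_dist U V = ennreal_sqrt (\<integral>\<^sup>+ x. ennreal ((U x - V x)\<^sup>2) \<partial>lborel)"


lemma ennreal_sqrt_power2: "(ennreal_sqrt a)\<^sup>2 = a"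
  by (cases a) (auto simp: ennreal_sqrt_def ennreal_power top_power_ennreal)

lemma prob_space_unif_circle: "prob_space unif_circle"
proof
  have "emeasure unif_circle (space unif_circle)
      = ennreal (1 / (2 * pi)) * emeasure (restrict_space lborel {-pi<..<pi}) {-pi<..<pi}"
    by (simp add: unif_circle_def space_restrict_space emeasure_density_const sets_restrict_space_iff)
  also have "\<dots> = ennreal (1 / (2 * pi)) * ennreal (2 * pi)"
    by (simp add: emeasure_restrict_space)
  also have "\<dots> = 1"
    by (simp flip: ennreal_mult)
  finally show "emeasure unif_circle (space unif_circle) = 1" .
qed

lemma euclid_norm_measurable [measurable]:
  "euclid_norm n \<in> borel_measurable (PiM {1..n} (\<lambda>_. lborel))"
  "euclid_norm n \<in> borel_measurable (PiM {1..n} (\<lambda>_. borel))"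
  unfolding euclid_norm_def[abs_def] euclid_inner_def by measurable

lemma unit_ball_sets [measurable]: "unit_ball n \<in> sets (PiM {1..n} (\<lambda>_. lborel))"
proof -
  have eq: "unit_ball n = {x \<in> space (PiM {1..n} (\<lambda>_. lborel)). euclid_norm n x \<le> 1}"
    by (simp add: unit_ball_def space_PiM)
  show ?thesis unfolding eq by measurable
qed

lemma unit_sphere_sets [measurable]: "unit_sphere n \<in> sets (PiM {1..n} (\<lambda>_. borel))"
proof -
  have eq: "unit_sphere n = {x \<in> space (PiM {1..n} (\<lambda>_. borel)). euclid_norm n x = 1}"
    by (simp add: unit_sphere_def space_PiM)
  show ?thesis unfolding eq by measurable
qed

lemma radial_proj_measurable [measurable]:
  "radial_proj n \<in> PiM {1..n} (\<lambda>_. lborel) \<rightarrow>\<^sub>M PiM {1..n} (\<lambda>_. borel)"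
  unfolding radial_proj_def[abs_def] by measurable

lemma space_sphere_measure: "space (sphere_measure n) = unit_sphere n"
  by (auto simp: sphere_measure_def space_restrict_space unit_sphere_def space_PiM)

lemma euclid_norm_eq_0_iff: "euclid_norm n x = 0 \<longleftrightarrow> (\<forall>i\<in>{1..n}. x i = 0)"
  by (auto simp: euclid_norm_def euclid_inner_def sum_nonneg_eq_0_iff)

lemma euclid_norm_radial_proj:
  assumes "euclid_norm n x \<noteq> 0"
  shows "euclid_norm n (radial_proj n x) = 1"
proof -
  have "euclid_inner n (radial_proj n x) (radial_proj n x) = euclid_inner n x x / (euclid_norm n x)\<^sup>2"
    by (auto simp: euclid_inner_def radial_proj_def sum_divide_distrib power2_eq_square intro!: sum.cong)
  moreover have "(euclid_norm n x)\<^sup>2 = euclid_inner n x x"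
    by (simp add: euclid_norm_def euclid_inner_def sum_nonneg)
  ultimately show ?thesis
    using assms by (simp add: euclid_norm_def)
qed

lemma emeasure_unit_ball:
  assumes "n \<ge> 1"
  shows "emeasure (PiM {1..n} (\<lambda>_. lborel)) (unit_ball n) \<noteq> 0"
    and "emeasure (PiM {1..n} (\<lambda>_. lborel)) (unit_ball n) \<noteq> \<infinity>"
proof -
  interpret finite_product_sigma_finite "\<lambda>_. lborel :: real measure" "{1..n}"
    by standard auto
  let ?L = "PiM {1..n} (\<lambda>_. lborel :: real measure)"
  have box: "emeasure ?L ({1..n} \<rightarrow>\<^sub>E {-r..r}) = ennreal ((2 * r) ^ n)" if "r \<ge> 0" for r
    using measure_times[of "\<lambda>_. {-r..r}"] that by (simp add: ennreal_power)
  have "({1..n} \<rightarrow>\<^sub>E {-(1 / n)..1 / n}) \<subseteq> unit_ball n"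
  proof
    fix x assume x: "x \<in> {1..n} \<rightarrow>\<^sub>E {-(1 / real n)..1 / real n}"
    have "x i * x i \<le> 1 / n" if "i \<in> {1..n}" for i
    proof -
      have "\<bar>x i\<bar> \<le> 1 / n"
        using PiE_mem[OF x that] by (auto simp: abs_le_iff)
      moreover have "1 / real n \<le> 1"
        using assms by simp
      ultimately have "\<bar>x i\<bar> * \<bar>x i\<bar> \<le> 1 / n * 1"
        by (intro mult_mono) auto
      then show ?thesis
        by simp
    qed
    then have "euclid_inner n x x \<le> (\<Sum>i=1..n. 1 / n)"
      unfolding euclid_inner_def by (rule sum_mono)
    then have "euclid_inner n x x \<le> 1"
      using assms by simp
    then show "x \<in> unit_ball n"
      using x by (auto simp: unit_ball_def euclid_norm_def PiE_iff)
  qed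
  then have "ennreal ((2 * (1 / n)) ^ n) \<le> emeasure ?L (unit_ball n)"
    using box[of "1 / n"] by (metis emeasure_mono unit_ball_sets of_nat_0_le_iff zero_le_divide_1_iff)
  moreover have "(2 * (1 / real n)) ^ n > 0"
    using assms by simp
  ultimately show "emeasure ?L (unit_ball n) \<noteq> 0"
    by (metis ennreal_eq_0_iff le_zero_eq not_le)
  have "unit_ball n \<subseteq> ({1..n} \<rightarrow>\<^sub>E {-1..1})"
  proof
    fix x assume x: "x \<in> unit_ball n"
    have "x i \<in> {-1..1}" if "i \<in> {1..n}" for i
    proof -
      have "x i * x i \<le> euclid_inner n x x"
        unfolding euclid_inner_def by (rule member_le_sum) (use that in auto)
      also have "\<dots> \<le> 1"
        using x by (simp add: unit_ball_def euclid_norm_def)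
      finally show ?thesis
        using abs_square_le_1[of "x i"] by (auto simp: power2_eq_square abs_le_iff)
    qed
    then show "x \<in> {1..n} \<rightarrow>\<^sub>E {-1..1}"
      using x by (auto simp: unit_ball_def PiE_iff)
  qed
  then have "emeasure ?L (unit_ball n) \<le> emeasure ?L ({1..n} \<rightarrow>\<^sub>E {-1..1})"
    by (intro emeasure_mono sets_PiM_I_finite) auto
  also have "\<dots> = ennreal ((2 * 1) ^ n)"
    using box[of 1] by simp
  finally show "emeasure ?L (unit_ball n) \<noteq> \<infinity>"
    by (metis ennreal_less_top infinity_ennreal_def leD)
qed

lemma AE_euclid_norm_neq_0:
  assumes "n \<ge> 1"
  shows "AE x in PiM {1..n} (\<lambda>_. lborel). euclid_norm n x \<noteq> 0"
proof (rule AE_I)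
  interpret finite_product_sigma_finite "\<lambda>_. lborel :: real measure" "{1..n}"
    by standard auto
  show "emeasure (PiM {1..n} (\<lambda>_. lborel)) ({1..n} \<rightarrow>\<^sub>E {0::real}) = 0"
    using measure_times[of "\<lambda>_. {0}"] assms by simp
  show "({1..n} \<rightarrow>\<^sub>E {0::real}) \<in> sets (PiM {1..n} (\<lambda>_. lborel))"
    by (intro sets_PiM_I_finite) auto
  show "{x \<in> space (PiM {1..n} (\<lambda>_. lborel)). \<not> euclid_norm n x \<noteq> 0} \<subseteq> {1..n} \<rightarrow>\<^sub>E {0}"
    by (auto simp: euclid_norm_eq_0_iff space_PiM PiE_iff extensional_def fun_eq_iff)
qed

lemma prob_space_sphere_measure:
  assumes "n \<ge> 1"
  shows "prob_space (sphere_measure n)"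
proof -
  let ?L = "PiM {1..n} (\<lambda>_. lborel :: real measure)"
  let ?U = "uniform_measure ?L (unit_ball n)"
  let ?D = "distr ?U (PiM {1..n} (\<lambda>_. borel)) (radial_proj n)"
  interpret U: prob_space ?U
    by (rule prob_space_uniform_measure) (use emeasure_unit_ball[OF assms] in auto)
  interpret D: prob_space ?D
    by (rule U.prob_space_distr) (use radial_proj_measurable in \<open>simp del: One_nat_def\<close>)
  have "AE x in ?U. euclid_norm n x \<noteq> 0"
    by (rule AE_uniform_measureI[OF unit_ball_sets]) (use AE_euclid_norm_neq_0[OF assms] in eventually_elim, simp)
  then have "AE x in ?U. radial_proj n x \<in> unit_sphere n"
    by eventually_elim (simp add: unit_sphere_def euclid_norm_radial_proj, simp add: radial_proj_def)
  then have "AE \<theta> in ?D. \<theta> \<in> unit_sphere n"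
    by (subst AE_distr_iff) measurable
  then have "emeasure ?D (unit_sphere n) = 1"
    by (intro D.emeasure_eq_1_AE) (use unit_sphere_sets in \<open>simp_all del: One_nat_def\<close>)
  then show ?thesis
    unfolding sphere_measure_def 
    by (intro prob_space_restrict_space) (use unit_sphere_sets in \<open>simp_all del: One_nat_def\<close>)
qed

end

theory Submission
  imports Defs
begin

text \<open>
  Write \<open>F\<close> for the distribution function of \<open><X, \<theta>>\<close>. Both averaged distances are
  averages of energies \<open>E k(Y - Y')\<close> of independent pairs, which homogeneity of the kernel \<open>k\<close> turns into
  moments of lengths of random vectors in \<open>\<real>\<^sup>n\<close>.

  Energies. The squared \<open>L\<^sup>2\<close> distance of two distribution functions is an energy distance with kernel
  \<open>max 0 r\<close> (\<open>cramer_von_mises_energy\<close>). The supremum of \<open>|F - \<Phi>|\<close> is controlled by the \<open>L\<^sup>2\<close> norm and a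
  fractional Sobolev seminorm of order 7/10, which exceeds 1/2 (\<open>square_le_fractional_norm\<close>). The square of this seminorm
  is again an energy distance, now with a kernel proportional to \<open>|r| powr (-2/5)\<close>
  (\<open>fractional_increment_energy\<close>).

  Averaging over the sphere. For a kernel \<open>k\<close> that is homogeneous of degree \<open>e\<close> under positive dilations, the
  spherical average of \<open>k <v, \<theta>>\<close> is a constant times \<open>|v| powr e\<close>
  (\<open>nn_integral_sphere_homogeneous\<close>): this is the rotation invariance of a Gaussian vector \<open>G\<close> combined with the
  independence of its length and direction. Since the standard normal law is the law of \<open><G, \<theta>>\<close> for every
  unit vector \<open>\<theta>\<close>, the averaged energies become \<open>E |X - X'| powr e\<close>, \<open>E |X - G| powr e\<close> and
  \<open>E |G - G'| powr e\<close>, with a common constant (\<open>sphere_average_energy\<close>).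

  Cancellation. As \<open>|X|\<^sup>2 = n\<close>, the squared lengths divided by \<open>2 n\<close> are \<open>1 - xi\<close>, \<open>1 - zeta\<close> and
  \<open>1 - kappa\<close>, where \<open>xi\<close>, \<open>zeta\<close>, \<open>kappa\<close> have mean zero and variances \<open>1 / n\<close>,
  \<open>3 / (2 n)\<close>, \<open>2 / n\<close>. In a Taylor expansion of \<open>(1 - x) powr (e / 2)\<close> the first-order terms vanish in
  mean, and the second-order terms cancel in the energy distance, because twice \<open>3 / (2 n)\<close> equals
  \<open>1 / n + 2 / n\<close>. What remains is governed by the third moments, which are at most of order \<open>n\<close> to the power -2, and
  by a remainder of the same order, which is estimated by tenth moments of order \<open>n\<close> to the power -5 and a crude bound for
  a negative moment of the squared lengths (\<open>sqrt_energy_bounds\<close>, \<open>fifth_root_energy_bounds\<close>,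
  \<open>energy_cancellation\<close>).

  Lacunarity. The frequencies enter only through \<open>xi = (1 / N) \<Sum> cos (m\<^sub>k (t - s))\<close> with \<open>n = 2 N\<close>. Its third moment counts the
  solutions of \<open>m\<^sub>j + m\<^sub>k = m\<^sub>l\<close>, of which there are \<open>O(N)\<close> (\<open>additive_relations_le\<close>). For its tenth
  moment the indices are split into residue classes, with a modulus for which frequencies at least double within a class;
  there exponential moments are bounded by Riesz products (\<open>riesz_product_mean\<close>,
  \<open>dissociate_exp_moment\<close>).

  The resulting bound for the mean of \<open>\<rho>\<^sup>2\<close> is again a multiple of \<open>1 / n\<^sup>2\<close>, and
  \<open>ln n \<ge> ln 2\<close>.
\<close>

declare One_nat_def [simp del]

section \<open>The uniform measure on the sphere and Gaussian vectors\<close>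

lemma nn_integral_swap:
  assumes "sigma_finite_measure A" "sigma_finite_measure B"
    and "case_prod f \<in> borel_measurable (A \<Otimes>\<^sub>M B)"
  shows "(\<integral>\<^sup>+x. \<integral>\<^sup>+y. f x y \<partial>B \<partial>A) = (\<integral>\<^sup>+y. \<integral>\<^sup>+x. f x y \<partial>A \<partial>B)"
proof -
  interpret pair_sigma_finite A B
    using assms by (simp add: pair_sigma_finite_def)
  show ?thesis
    using Fubini'[OF assms(3)] by simp
qed

abbreviation lebesgue_n :: "nat \<Rightarrow> (nat \<Rightarrow> real) measure" where
  "lebesgue_n n \<equiv> PiM {1..n} (\<lambda>_. lborel)"

definition gauss :: "nat \<Rightarrow> (nat \<Rightarrow> real) measure" where
  "gauss n = PiM {1..n} (\<lambda>_. std_normal_distribution)"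

lemma sigma_finite_lebesgue_n: "sigma_finite_measure (lebesgue_n n)"
proof -
  interpret finite_product_sigma_finite "\<lambda>_. lborel :: real measure" "{1..n}"
    by standard auto
  show ?thesis by (rule sigma_finite_measure_axioms)
qed

lemma prob_space_gauss: "prob_space (gauss n)"
  unfolding gauss_def by (intro prob_space_PiM prob_space_normal_density) simp

lemma sets_gauss [measurable_cong]: "sets (gauss n) = sets (PiM {1..n} (\<lambda>_. borel))"
  unfolding gauss_def by (intro sets_PiM_cong) auto

lemma euclid_inner_measurable [measurable (raw)]:
  assumes [measurable]: "\<And>i. i \<in> {1..n} \<Longrightarrow> (\<lambda>x. f x i) \<in> borel_measurable M"
    "\<And>i. i \<in> {1..n} \<Longrightarrow> (\<lambda>x. g x i) \<in> borel_measurable M"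
  shows "(\<lambda>x. euclid_inner n (f x) (g x)) \<in> borel_measurable M"
  unfolding euclid_inner_def by measurable

lemma euclid_norm_measurable_comp [measurable (raw)]:
  assumes [measurable]: "\<And>i. i \<in> {1..n} \<Longrightarrow> (\<lambda>x. f x i) \<in> borel_measurable M"
  shows "(\<lambda>x. euclid_norm n (f x)) \<in> borel_measurable M"
  unfolding euclid_norm_def by measurable

lemma euclid_norm_nonneg: "euclid_norm n x \<ge> 0"
  by (simp add: euclid_norm_def euclid_inner_def sum_nonneg)

lemma euclid_norm_power2: "(euclid_norm n x)\<^sup>2 = (\<Sum>i=1..n. (x i)\<^sup>2)"
  by (simp add: euclid_norm_def euclid_inner_def sum_nonneg power2_eq_square[symmetric])

definition dilate :: "nat \<Rightarrow> real \<Rightarrow> (nat \<Rightarrow> real) \<Rightarrow> nat \<Rightarrow> real" where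
  "dilate n c x = (\<lambda>i\<in>{1..n}. c * x i)"

lemma dilate_measurable [measurable]: "dilate n c \<in> lebesgue_n n \<rightarrow>\<^sub>M lebesgue_n n"
  unfolding dilate_def[abs_def] by measurable

lemma euclid_norm_dilate: "c > 0 \<Longrightarrow> euclid_norm n (dilate n c x) = c * euclid_norm n x"
proof -
  assume "c > 0"
  have "euclid_inner n (dilate n c x) (dilate n c x) = c\<^sup>2 * euclid_inner n x x"
    by (simp add: euclid_inner_def dilate_def sum_distrib_left power2_eq_square mult_ac)
  then show ?thesis using \<open>c > 0\<close> by (simp add: euclid_norm_def real_sqrt_mult)
qed

lemma radial_proj_dilate: "c > 0 \<Longrightarrow> radial_proj n (dilate n c x) = radial_proj n x"
  unfolding radial_proj_def euclid_norm_dilate by (auto simp: fun_eq_iff dilate_def)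

text \<open>
  The measure with density \<open>c ^ n\<close> with respect to the image of Lebesgue measure under the dilation agrees with
  Lebesgue measure on boxes, since each coordinate scales by \<open>c\<close>; boxes determine a product measure.
\<close>

lemma nn_integral_lebesgue_n_dilate:
  assumes c: "c > 0" and g[measurable]: "g \<in> borel_measurable (lebesgue_n n)"
  shows "(\<integral>\<^sup>+x. g x \<partial>lebesgue_n n) = ennreal (c ^ n) * (\<integral>\<^sup>+x. g (dilate n c x) \<partial>lebesgue_n n)"
proof -
  interpret product_sigma_finite "\<lambda>_::nat. lborel :: real measure"
    by standard
  interpret finite_product_sigma_finite "\<lambda>_. lborel :: real measure" "{1..n}"
    by standard auto
  let ?L = "lebesgue_n n"
  have "density (distr ?L ?L (dilate n c)) (\<lambda>_. ennreal (c ^ n)) = ?L"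
  proof (rule PiM_eqI)
    fix A :: "nat \<Rightarrow> real set" assume A: "\<And>i. i \<in> {1..n} \<Longrightarrow> A i \<in> sets lborel"
    then have PA [measurable]: "Pi\<^sub>E {1..n} A \<in> sets ?L"
      by (intro sets_PiM_I_finite) auto
    have sc: "emeasure lborel (A i) = ennreal c * emeasure lborel ((*) c -` A i)" if "i \<in> {1..n}" for i
    proof -
      have [measurable]: "A i \<in> sets borel" using A[OF that] by simp
      have "emeasure lborel (A i) = (\<integral>\<^sup>+x. indicator (A i) x \<partial>lborel)" by simp
      also have "\<dots> = ennreal c * (\<integral>\<^sup>+x. indicator (A i) (0 + c * x) \<partial>lborel)"
        using c by (subst nn_integral_real_affine[of _ c 0]) auto
      also have "(\<integral>\<^sup>+x. indicator (A i) (0 + c * x) \<partial>lborel) = (\<integral>\<^sup>+x. indicator ((*) c -` A i) x \<partial>lborel)"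
        by (intro nn_integral_cong) (auto simp: indicator_def)
      also have "\<dots> = emeasure lborel ((*) c -` A i)"
        by (subst nn_integral_indicator) (auto intro: measurable_sets_borel[OF _ \<open>A i \<in> sets borel\<close>])
      finally show ?thesis .
    qed
    have pre: "dilate n c -` Pi\<^sub>E {1..n} A \<inter> space ?L = Pi\<^sub>E {1..n} (\<lambda>i. (*) c -` A i)"
      by (auto simp: dilate_def space_PiM PiE_iff)
    have "emeasure (density (distr ?L ?L (dilate n c)) (\<lambda>_. ennreal (c ^ n))) (Pi\<^sub>E {1..n} A)
        = ennreal (c ^ n) * emeasure ?L (Pi\<^sub>E {1..n} (\<lambda>i. (*) c -` A i))"
      by (subst emeasure_density_const) (simp_all add: emeasure_distr pre)
    also have "emeasure ?L (Pi\<^sub>E {1..n} (\<lambda>i. (*) c -` A i)) = (\<Prod>i\<in>{1..n}. emeasure lborel ((*) c -` A i))"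
    proof (rule measure_times)
      fix i assume "i \<in> {1..n}"
      then have *: "A i \<in> sets borel" using A by simp
      show "(*) c -` A i \<in> sets lborel"
        using measurable_sets_borel[OF _ *, of "(*) c"] by simp
    qed
    also have "ennreal (c ^ n) * \<dots> = (\<Prod>i\<in>{1..n}. ennreal c * emeasure lborel ((*) c -` A i))"
      using c by (simp add: prod.distrib ennreal_power)
    also have "\<dots> = (\<Prod>i\<in>{1..n}. emeasure lborel (A i))"
      by (intro prod.cong refl sc[symmetric])
    finally show "emeasure (density (distr ?L ?L (dilate n c)) (\<lambda>_. ennreal (c ^ n))) (Pi\<^sub>E {1..n} A)
        = (\<Prod>i\<in>{1..n}. emeasure lborel (A i))" .
  qed auto
  then have "(\<integral>\<^sup>+x. g x \<partial>?L) = (\<integral>\<^sup>+x. g x \<partial>density (distr ?L ?L (dilate n c)) (\<lambda>_. ennreal (c ^ n)))"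
    by simp
  also have "\<dots> = ennreal (c ^ n) * (\<integral>\<^sup>+x. g (dilate n c x) \<partial>?L)"
    by (subst nn_integral_density) (simp_all add: nn_integral_distr nn_integral_cmult)
  finally show ?thesis .
qed

text \<open>
  The product of the one-dimensional densities depends on the length only. Polar coordinates therefore make the
  length and the direction of a Gaussian vector independent.
\<close>

lemma gauss_density:
  "gauss n = density (lebesgue_n n) (\<lambda>x. ennreal ((1 / sqrt (2 * pi)) ^ n * exp (- (euclid_norm n x)\<^sup>2 / 2)))"
proof -
  interpret N: product_sigma_finite "\<lambda>_::nat. std_normal_distribution"
    by (intro product_sigma_finite.intro prob_space_imp_sigma_finite prob_space_normal_density) simp
  interpret product_sigma_finite "\<lambda>_::nat. lborel :: real measure"
    by standard
  let ?L = "lebesgue_n n"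
  let ?d = "\<lambda>x. ennreal ((1 / sqrt (2 * pi)) ^ n * exp (- (euclid_norm n x)\<^sup>2 / 2))"
  have d: "?d x = (\<Prod>i=1..n. ennreal (std_normal_density (x i)))" for x
    by (simp add: prod_ennreal std_normal_density_def euclid_norm_power2 exp_sum[symmetric] prod.distrib
        sum_divide_distrib sum_negf prod_dividef power_divide)
  have "density ?L ?d = gauss n"
    unfolding gauss_def
  proof (rule N.PiM_eqI)
    fix A :: "nat \<Rightarrow> real set" assume A: "\<And>i. i \<in> {1..n} \<Longrightarrow> A i \<in> sets std_normal_distribution"
    then have PA [measurable]: "Pi\<^sub>E {1..n} A \<in> sets ?L"
      by (intro sets_PiM_I_finite) auto
    have "emeasure (density ?L ?d) (Pi\<^sub>E {1..n} A) = (\<integral>\<^sup>+x. ?d x * indicator (Pi\<^sub>E {1..n} A) x \<partial>?L)"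
      by (subst emeasure_density) simp_all
    also have "\<dots> = (\<integral>\<^sup>+x. (\<Prod>i=1..n. ennreal (std_normal_density (x i)) * indicator (A i) (x i)) \<partial>?L)"
    proof (intro nn_integral_cong)
      fix x :: "nat \<Rightarrow> real" assume "x \<in> space ?L"
      then have "(indicator (Pi\<^sub>E {1..n} A) x :: ennreal) = (\<Prod>i=1..n. indicator (A i) (x i))"
        by (auto simp: space_PiM PiE_iff indicator_def)
      then show "?d x * indicator (Pi\<^sub>E {1..n} A) x
        = (\<Prod>i=1..n. ennreal (std_normal_density (x i)) * indicator (A i) (x i))"
        unfolding d by (simp add: prod.distrib)
    qed
    also have "\<dots> = (\<Prod>i=1..n. \<integral>\<^sup>+x. ennreal (std_normal_density x) * indicator (A i) x \<partial>lborel)"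
      using A by (intro product_nn_integral_prod) auto
    also have "\<dots> = (\<Prod>i=1..n. emeasure std_normal_distribution (A i))"
      using A by (intro prod.cong refl, subst emeasure_density) auto
    finally show "emeasure (density ?L ?d) (Pi\<^sub>E {1..n} A)
      = (\<Prod>i=1..n. emeasure std_normal_distribution (A i))" .
  qed (auto intro!: sets_PiM_cong)
  then show ?thesis by simp
qed

text \<open>
  The weight, which is the length to the power \<open>-n\<close>, compensates the Jacobian of a dilation. The integral is therefore
  invariant under dilations of the radial function \<open>h\<close>; in polar coordinates it is the surface integral of
  \<open>f\<close> times the integral of \<open>h s / s\<close>.
\<close>

definition polar_integral :: "nat \<Rightarrow> ((nat \<Rightarrow> real) \<Rightarrow> ennreal) \<Rightarrow> (real \<Rightarrow> ennreal) \<Rightarrow> ennreal" where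
  "polar_integral n f h
    = (\<integral>\<^sup>+x. h (euclid_norm n x) * (f (radial_proj n x) * ennreal ((1 / euclid_norm n x) ^ n)) \<partial>lebesgue_n n)"

text \<open>
  The integral against \<open>ds / s\<close> on the positive half-line: for \<open>s \<le> 0\<close> the factor \<open>ennreal (1 / s)\<close>
  vanishes.
\<close>

definition mellin_integral :: "(real \<Rightarrow> ennreal) \<Rightarrow> ennreal" where
  "mellin_integral h = (\<integral>\<^sup>+s. h s * ennreal (1 / s) \<partial>lborel)"

lemma polar_integral_dilate:
  assumes c: "c > 0" and [measurable]: "f \<in> borel_measurable (PiM {1..n} (\<lambda>_. borel))" "h \<in> borel_measurable borel"
  shows "polar_integral n f (\<lambda>r. h (c * r)) = polar_integral n f h"
proof -
  let ?r = "euclid_norm n"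
  let ?g = "\<lambda>x. h (c * ?r x) * (f (radial_proj n x) * ennreal ((1 / (c * ?r x)) ^ n))"
  have "polar_integral n f h = ennreal (c ^ n) * (\<integral>\<^sup>+x. ?g x \<partial>lebesgue_n n)"
    unfolding polar_integral_def
    by (subst nn_integral_lebesgue_n_dilate[OF c]) (use c in \<open>simp_all add: euclid_norm_dilate radial_proj_dilate\<close>)
  also have "\<dots> = (\<integral>\<^sup>+x. ennreal (c ^ n) * ?g x \<partial>lebesgue_n n)"
    by (subst nn_integral_cmult) simp_all
  also have "\<dots> = polar_integral n f (\<lambda>r. h (c * r))"
    unfolding polar_integral_def
  proof (intro nn_integral_cong)
    fix x
    have "(1 / ?r x) ^ n = c ^ n * (1 / (c * ?r x)) ^ n"
      using c by (simp add: power_mult_distrib power_divide)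
    then have "ennreal ((1 / ?r x) ^ n) = ennreal (c ^ n) * ennreal ((1 / (c * ?r x)) ^ n)"
      using c by (simp add: ennreal_mult euclid_norm_nonneg)
    then show "ennreal (c ^ n) * ?g x = h (c * ?r x) * (f (radial_proj n x) * ennreal ((1 / ?r x) ^ n))"
      by (simp add: mult_ac)
  qed
  finally show ?thesis by simp
qed

text \<open>
  Fubini's theorem in place of polar coordinates. By dilation invariance,
  \<open>h1\<close> may be replaced by \<open>h1 (s * r)\<close> for each \<open>s > 0\<close>; integrating against \<open>h2 s ds / s\<close>, exchanging the
  integrals and substituting \<open>s / r\<close> for \<open>s\<close> moves all dependence on \<open>h1\<close> into a factor that does not see
  \<open>f\<close>.
\<close>

lemma polar_exchange:
  fixes f :: "(nat \<Rightarrow> real) \<Rightarrow> ennreal" and h1 h2 :: "real \<Rightarrow> ennreal"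
  assumes n: "n \<ge> 1" and [measurable]: "f \<in> borel_measurable (PiM {1..n} (\<lambda>_. borel))"
    "h1 \<in> borel_measurable borel" "h2 \<in> borel_measurable borel"
  shows "polar_integral n f h1 * mellin_integral h2 = mellin_integral h1 * polar_integral n f (\<lambda>r. h2 (1 / r))"
proof -
  let ?L = "lebesgue_n n" and ?r = "euclid_norm n"
  let ?v = "\<lambda>s::real. ennreal (1 / s)"
  define w where "w x = f (radial_proj n x) * ennreal ((1 / ?r x) ^ n)" for x
  have [measurable]: "w \<in> borel_measurable ?L" unfolding w_def[abs_def] by measurable
  have I: "polar_integral n f h = (\<integral>\<^sup>+x. h (?r x) * w x \<partial>?L)" for h by (simp add: polar_integral_def w_def)
  have v0: "?v s = 0" if "\<not> s > 0" for s using that by (simp add: ennreal_neg)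
  have "polar_integral n f h1 * mellin_integral h2 = (\<integral>\<^sup>+s. polar_integral n f h1 * (h2 s * ?v s) \<partial>lborel)"
    unfolding mellin_integral_def by (subst nn_integral_cmult) simp_all
  also have "\<dots> = (\<integral>\<^sup>+s. (\<integral>\<^sup>+x. h1 (s * ?r x) * w x \<partial>?L) * (h2 s * ?v s) \<partial>lborel)"
  proof (intro nn_integral_cong)
    fix s :: real
    show "polar_integral n f h1 * (h2 s * ?v s) = (\<integral>\<^sup>+x. h1 (s * ?r x) * w x \<partial>?L) * (h2 s * ?v s)"
      using polar_integral_dilate[of s f n h1] by (cases "s > 0") (simp_all add: v0 I)
  qed
  also have "\<dots> = (\<integral>\<^sup>+s. (\<integral>\<^sup>+x. h1 (s * ?r x) * w x * (h2 s * ?v s) \<partial>?L) \<partial>lborel)"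
    by (intro nn_integral_cong, subst nn_integral_multc) simp_all
  also have "\<dots> = (\<integral>\<^sup>+x. (\<integral>\<^sup>+s. h1 (s * ?r x) * w x * (h2 s * ?v s) \<partial>lborel) \<partial>?L)"
    by (intro nn_integral_swap sigma_finite_lebesgue_n sigma_finite_lborel) measurable
  also have "\<dots> = (\<integral>\<^sup>+x. (\<integral>\<^sup>+s. h1 s * w x * (h2 (s / ?r x) * ?v s) \<partial>lborel) \<partial>?L)"
  proof (rule nn_integral_cong)
    fix x
    show "(\<integral>\<^sup>+s. h1 (s * ?r x) * w x * (h2 s * ?v s) \<partial>lborel) = (\<integral>\<^sup>+s. h1 s * w x * (h2 (s / ?r x) * ?v s) \<partial>lborel)"
    proof (cases "?r x = 0")
      case True
      then have "w x = 0" using n by (simp add: w_def)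
      then show ?thesis by simp
    next
      case False
      then have r: "?r x > 0" using euclid_norm_nonneg[of n x] by simp
      let ?g = "\<lambda>s. h1 s * w x * (h2 (s / ?r x) * ?v s)"
      have "(\<integral>\<^sup>+s. ?g s \<partial>lborel) = ennreal (?r x) * (\<integral>\<^sup>+s. ?g (0 + ?r x * s) \<partial>lborel)"
        using r by (subst nn_integral_real_affine[of _ "?r x" 0]) simp_all
      also have "\<dots> = (\<integral>\<^sup>+s. ennreal (?r x) * ?g (0 + ?r x * s) \<partial>lborel)"
        by (rule nn_integral_cmult[symmetric]) simp
      also have "\<dots> = (\<integral>\<^sup>+s. h1 (s * ?r x) * w x * (h2 s * ?v s) \<partial>lborel)"
      proof (intro nn_integral_cong)
        fix s :: real
        have e: "ennreal (?r x) * ?v (s * ?r x) = ?v s"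
          using r by (subst ennreal_mult'[symmetric]) auto
        have "ennreal (?r x) * ?g (0 + ?r x * s) = h1 (s * ?r x) * w x * (h2 s * (ennreal (?r x) * ?v (s * ?r x)))"
          using r by (simp add: mult_ac)
        then show "ennreal (?r x) * ?g (0 + ?r x * s) = h1 (s * ?r x) * w x * (h2 s * ?v s)"
          unfolding e .
      qed
      finally show ?thesis by simp
    qed
  qed
  also have "\<dots> = (\<integral>\<^sup>+s. (\<integral>\<^sup>+x. h1 s * w x * (h2 (s / ?r x) * ?v s) \<partial>?L) \<partial>lborel)"
    by (intro nn_integral_swap[symmetric] sigma_finite_lebesgue_n sigma_finite_lborel) measurable
  also have "\<dots> = (\<integral>\<^sup>+s. h1 s * ?v s * polar_integral n f (\<lambda>r. h2 (1 / r)) \<partial>lborel)"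
  proof (rule nn_integral_cong)
    fix s :: real
    have "(\<integral>\<^sup>+x. h1 s * w x * (h2 (s / ?r x) * ?v s) \<partial>?L) = (\<integral>\<^sup>+x. h1 s * ?v s * (h2 (s / ?r x) * w x) \<partial>?L)"
      by (simp add: mult_ac)
    also have "\<dots> = h1 s * ?v s * (\<integral>\<^sup>+x. h2 (s / ?r x) * w x \<partial>?L)"
      by (rule nn_integral_cmult) simp
    also have "\<dots> = h1 s * ?v s * polar_integral n f (\<lambda>r. h2 (1 / r))"
      using polar_integral_dilate[of "1 / s" f n "\<lambda>r. h2 (1 / r)"] by (cases "s > 0") (simp_all add: v0 I)
    finally show "(\<integral>\<^sup>+x. h1 s * w x * (h2 (s / ?r x) * ?v s) \<partial>?L)
       = h1 s * ?v s * polar_integral n f (\<lambda>r. h2 (1 / r))" .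
  qed
  also have "\<dots> = mellin_integral h1 * polar_integral n f (\<lambda>r. h2 (1 / r))"
    unfolding mellin_integral_def by (rule nn_integral_multc) simp
  finally show ?thesis .
qed

lemma sets_sphere_measure:
  "sets (sphere_measure n) = sets (restrict_space (PiM {1..n} (\<lambda>_. borel)) (unit_sphere n))"
  unfolding sphere_measure_def by (intro sets_restrict_space_cong) simp

text \<open>
  Almost every point is nonzero and is projected to the sphere, so the restriction to the sphere in the definition
  of the uniform measure costs nothing.
\<close>

lemma nn_integral_sphere_measure:
  assumes n: "n \<ge> 1" and f [measurable]: "f \<in> borel_measurable (PiM {1..n} (\<lambda>_. borel))"
  shows "(\<integral>\<^sup>+\<theta>. f \<theta> \<partial>sphere_measure n)
    = (\<integral>\<^sup>+x. f (radial_proj n x) * indicator (unit_ball n) x \<partial>lebesgue_n n) / emeasure (lebesgue_n n) (unit_ball n)"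
proof -
  let ?L = "lebesgue_n n"
  let ?U = "uniform_measure ?L (unit_ball n)"
  have [measurable]: "radial_proj n \<in> ?U \<rightarrow>\<^sub>M PiM {1..n} (\<lambda>_. borel)"
    using radial_proj_measurable[of n] by (simp add: measurable_def uniform_measure_def)
  have "(\<integral>\<^sup>+\<theta>. f \<theta> \<partial>sphere_measure n)
      = (\<integral>\<^sup>+\<theta>. f \<theta> * indicator (unit_sphere n) \<theta> \<partial>distr ?U (PiM {1..n} (\<lambda>_. borel)) (radial_proj n))"
    unfolding sphere_measure_def by (intro nn_integral_restrict_space) (simp add: sets.Int)
  also have "\<dots> = (\<integral>\<^sup>+x. f (radial_proj n x) * indicator (unit_sphere n) (radial_proj n x) \<partial>?U)"
    by (subst nn_integral_distr) simp_all
  also have "\<dots> = (\<integral>\<^sup>+x. f (radial_proj n x) * indicator (unit_sphere n) (radial_proj n x) * indicator (unit_ball n) x \<partial>?L)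
       / emeasure ?L (unit_ball n)"
    by (rule nn_integral_uniform_measure) measurable
  also have "(\<integral>\<^sup>+x. f (radial_proj n x) * indicator (unit_sphere n) (radial_proj n x) * indicator (unit_ball n) x \<partial>?L)
     = (\<integral>\<^sup>+x. f (radial_proj n x) * indicator (unit_ball n) x \<partial>?L)"
  proof (rule nn_integral_cong_AE)
    have "radial_proj n x \<in> unit_sphere n" if "euclid_norm n x \<noteq> 0" for x
      using euclid_norm_radial_proj[OF that] by (simp add: unit_sphere_def radial_proj_def)
    with AE_euclid_norm_neq_0[OF n]
    show "AE x in ?L. f (radial_proj n x) * indicator (unit_sphere n) (radial_proj n x) * indicator (unit_ball n) x
        = f (radial_proj n x) * indicator (unit_ball n) x"
      by (auto elim!: eventually_mono)
  qed
  finally show ?thesis .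
qed

text \<open>
  Length and direction of a Gaussian vector are independent, and the direction is uniform. Both the Gaussian integral and
  the integral over the unit ball that defines the uniform measure have the form \<open>polar_integral n f h\<close>, for different
  \<open>h\<close>. By \<open>polar_exchange\<close> the ratio of two such integrals with the same \<open>h\<close> and different
  \<open>f\<close> does not depend on \<open>h\<close>.
\<close>

theorem gauss_polar:
  fixes f :: "(nat \<Rightarrow> real) \<Rightarrow> ennreal" and h :: "real \<Rightarrow> ennreal"
  assumes n: "n \<ge> 1" and [measurable]: "f \<in> borel_measurable (PiM {1..n} (\<lambda>_. borel))" "h \<in> borel_measurable borel"
  shows "(\<integral>\<^sup>+x. h (euclid_norm n x) * f (radial_proj n x) \<partial>gauss n)
       = (\<integral>\<^sup>+x. h (euclid_norm n x) \<partial>gauss n) * (\<integral>\<^sup>+\<theta>. f \<theta> \<partial>sphere_measure n)"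
proof -
  let ?L = "lebesgue_n n"
  let ?r = "euclid_norm n"
  let ?I = "polar_integral n" and ?M = mellin_integral
  define d where "d r = ennreal ((1 / sqrt (2 * pi)) ^ n * exp (- r\<^sup>2 / 2))" for r :: real
  define H where "H r = h r * d r * ennreal (r ^ n)" for r
  define b :: "real \<Rightarrow> ennreal" where "b r = indicator {..1} r * ennreal (r ^ n)" for r
  \<comment> \<open>any function with finite and nonzero Mellin integral would do\<close>
  define u :: "real \<Rightarrow> ennreal" where "u = indicator {1..2}"
  have [measurable]: "d \<in> borel_measurable borel" "H \<in> borel_measurable borel" "b \<in> borel_measurable borel"
    "u \<in> borel_measurable borel"
    unfolding d_def[abs_def] H_def[abs_def] b_def[abs_def] u_def by measurable
  have ex: "?I g k * ?M u = ?M k * ?I g (\<lambda>r. u (1 / r))"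
    if "g \<in> borel_measurable (PiM {1..n} (\<lambda>_. borel))" "k \<in> borel_measurable borel" for g k
    using polar_exchange[of n g k u] n that by simp
  have canc: "ennreal (r ^ n) * ennreal ((1 / r) ^ n) = 1" if "r > 0" for r :: real
    using that by (simp add: ennreal_mult'[symmetric] power_mult_distrib[symmetric])
  have pos: "AE x in ?L. ?r x > 0"
    using AE_euclid_norm_neq_0[OF n] by eventually_elim (use euclid_norm_nonneg[of n] in \<open>simp add: less_le\<close>)
  have gaussI: "(\<integral>\<^sup>+x. h (?r x) * g (radial_proj n x) \<partial>gauss n) = ?I g H"
    if [measurable]: "g \<in> borel_measurable (PiM {1..n} (\<lambda>_. borel))" for g
  proof -
    have "(\<integral>\<^sup>+x. h (?r x) * g (radial_proj n x) \<partial>gauss n) = (\<integral>\<^sup>+x. d (?r x) * (h (?r x) * g (radial_proj n x)) \<partial>?L)"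
      unfolding gauss_density d_def by (subst nn_integral_density) simp_all
    also have "\<dots> = ?I g H"
      unfolding polar_integral_def
    proof (rule nn_integral_cong_AE)
      show "AE x in ?L. d (?r x) * (h (?r x) * g (radial_proj n x))
          = H (?r x) * (g (radial_proj n x) * ennreal ((1 / ?r x) ^ n))"
        using pos
      proof eventually_elim
        case (elim x)
        have "H (?r x) * (g (radial_proj n x) * ennreal ((1 / ?r x) ^ n))
          = h (?r x) * d (?r x) * g (radial_proj n x) * (ennreal (?r x ^ n) * ennreal ((1 / ?r x) ^ n))"
          unfolding H_def by (simp only: mult_ac)
        then show ?case using canc[OF elim] by (simp add: mult_ac)
      qed
    qed
    finally show ?thesis .
  qed
  have ballI: "(\<integral>\<^sup>+x. g (radial_proj n x) * indicator (unit_ball n) x \<partial>?L) = ?I g b"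
    if [measurable]: "g \<in> borel_measurable (PiM {1..n} (\<lambda>_. borel))" for g
    unfolding polar_integral_def
  proof (rule nn_integral_cong_AE)
    show "AE x in ?L. g (radial_proj n x) * indicator (unit_ball n) x
        = b (?r x) * (g (radial_proj n x) * ennreal ((1 / ?r x) ^ n))"
      using pos AE_space
    proof eventually_elim
      case (elim x)
      have "b (?r x) * (g (radial_proj n x) * ennreal ((1 / ?r x) ^ n))
        = indicator {..1} (?r x) * g (radial_proj n x) * (ennreal (?r x ^ n) * ennreal ((1 / ?r x) ^ n))"
        unfolding b_def by (simp only: mult_ac)
      moreover have "(indicator {..1} (?r x) :: ennreal) = indicator (unit_ball n) x"
        using elim by (auto simp: unit_ball_def space_PiM indicator_def)
      ultimately show ?case using canc elim by (simp add: mult_ac)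
    qed
  qed
  let ?B = "emeasure ?L (unit_ball n)"
  have B: "?I (\<lambda>_. 1) b = ?B"
    using ballI[of "\<lambda>_. 1"] by simp
  have M_le: "?M u \<le> 1"
  proof -
    have "?M u \<le> (\<integral>\<^sup>+s. indicator {1..2::real} s \<partial>lborel)"
      unfolding mellin_integral_def u_def
      by (intro nn_integral_mono) (auto simp: indicator_def intro!: ennreal_le_1[THEN iffD2])
    then show ?thesis by simp
  qed
  have "ennreal (1/2) = (\<integral>\<^sup>+s. ennreal (1/2) * indicator {1..2::real} s \<partial>lborel)"
    by (subst nn_integral_cmult) simp_all
  also have "\<dots> \<le> ?M u"
    unfolding mellin_integral_def u_def
  proof (rule nn_integral_mono)
    fix s :: real
    have "ennreal (1/2) \<le> ennreal (1/s)" if "s \<in> {1..2}"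
      using that by (intro ennreal_leI) (simp add: field_simps)
    then show "ennreal (1/2) * indicator {1..2} s \<le> indicator {1..2} s * ennreal (1 / s)"
      by (simp add: indicator_def)
  qed
  finally have M0: "?M u \<noteq> 0"
    by (metis ennreal_eq_0_iff le_zero_eq not_le half_gt_zero zero_less_one)
  have Mtop: "?M u \<noteq> \<infinity>" using M_le by (auto simp: top_unique)
  have ex1: "?I f H * ?M u = ?M H * ?I f (\<lambda>r. u (1 / r))" and ex2: "?I f b * ?M u = ?M b * ?I f (\<lambda>r. u (1 / r))"
    and ex3: "?I (\<lambda>_. 1) H * ?M u = ?M H * ?I (\<lambda>_. 1) (\<lambda>r. u (1 / r))"
    and ex4: "?I (\<lambda>_. 1) b * ?M u = ?M b * ?I (\<lambda>_. 1) (\<lambda>r. u (1 / r))"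
    by (simp_all add: ex)
  have "(?I f H * ?B) * (?M u * ?M u) = (?I f H * ?M u) * (?I (\<lambda>_. 1) b * ?M u)"
    by (simp only: B mult_ac)
  also have "\<dots> = (?I (\<lambda>_. 1) H * ?M u) * (?I f b * ?M u)"
    unfolding ex1 ex2 ex3 ex4 by (simp only: mult_ac)
  also have "\<dots> = (?I (\<lambda>_. 1) H * ?I f b) * (?M u * ?M u)"
    by (simp only: mult_ac)
  finally have eq: "?I f H * ?B = ?I (\<lambda>_. 1) H * ?I f b"
    using M0 Mtop by (auto simp: mult.commute[of _ "?M u * ?M u"] ennreal_mult_cancel_left ennreal_mult_eq_top_iff)
  have "?I f H = ?I (\<lambda>_. 1) H * (?I f b / ?B)"
    using emeasure_unit_ball[OF n] by (simp add: ennreal_times_divide eq[symmetric] mult_divide_eq_ennreal)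
  then show ?thesis
    using gaussI[of f] gaussI[of "\<lambda>_. 1"] ballI[of f] nn_integral_sphere_measure[OF n, of f] by simp
qed

lemma indep_vars_gauss:
  assumes n: "n \<ge> 1"
  shows "prob_space.indep_vars (gauss n) (\<lambda>_. borel) (\<lambda>i x. x i) {1..n}"
proof -
  interpret prob_space "gauss n" by (rule prob_space_gauss)
  have comp: "distr (gauss n) borel (\<lambda>x. x i) = std_normal_distribution" if "i \<in> {1..n}" for i
  proof -
    have "distr (gauss n) borel (\<lambda>x. x i) = distr (gauss n) std_normal_distribution (\<lambda>x. x i)"
      by (intro distr_cong) simp_all
    also have "\<dots> = std_normal_distribution"
      unfolding gauss_def using that by (intro distr_PiM_component prob_space_normal_density) simp_all
    finally show ?thesis .
  qed
  show ?thesis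
  proof (subst indep_vars_iff_distr_eq_PiM')
    have "distr (gauss n) (PiM {1..n} (\<lambda>_. borel)) (\<lambda>x. \<lambda>i\<in>{1..n}. x i) = distr (gauss n) (gauss n) (\<lambda>x. x)"
    proof (rule distr_cong)
      fix x assume "x \<in> space (gauss n)"
      then show "(\<lambda>i\<in>{1..n}. x i) = x"
        by (auto simp: gauss_def space_PiM PiE_iff extensional_def fun_eq_iff)
    qed (simp_all add: sets_gauss)
    also have "\<dots> = PiM {1..n} (\<lambda>i. distr (gauss n) borel (\<lambda>x. x i))"
      unfolding distr_id by (subst gauss_def, intro PiM_cong) (simp_all add: comp)
    finally show "distr (gauss n) (PiM {1..n} (\<lambda>_. borel)) (\<lambda>x. \<lambda>i\<in>{1..n}. x i)
       = PiM {1..n} (\<lambda>i. distr (gauss n) borel (\<lambda>x. x i))" .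
  qed (use n in simp_all)
qed

lemma distributed_gauss_component:
  assumes "i \<in> {1..n}"
  shows "distributed (gauss n) lborel (\<lambda>x. x i) std_normal_density"
proof -
  have "distr (gauss n) lborel (\<lambda>x. x i) = distr (gauss n) std_normal_distribution (\<lambda>x. x i)"
    by (intro distr_cong) simp_all
  also have "\<dots> = std_normal_distribution"
    unfolding gauss_def using assms by (intro distr_PiM_component prob_space_normal_density) simp_all
  finally show ?thesis using assms by (simp add: distributed_def)
qed

text \<open>
  A linear form in independent normal variables is normal with variance \<open>|v|\<^sup>2\<close>.
\<close>

lemma nn_integral_gauss_inner:
  assumes v: "euclid_norm n v > 0" and [measurable]: "g \<in> borel_measurable borel"
  shows "(\<integral>\<^sup>+x. g (euclid_inner n v x) \<partial>gauss n) = (\<integral>\<^sup>+z. g (euclid_norm n v * z) \<partial>std_normal_distribution)"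
proof -
  interpret prob_space "gauss n" by (rule prob_space_gauss)
  \<comment> \<open>zero coefficients are dropped, since a normal density needs a positive variance\<close>
  define J where "J = {i \<in> {1..n}. v i \<noteq> 0}"
  have "n \<ge> 1" using v by (cases n) (simp_all add: euclid_norm_def euclid_inner_def)
  have J: "finite J" "J \<noteq> {}"
    using v by (auto simp: J_def less_le euclid_norm_eq_0_iff)
  have "indep_vars (\<lambda>_. borel) (\<lambda>i x. x i) J"
    by (rule indep_vars_subset[OF indep_vars_gauss[OF \<open>n \<ge> 1\<close>]]) (auto simp: J_def)
  then have ind: "indep_vars (\<lambda>_. borel) (\<lambda>i x. v i * x i) J"
    by (rule indep_vars_compose2) simp
  have "distributed (gauss n) lborel (\<lambda>x. \<Sum>i\<in>J. v i * x i) (normal_density (\<Sum>i\<in>J. 0) (sqrt (\<Sum>i\<in>J. \<bar>v i\<bar>\<^sup>2)))"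
  proof (rule sum_indep_normal[OF J ind])
    fix i assume "i \<in> J"
    then show "distributed (gauss n) lborel (\<lambda>x. v i * x i) (normal_density 0 \<bar>v i\<bar>)"
      using normal_density_affine[OF distributed_gauss_component, of i "v i" 0] by (simp add: J_def)
  qed (simp add: J_def)
  moreover have "(\<Sum>i\<in>J. v i * x i) = euclid_inner n v x" for x
    unfolding euclid_inner_def J_def by (rule sum.mono_neutral_left) auto
  moreover have "sqrt (\<Sum>i\<in>J. \<bar>v i\<bar>\<^sup>2) = euclid_norm n v"
    unfolding euclid_norm_def euclid_inner_def J_def
    by (subst sum.mono_neutral_left[of "{1..n}"]) (auto simp: power2_eq_square)
  ultimately have D: "distributed (gauss n) lborel (euclid_inner n v) (normal_density 0 (euclid_norm n v))"
    by simp
  let ?s = "euclid_norm n v"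
  have "(\<integral>\<^sup>+x. g (euclid_inner n v x) \<partial>gauss n) = (\<integral>\<^sup>+z. normal_density 0 ?s z * g z \<partial>lborel)"
    by (rule distributed_nn_integral[OF D, symmetric]) simp
  also have "\<dots> = ennreal ?s * (\<integral>\<^sup>+z. normal_density 0 ?s (0 + ?s * z) * g (0 + ?s * z) \<partial>lborel)"
    using v by (subst nn_integral_real_affine[of _ ?s 0]) simp_all
  also have "\<dots> = (\<integral>\<^sup>+z. ennreal ?s * (normal_density 0 ?s (0 + ?s * z) * g (0 + ?s * z)) \<partial>lborel)"
    by (rule nn_integral_cmult[symmetric]) simp
  also have "\<dots> = (\<integral>\<^sup>+z. ennreal (std_normal_density z) * g (?s * z) \<partial>lborel)"
  proof (intro nn_integral_cong)
    fix z
    have "?s * normal_density 0 ?s (?s * z) = std_normal_density z"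
      using v by (simp add: normal_density_def real_sqrt_mult power_mult_distrib)
    then have "ennreal ?s * ennreal (normal_density 0 ?s (?s * z)) = ennreal (std_normal_density z)"
      using v by (simp add: ennreal_mult'[symmetric])
    then show "ennreal ?s * (normal_density 0 ?s (0 + ?s * z) * g (0 + ?s * z)) = ennreal (std_normal_density z) * g (?s * z)"
      by (simp add: mult.assoc[symmetric])
  qed
  also have "\<dots> = (\<integral>\<^sup>+z. g (?s * z) \<partial>std_normal_distribution)"
    by (subst nn_integral_density) simp_all
  finally show ?thesis .
qed

text \<open>
  Integrate \<open>k <v, x>\<close> over a Gaussian vector in two ways. The scalar product is \<open>|v|\<close> times a
  standard normal variable, which gives the right-hand side by homogeneity; writing \<open>x\<close> as length times direction
  and using the independence of the two factors gives the left-hand side.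
\<close>

lemma nn_integral_sphere_homogeneous:
  fixes k :: "real \<Rightarrow> ennreal"
  assumes n: "n \<ge> 1" and v: "euclid_norm n v > 0" and [measurable]: "k \<in> borel_measurable borel"
    and hom: "\<And>c r. c > 0 \<Longrightarrow> k (c * r) = ennreal (c powr e) * k r"
  shows "(\<integral>\<^sup>+x. ennreal (euclid_norm n x powr e) \<partial>gauss n) * (\<integral>\<^sup>+\<theta>. k (euclid_inner n v \<theta>) \<partial>sphere_measure n)
     = ennreal (euclid_norm n v powr e) * (\<integral>\<^sup>+z. k z \<partial>std_normal_distribution)"
proof -
  have pos: "AE x in gauss n. euclid_norm n x > 0"
  proof -
    have "AE x in lebesgue_n n. euclid_norm n x > 0"
      using AE_euclid_norm_neq_0[OF n] by eventually_elim (use euclid_norm_nonneg[of n] in \<open>simp add: less_le\<close>)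
    then show ?thesis unfolding gauss_density by (subst AE_density) auto
  qed
  have "(\<integral>\<^sup>+x. ennreal (euclid_norm n x powr e) \<partial>gauss n) * (\<integral>\<^sup>+\<theta>. k (euclid_inner n v \<theta>) \<partial>sphere_measure n)
     = (\<integral>\<^sup>+x. ennreal (euclid_norm n x powr e) * k (euclid_inner n v (radial_proj n x)) \<partial>gauss n)"
    by (rule gauss_polar[OF n, symmetric]) measurable
  also have "\<dots> = (\<integral>\<^sup>+x. k (euclid_inner n v x) \<partial>gauss n)"
  proof (rule nn_integral_cong_AE)
    show "AE x in gauss n. ennreal (euclid_norm n x powr e) * k (euclid_inner n v (radial_proj n x)) = k (euclid_inner n v x)"
      using pos
    proof eventually_elim
      case (elim x)
      have "euclid_inner n v x = euclid_norm n x * euclid_inner n v (radial_proj n x)"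
        using elim by (simp add: euclid_inner_def radial_proj_def sum_distrib_left)
      then show ?case using hom[OF elim] by simp
    qed
  qed
  also have "\<dots> = (\<integral>\<^sup>+z. ennreal (euclid_norm n v powr e) * k z \<partial>std_normal_distribution)"
    by (simp add: nn_integral_gauss_inner[OF v] hom[OF v])
  also have "\<dots> = ennreal (euclid_norm n v powr e) * (\<integral>\<^sup>+z. k z \<partial>std_normal_distribution)"
    by (rule nn_integral_cmult) simp
  finally show ?thesis .
qed

section \<open>Distances of distribution functions as energies\<close>

text \<open>
  If \<open>\<integral>\<phi> z d\<mu>\<close> and \<open>\<integral>\<psi> z d\<nu>\<close> are distribution functions or their increments at
  \<open>z\<close>, this turns an integral of their product over the line into an energy.
\<close>

lemma nn_integral_product_kernel:
  fixes \<phi> \<psi> :: "real \<Rightarrow> real \<Rightarrow> ennreal"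
  assumes "sigma_finite_measure \<mu>" "sigma_finite_measure \<nu>"
    and [measurable]: "case_prod \<phi> \<in> borel_measurable (borel \<Otimes>\<^sub>M \<mu>)" "case_prod \<psi> \<in> borel_measurable (borel \<Otimes>\<^sub>M \<nu>)"
  shows "(\<integral>\<^sup>+z. (\<integral>\<^sup>+x. \<phi> z x \<partial>\<mu>) * (\<integral>\<^sup>+y. \<psi> z y \<partial>\<nu>) \<partial>lborel)
       = (\<integral>\<^sup>+x. \<integral>\<^sup>+y. (\<integral>\<^sup>+z. \<phi> z x * \<psi> z y \<partial>lborel) \<partial>\<nu> \<partial>\<mu>)"
proof -
  interpret M: sigma_finite_measure \<mu> by fact
  interpret N: sigma_finite_measure \<nu> by fact
  interpret L: sigma_finite_measure "lborel :: real measure" by (rule sigma_finite_lborel)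
  have "(\<integral>\<^sup>+z. (\<integral>\<^sup>+x. \<phi> z x \<partial>\<mu>) * (\<integral>\<^sup>+y. \<psi> z y \<partial>\<nu>) \<partial>lborel)
      = (\<integral>\<^sup>+z. \<integral>\<^sup>+x. \<phi> z x * (\<integral>\<^sup>+y. \<psi> z y \<partial>\<nu>) \<partial>\<mu> \<partial>lborel)"
    by (intro nn_integral_cong nn_integral_multc[symmetric]) measurable
  also have "\<dots> = (\<integral>\<^sup>+x. \<integral>\<^sup>+z. \<phi> z x * (\<integral>\<^sup>+y. \<psi> z y \<partial>\<nu>) \<partial>lborel \<partial>\<mu>)"
    by (intro nn_integral_swap assms sigma_finite_lborel) measurable
  also have "\<dots> = (\<integral>\<^sup>+x. \<integral>\<^sup>+z. \<integral>\<^sup>+y. \<phi> z x * \<psi> z y \<partial>\<nu> \<partial>lborel \<partial>\<mu>)"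
    by (intro nn_integral_cong nn_integral_cmult[symmetric]) measurable
  also have "\<dots> = (\<integral>\<^sup>+x. \<integral>\<^sup>+y. \<integral>\<^sup>+z. \<phi> z x * \<psi> z y \<partial>lborel \<partial>\<nu> \<partial>\<mu>)"
    by (intro nn_integral_cong nn_integral_swap assms sigma_finite_lborel) measurable
  finally show ?thesis .
qed

definition mutual_energy :: "(real \<Rightarrow> ennreal) \<Rightarrow> real measure \<Rightarrow> real measure \<Rightarrow> ennreal" where
  "mutual_energy k \<mu> \<nu> = (\<integral>\<^sup>+x. \<integral>\<^sup>+y. k (y - x) \<partial>\<nu> \<partial>\<mu>)"

definition pos_kernel :: "real \<Rightarrow> ennreal" where "pos_kernel r = ennreal (max 0 r)"

text \<open>
  The length of the overlap of two windows of length \<open>s\<close> whose left ends differ by \<open>r\<close>.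
\<close>

definition tent_kernel :: "real \<Rightarrow> real \<Rightarrow> ennreal" where "tent_kernel s r = ennreal (max 0 (s - \<bar>r\<bar>))"

lemma pos_kernel_measurable [measurable]: "pos_kernel \<in> borel_measurable borel"
  unfolding pos_kernel_def[abs_def] by measurable

lemma tent_kernel_measurable [measurable (raw)]:
  assumes [measurable]: "f \<in> borel_measurable M" "g \<in> borel_measurable M"
  shows "(\<lambda>x. tent_kernel (f x) (g x)) \<in> borel_measurable M"
  unfolding tent_kernel_def[abs_def] by measurable

lemma cdf_measurable [measurable]: "real_distribution \<mu> \<Longrightarrow> cdf \<mu> \<in> borel_measurable borel"
  by (intro borel_measurable_mono monoI finite_borel_measure.cdf_nondecreasing real_distribution.finite_borel_measure_M)

text \<open>
  The integrand is the probability of \<open>Y \<le> z < Y'\<close> for independent \<open>Y\<close>, \<open>Y'\<close>, and the set of such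
  \<open>z\<close> has length \<open>max 0 (Y' - Y)\<close>.
\<close>

lemma mutual_energy_pos_kernel:
  assumes "real_distribution \<mu>" "real_distribution \<nu>"
  shows "(\<integral>\<^sup>+z. ennreal (cdf \<mu> z * (1 - cdf \<nu> z)) \<partial>lborel) = mutual_energy pos_kernel \<mu> \<nu>"
proof -
  interpret M: real_distribution \<mu> by fact
  interpret N: real_distribution \<nu> by fact
  have a: "(\<integral>\<^sup>+x. indicator {..z} x \<partial>\<mu>) = ennreal (cdf \<mu> z)" for z
    by (simp add: cdf_def M.emeasure_eq_measure)
  have b: "(\<integral>\<^sup>+y. indicator {z<..} y \<partial>\<nu>) = ennreal (1 - cdf \<nu> z)" for z
  proof -
    have "measure \<nu> {z<..} = 1 - measure \<nu> {..z}"
      using N.prob_compl[of "{..z}"] by (simp add: Compl_eq_Diff_UNIV[symmetric])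
    then show ?thesis by (simp add: cdf_def N.emeasure_eq_measure)
  qed
  have "(\<integral>\<^sup>+z. ennreal (cdf \<mu> z * (1 - cdf \<nu> z)) \<partial>lborel)
     = (\<integral>\<^sup>+z. (\<integral>\<^sup>+x. indicator {..z} x \<partial>\<mu>) * (\<integral>\<^sup>+y. indicator {z<..} y \<partial>\<nu>) \<partial>lborel)"
    unfolding a b by (intro nn_integral_cong ennreal_mult) (simp_all add: cdf_def)
  also have "\<dots> = (\<integral>\<^sup>+x. \<integral>\<^sup>+y. (\<integral>\<^sup>+z. indicator {..z} x * indicator {z<..} y \<partial>lborel) \<partial>\<nu> \<partial>\<mu>)"
    by (intro nn_integral_product_kernel M.sigma_finite_measure_axioms N.sigma_finite_measure_axioms)
      (unfold indicator_def atMost_iff greaterThan_iff greaterThanAtMost_iff, measurable)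
  also have "\<dots> = mutual_energy pos_kernel \<mu> \<nu>"
    unfolding mutual_energy_def
  proof (intro nn_integral_cong)
    fix x y :: real
    have "(\<integral>\<^sup>+z. indicator {..z} x * indicator {z<..} y \<partial>lborel) = (\<integral>\<^sup>+z. indicator {x..<y} z \<partial>lborel)"
      by (intro nn_integral_cong) (auto simp: indicator_def)
    then show "(\<integral>\<^sup>+z. indicator {..z} x * indicator {z<..} y \<partial>lborel) = pos_kernel (y - x)"
      by (cases "x \<le> y") (auto simp: pos_kernel_def max_def)
  qed
  finally show ?thesis .
qed

text \<open>
  The integrand is the probability that two independent variables both lie in the window from \<open>z\<close> to
  \<open>z + s\<close>, and \<open>tent_kernel\<close> is the length of the set of \<open>z\<close> for which they do.
\<close>

lemma mutual_energy_tent_kernel: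
  assumes "real_distribution \<mu>" "real_distribution \<nu>" and s: "s > 0"
  shows "(\<integral>\<^sup>+z. ennreal ((cdf \<mu> (z + s) - cdf \<mu> z) * (cdf \<nu> (z + s) - cdf \<nu> z)) \<partial>lborel)
    = mutual_energy (tent_kernel s) \<mu> \<nu>"
proof -
  interpret M: real_distribution \<mu> by fact
  interpret N: real_distribution \<nu> by fact
  have incr: "(\<integral>\<^sup>+x. indicator {z<..z+s} x \<partial>\<eta>) = ennreal (cdf \<eta> (z + s) - cdf \<eta> z)"
    if "real_distribution \<eta>" for z \<eta>
  proof -
    interpret real_distribution \<eta> by fact
    show ?thesis using cdf_diff_eq[of z "z + s"] s by (simp add: emeasure_eq_measure)
  qed
  note M = incr[OF assms(1)] and N = incr[OF assms(2)]
  have "(\<integral>\<^sup>+z. ennreal ((cdf \<mu> (z + s) - cdf \<mu> z) * (cdf \<nu> (z + s) - cdf \<nu> z)) \<partial>lborel)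
     = (\<integral>\<^sup>+z. (\<integral>\<^sup>+x. indicator {z<..z+s} x \<partial>\<mu>) * (\<integral>\<^sup>+y. indicator {z<..z+s} y \<partial>\<nu>) \<partial>lborel)"
    unfolding M N using s
    by (intro nn_integral_cong ennreal_mult) (simp_all add: M.cdf_nondecreasing N.cdf_nondecreasing)
  also have "\<dots> = (\<integral>\<^sup>+x. \<integral>\<^sup>+y. (\<integral>\<^sup>+z. indicator {z<..z+s} x * indicator {z<..z+s} y \<partial>lborel) \<partial>\<nu> \<partial>\<mu>)"
    by (intro nn_integral_product_kernel M.sigma_finite_measure_axioms N.sigma_finite_measure_axioms)
      (unfold indicator_def atMost_iff greaterThan_iff greaterThanAtMost_iff, measurable)
  also have "\<dots> = mutual_energy (tent_kernel s) \<mu> \<nu>"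
    unfolding mutual_energy_def
  proof (intro nn_integral_cong)
    fix x y :: real
    have "(\<integral>\<^sup>+z. indicator {z<..z+s} x * indicator {z<..z+s} y \<partial>lborel)
        = (\<integral>\<^sup>+z. indicator {max x y - s..<min x y} z \<partial>lborel)"
      by (intro nn_integral_cong) (auto simp: indicator_def)
    also have "\<dots> = tent_kernel s (y - x)"
      by (cases "max x y - s \<le> min x y") (auto simp: tent_kernel_def max_def min_def abs_real_def intro!: arg_cong[where f=ennreal])
    finally show "(\<integral>\<^sup>+z. indicator {z<..z+s} x * indicator {z<..z+s} y \<partial>lborel) = tent_kernel s (y - x)" .
  qed
  finally show ?thesis .
qed

text \<open>
  Integrate the pointwise identity
  \<open>(F - G)\<^sup>2 + F (1 - F) + G (1 - G) = F (1 - G) + G (1 - F)\<close>. The energies stay on the side where they are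
  added, since infinite energies cannot be subtracted.
\<close>

lemma cramer_von_mises_energy:
  assumes D: "real_distribution \<mu>" "real_distribution \<nu>"
  shows "(\<integral>\<^sup>+z. ennreal ((cdf \<mu> z - cdf \<nu> z)\<^sup>2) \<partial>lborel) + mutual_energy pos_kernel \<mu> \<mu> + mutual_energy pos_kernel \<nu> \<nu>
     = mutual_energy pos_kernel \<mu> \<nu> + mutual_energy pos_kernel \<nu> \<mu>"
proof -
  interpret M: real_distribution \<mu> by fact
  interpret N: real_distribution \<nu> by fact
  note [measurable] = cdf_measurable[OF D(1)] cdf_measurable[OF D(2)]
  have p: "cdf \<mu> z \<ge> 0" "cdf \<mu> z \<le> 1" "cdf \<nu> z \<ge> 0" "cdf \<nu> z \<le> 1" for z
    by (simp_all add: cdf_def)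
  have "ennreal ((cdf \<mu> z - cdf \<nu> z)\<^sup>2) + ennreal (cdf \<mu> z * (1 - cdf \<mu> z)) + ennreal (cdf \<nu> z * (1 - cdf \<nu> z))
    = ennreal (cdf \<mu> z * (1 - cdf \<nu> z)) + ennreal (cdf \<nu> z * (1 - cdf \<mu> z))" for z
  proof -
    have nn: "cdf \<mu> z * (1 - cdf \<mu> z) \<ge> 0" "cdf \<nu> z * (1 - cdf \<nu> z) \<ge> 0" "cdf \<mu> z * (1 - cdf \<nu> z) \<ge> 0" "cdf \<nu> z * (1 - cdf \<mu> z) \<ge> 0"
      using p[of z] by simp_all
    have "(cdf \<mu> z - cdf \<nu> z)\<^sup>2 + cdf \<mu> z * (1 - cdf \<mu> z) + cdf \<nu> z * (1 - cdf \<nu> z)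
      = cdf \<mu> z * (1 - cdf \<nu> z) + cdf \<nu> z * (1 - cdf \<mu> z)"
      by (simp add: power2_eq_square algebra_simps)
    then show ?thesis
      by (simp only: ennreal_plus[symmetric] nn zero_le_power2 add_nonneg_nonneg)
  qed
  then have "(\<integral>\<^sup>+z. ennreal ((cdf \<mu> z - cdf \<nu> z)\<^sup>2) + ennreal (cdf \<mu> z * (1 - cdf \<mu> z)) + ennreal (cdf \<nu> z * (1 - cdf \<nu> z)) \<partial>lborel)
    = (\<integral>\<^sup>+z. ennreal (cdf \<mu> z * (1 - cdf \<nu> z)) + ennreal (cdf \<nu> z * (1 - cdf \<mu> z)) \<partial>lborel)"
    by simp
  then show ?thesis
    by (simp add: nn_integral_add mutual_energy_pos_kernel D)
qed

text \<open>
  Integrate \<open>(a - b)\<^sup>2 + 2 a b = a\<^sup>2 + b\<^sup>2\<close> for the increments \<open>a\<close>, \<open>b\<close> of the two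
  distribution functions.
\<close>

lemma increment_energy:
  assumes D: "real_distribution \<mu>" "real_distribution \<nu>" and s: "s > 0"
  shows "(\<integral>\<^sup>+z. ennreal (((cdf \<mu> (z + s) - cdf \<nu> (z + s)) - (cdf \<mu> z - cdf \<nu> z))\<^sup>2) \<partial>lborel)
       + 2 * mutual_energy (tent_kernel s) \<mu> \<nu>
     = mutual_energy (tent_kernel s) \<mu> \<mu> + mutual_energy (tent_kernel s) \<nu> \<nu>"
proof -
  interpret M: real_distribution \<mu> by fact
  interpret N: real_distribution \<nu> by fact
  note [measurable] = cdf_measurable[OF D(1)] cdf_measurable[OF D(2)]
  let ?a = "\<lambda>z. cdf \<mu> (z + s) - cdf \<mu> z" and ?b = "\<lambda>z. cdf \<nu> (z + s) - cdf \<nu> z"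
  have "ennreal (((cdf \<mu> (z + s) - cdf \<nu> (z + s)) - (cdf \<mu> z - cdf \<nu> z))\<^sup>2) + 2 * ennreal (?a z * ?b z)
    = ennreal (?a z * ?a z) + ennreal (?b z * ?b z)" for z
  proof -
    have ab: "?a z \<ge> 0" "?b z \<ge> 0"
      using s by (simp_all add: M.cdf_nondecreasing N.cdf_nondecreasing)
    have "2 * ennreal (?a z * ?b z) = ennreal (2 * (?a z * ?b z))"
      using ab by (subst ennreal_mult) simp_all
    moreover have "((cdf \<mu> (z + s) - cdf \<nu> (z + s)) - (cdf \<mu> z - cdf \<nu> z))\<^sup>2 + 2 * (?a z * ?b z) = ?a z * ?a z + ?b z * ?b z"
      by (simp add: power2_eq_square algebra_simps)
    ultimately show ?thesis
      using ab by (simp add: ennreal_plus[symmetric] del: ennreal_plus)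
  qed
  then have "(\<integral>\<^sup>+z. ennreal (((cdf \<mu> (z + s) - cdf \<nu> (z + s)) - (cdf \<mu> z - cdf \<nu> z))\<^sup>2) + 2 * ennreal (?a z * ?b z) \<partial>lborel)
     = (\<integral>\<^sup>+z. ennreal (?a z * ?a z) + ennreal (?b z * ?b z) \<partial>lborel)"
    by simp
  then show ?thesis
    by (simp add: nn_integral_add nn_integral_cmult mutual_energy_tent_kernel D s)
qed

text \<open>
  The integral of \<open>s powr (-1 - 2 \<sigma>)\<close> times squared \<open>L\<^sup>2\<close> norms of increments is the squared Sobolev
  seminorm of order \<open>\<sigma>\<close>. Here \<open>\<sigma>\<close> is 7/10, which is larger than 1/2, as needed to control the supremum, and smaller
  than 1, as needed for the kernel, of degree \<open>1 - 2 \<sigma>\<close>, to be integrable near the origin. The corresponding power of a squared length is the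
  inverse fifth root, whose Taylor remainder can be computed with polynomials.
\<close>

definition riesz_weight :: "real \<Rightarrow> ennreal" where
  "riesz_weight s = indicator {0<..} s * ennreal (s powr (-12/5))"

text \<open>
  Up to a positive factor this is \<open>|r| powr (-2/5)\<close> for \<open>r \<noteq> 0\<close>; its value at zero is infinite. The integral
  form shows it as a superposition of window overlaps.
\<close>

definition riesz_kernel :: "real \<Rightarrow> ennreal" where
  "riesz_kernel r = (\<integral>\<^sup>+s. riesz_weight s * tent_kernel s r \<partial>lborel)"

lemma riesz_weight_measurable [measurable]: "riesz_weight \<in> borel_measurable borel"
  unfolding riesz_weight_def[abs_def] by measurable

lemma riesz_kernel_measurable [measurable]: "riesz_kernel \<in> borel_measurable borel"
  unfolding riesz_kernel_def[abs_def] by measurable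

lemma riesz_energy:
  assumes D: "real_distribution \<mu>" "real_distribution \<nu>"
  shows "(\<integral>\<^sup>+s. riesz_weight s * mutual_energy (tent_kernel s) \<mu> \<nu> \<partial>lborel) = mutual_energy riesz_kernel \<mu> \<nu>"
proof -
  interpret M: real_distribution \<mu> by fact
  interpret N: real_distribution \<nu> by fact
  have "(\<integral>\<^sup>+s. riesz_weight s * mutual_energy (tent_kernel s) \<mu> \<nu> \<partial>lborel)
      = (\<integral>\<^sup>+s. \<integral>\<^sup>+x. \<integral>\<^sup>+y. riesz_weight s * tent_kernel s (y - x) \<partial>\<nu> \<partial>\<mu> \<partial>lborel)"
    unfolding mutual_energy_def
    by (simp add: nn_integral_cmult[symmetric])
  also have "\<dots> = (\<integral>\<^sup>+x. \<integral>\<^sup>+s. \<integral>\<^sup>+y. riesz_weight s * tent_kernel s (y - x) \<partial>\<nu> \<partial>lborel \<partial>\<mu>)"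
    by (intro nn_integral_swap M.sigma_finite_measure_axioms sigma_finite_lborel) measurable
  also have "\<dots> = (\<integral>\<^sup>+x. \<integral>\<^sup>+y. \<integral>\<^sup>+s. riesz_weight s * tent_kernel s (y - x) \<partial>lborel \<partial>\<nu> \<partial>\<mu>)"
    by (intro nn_integral_cong nn_integral_swap N.sigma_finite_measure_axioms sigma_finite_lborel) measurable
  finally show ?thesis by (simp add: riesz_kernel_def mutual_energy_def)
qed

text \<open>
  Superpose \<open>increment_energy\<close> over all window lengths.
\<close>

lemma fractional_increment_energy:
  assumes D: "real_distribution \<mu>" "real_distribution \<nu>"
  shows "(\<integral>\<^sup>+s. riesz_weight s * (\<integral>\<^sup>+z. ennreal (((cdf \<mu> (z + s) - cdf \<nu> (z + s)) - (cdf \<mu> z - cdf \<nu> z))\<^sup>2) \<partial>lborel) \<partial>lborel)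
       + 2 * mutual_energy riesz_kernel \<mu> \<nu>
     = mutual_energy riesz_kernel \<mu> \<mu> + mutual_energy riesz_kernel \<nu> \<nu>"
proof -
  interpret M: real_distribution \<mu> by fact
  interpret N: real_distribution \<nu> by fact
  note [measurable] = cdf_measurable[OF D(1)] cdf_measurable[OF D(2)]
  let ?T = "\<lambda>s. \<integral>\<^sup>+z. ennreal (((cdf \<mu> (z + s) - cdf \<nu> (z + s)) - (cdf \<mu> z - cdf \<nu> z))\<^sup>2) \<partial>lborel"
  have "riesz_weight s * ?T s + 2 * (riesz_weight s * mutual_energy (tent_kernel s) \<mu> \<nu>)
     = riesz_weight s * mutual_energy (tent_kernel s) \<mu> \<mu> + riesz_weight s * mutual_energy (tent_kernel s) \<nu> \<nu>" for s
  proof (cases "s > 0")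
    case True
    have "riesz_weight s * ?T s + 2 * (riesz_weight s * mutual_energy (tent_kernel s) \<mu> \<nu>)
      = riesz_weight s * (?T s + 2 * mutual_energy (tent_kernel s) \<mu> \<nu>)"
      by (simp only: distrib_left mult_ac)
    then show ?thesis by (simp only: increment_energy[OF D True] distrib_left)
  qed (simp add: riesz_weight_def)
  then have "(\<integral>\<^sup>+s. riesz_weight s * ?T s + 2 * (riesz_weight s * mutual_energy (tent_kernel s) \<mu> \<nu>) \<partial>lborel)
     = (\<integral>\<^sup>+s. riesz_weight s * mutual_energy (tent_kernel s) \<mu> \<mu> + riesz_weight s * mutual_energy (tent_kernel s) \<nu> \<nu> \<partial>lborel)"
    by simp
  moreover have [measurable]: "(\<lambda>s. mutual_energy (tent_kernel s) \<alpha> \<beta>) \<in> borel_measurable borel"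
    if "real_distribution \<alpha>" "real_distribution \<beta>" for \<alpha> \<beta>
  proof -
    interpret A: real_distribution \<alpha> by fact
    interpret B: real_distribution \<beta> by fact
    show ?thesis unfolding mutual_energy_def by measurable
  qed
  ultimately show ?thesis
    by (simp add: nn_integral_add nn_integral_cmult riesz_energy D)
qed

lemma riesz_kernel_homogeneous:
  assumes c: "c > 0"
  shows "riesz_kernel (c * r) = ennreal (c powr (-2/5)) * riesz_kernel r"
proof -
  have "riesz_kernel (c * r) = ennreal c * (\<integral>\<^sup>+s. riesz_weight (0 + c * s) * tent_kernel (0 + c * s) (c * r) \<partial>lborel)"
    unfolding riesz_kernel_def using c by (subst nn_integral_real_affine[of _ c 0]) simp_all
  also have "\<dots> = (\<integral>\<^sup>+s. ennreal c * (riesz_weight (0 + c * s) * tent_kernel (0 + c * s) (c * r)) \<partial>lborel)"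
    by (rule nn_integral_cmult[symmetric]) measurable
  also have "\<dots> = (\<integral>\<^sup>+s. ennreal (c powr (-2/5)) * (riesz_weight s * tent_kernel s r) \<partial>lborel)"
  proof (intro nn_integral_cong)
    fix s :: real
    show "ennreal c * (riesz_weight (0 + c * s) * tent_kernel (0 + c * s) (c * r))
      = ennreal (c powr (-2/5)) * (riesz_weight s * tent_kernel s r)"
    proof (cases "s > 0")
      case True
      have t: "max 0 (c * s - \<bar>c * r\<bar>) = c * max 0 (s - \<bar>r\<bar>)"
        using c by (simp add: abs_mult max_mult_distrib_left right_diff_distrib)
      have "c powr (-2/5) = c powr (1 + (-12/5) + 1)" by simp
      also have "\<dots> = c * c powr (-12/5) * c" using c by (simp only: powr_add powr_one)
      finally have e: "c powr (-2/5) = c * c powr (-12/5) * c" .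
      have "ennreal c * (riesz_weight (0 + c * s) * tent_kernel (0 + c * s) (c * r))
        = ennreal (c * ((c * s) powr (-12/5) * (c * max 0 (s - \<bar>r\<bar>))))"
        using c True by (simp add: riesz_weight_def tent_kernel_def t ennreal_mult)
      also have "\<dots> = ennreal (c powr (-2/5) * (s powr (-12/5) * max 0 (s - \<bar>r\<bar>)))"
        using c True e by (simp add: powr_mult mult_ac)
      also have "\<dots> = ennreal (c powr (-2/5)) * (riesz_weight s * tent_kernel s r)"
        using True by (simp add: riesz_weight_def tent_kernel_def ennreal_mult)
      finally show ?thesis .
    qed (use c in \<open>simp add: riesz_weight_def zero_less_mult_iff\<close>)
  qed
  also have "\<dots> = ennreal (c powr (-2/5)) * riesz_kernel r"
    unfolding riesz_kernel_def by (rule nn_integral_cmult) measurable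
  finally show ?thesis .
qed

lemma riesz_kernel_1: "riesz_kernel 1 \<le> ennreal (5/2)"
proof -
  have "riesz_kernel 1 \<le> (\<integral>\<^sup>+s. ennreal (s powr (-7/5)) * indicator {1..} s \<partial>lborel)"
    unfolding riesz_kernel_def
  proof (rule nn_integral_mono)
    fix s :: real
    show "riesz_weight s * tent_kernel s 1 \<le> ennreal (s powr (-7/5)) * indicator {1..} s"
    proof (cases "s \<ge> 1")
      case True
      have "s powr (-7/5) = s powr (-12/5) * s"
        using True powr_add[of s "-12/5" 1] by simp
      moreover have "s powr (-12/5) * (s - 1) \<le> s powr (-12/5) * s"
        by (intro mult_left_mono) simp_all
      ultimately show ?thesis
        using True by (simp add: riesz_weight_def tent_kernel_def ennreal_mult'[symmetric] ennreal_leI)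
    qed (simp add: tent_kernel_def)
  qed
  also have "\<dots> = ennreal (0 - (- 5/2 * 1 powr (-2/5)))"
  proof (rule nn_integral_FTC_atLeast)
    show "((\<lambda>s::real. - 5/2 * s powr (-2/5)) \<longlongrightarrow> 0) at_top"
    proof -
      have "((\<lambda>s::real. s powr (-2/5)) \<longlongrightarrow> 0) at_top"
        by (rule tendsto_neg_powr) (auto simp: filterlim_ident)
      from tendsto_mult_right_zero[OF this, of "-5/2"] show ?thesis by simp
    qed
    show "((\<lambda>s. - 5/2 * s powr (-2/5)) has_real_derivative x powr (-7/5)) (at x)" if "1 \<le> x" for x :: real
      using that by (auto intro!: derivative_eq_intros)
  qed simp_all
  finally show ?thesis by simp
qed

section \<open>A Sobolev bound for the supremum\<close>

abbreviation unit_unif :: "real measure" where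
  "unit_unif \<equiv> restrict_space lborel {0..1}"

lemma pos_if_dyadic_multiple_ge_1:
  fixes s :: real
  assumes "1 \<le> 2 ^ k * s" shows "s > 0"
proof (rule ccontr)
  assume "\<not> s > 0"
  then have "2 ^ k * s \<le> 0" by (intro mult_nonneg_nonpos) simp_all
  with assms show False by linarith
qed

lemma prob_space_unit_unif: "prob_space unit_unif"
  by (intro prob_space_restrict_space) simp_all

text \<open>
  The square of a mean is at most the mean square, and enlarging the domain to the line only increases the
  integral.
\<close>

lemma square_mean_unit_le:
  assumes g: "g \<in> borel_measurable borel" "\<And>y. \<bar>g y\<bar> \<le> C"
  shows "ennreal ((\<integral>y. g y \<partial>unit_unif)\<^sup>2) \<le> (\<integral>\<^sup>+y. ennreal ((g y)\<^sup>2) \<partial>lborel)"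
proof -
  interpret prob_space unit_unif by (rule prob_space_unit_unif)
  have m [measurable]: "g \<in> borel_measurable unit_unif" using g(1) by (intro measurable_restrict_space1) simp
  have [measurable]: "g \<in> borel_measurable borel" by fact
  have i: "integrable unit_unif g" by (rule integrable_const_bound[of _ C]) (use g(2) in simp_all)
  have "C \<ge> 0" using g(2)[of 0] by linarith
  have i2: "integrable unit_unif (\<lambda>y. (g y)\<^sup>2)"
  proof (rule integrable_const_bound[of _ "C\<^sup>2"])
    show "AE x in unit_unif. norm ((g x)\<^sup>2) \<le> C\<^sup>2"
      using power_mono[OF g(2) abs_ge_zero, of _ 2] by (intro AE_I2) simp
  qed simp
  have "(\<integral>y. g y \<partial>unit_unif)\<^sup>2 \<le> (\<integral>y. (g y)\<^sup>2 \<partial>unit_unif)"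
    using variance_eq[OF i i2] variance_positive[of g] by linarith
  then have "ennreal ((\<integral>y. g y \<partial>unit_unif)\<^sup>2) \<le> ennreal (\<integral>y. (g y)\<^sup>2 \<partial>unit_unif)"
    by (rule ennreal_leI)
  also have "\<dots> = (\<integral>\<^sup>+y. ennreal ((g y)\<^sup>2) \<partial>unit_unif)"
    by (rule nn_integral_eq_integral[OF i2, symmetric]) simp
  also have "\<dots> = (\<integral>\<^sup>+y. ennreal ((g y)\<^sup>2) * indicator {0..1} y \<partial>lborel)"
    by (rule nn_integral_restrict_space) simp
  also have "\<dots> \<le> (\<integral>\<^sup>+y. ennreal ((g y)\<^sup>2) \<partial>lborel)"
    by (intro nn_integral_mono) (simp add: indicator_def)
  finally show ?thesis .
qed

lemma nn_integral_shift_scale: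
  assumes "s > 0" and [measurable]: "g \<in> borel_measurable borel"
  shows "(\<integral>\<^sup>+y. g (x + s * y) \<partial>lborel) = ennreal (1 / s) * (\<integral>\<^sup>+z. g z \<partial>lborel)"
proof -
  have "ennreal (1 / s) * (\<integral>\<^sup>+z. g z \<partial>lborel) = ennreal (1 / s) * (ennreal s * (\<integral>\<^sup>+y. g (x + s * y) \<partial>lborel))"
    using assms by (subst nn_integral_real_affine[of g s x]) simp_all
  also have "\<dots> = (\<integral>\<^sup>+y. g (x + s * y) \<partial>lborel)"
    using assms(1) by (simp add: mult.assoc[symmetric] ennreal_mult[symmetric])
  finally show ?thesis by simp
qed

definition geom_const :: real where "geom_const = 1 / (1 - 2 powr (-2/5))"

lemma sum_dyadic_powr_le:
  assumes "0 < \<tau>" "\<tau> \<le> 2"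
  shows "(\<Sum>j<k. (\<tau> / 2 ^ Suc j) powr (2/5)) \<le> geom_const"
proof -
  have r: "(2::real) powr (-2/5) < 1" using powr_less_mono[of "-2/5" 0 "2::real"] by simp
  have "(\<Sum>j<k. (\<tau> / 2 ^ Suc j) powr (2/5)) \<le> (\<Sum>j<k. (2 powr (-2/5)) ^ j)"
  proof (rule sum_mono)
    fix j
    have "(\<tau> / 2 ^ Suc j) powr (2/5) \<le> (2 / 2 ^ Suc j) powr (2/5)"
      using assms by (intro powr_mono2 divide_right_mono) simp_all
    also have "2 / 2 ^ Suc j = (2::real) powr (- real j)"
      by (simp add: powr_minus_divide powr_realpow)
    also have "(2 powr (- real j)) powr (2/5) = (2 powr (-2/5)) ^ j"
      by (simp add: powr_powr powr_power mult_ac)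
    finally show "(\<tau> / 2 ^ Suc j) powr (2/5) \<le> (2 powr (-2/5)) ^ j" .
  qed
  also have "\<dots> \<le> (\<Sum>j. (2 powr (-2/5)) ^ j)"
    using r by (intro sum_le_suminf summable_geometric) simp_all
  also have "\<dots> = geom_const"
    using r by (subst suminf_geometric) (simp_all add: geom_const_def)
  finally show ?thesis .
qed

lemma geom_const_pos: "geom_const > 0"
proof -
  have "(2::real) powr (-2/5) < 1" using powr_less_mono[of "-2/5" 0 "2::real"] by simp
  then show ?thesis by (simp add: geom_const_def)
qed

text \<open>
  The dyadic intervals on which the summands do not vanish are disjoint.
\<close>

lemma sum_dyadic_indicator_le:
  "(\<Sum>j. indicator {1..<2} (2 ^ Suc j * s)) \<le> (indicator {0<..} s :: ennreal)" for s :: real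
proof -
  define A where "A j = {s::real. 1 \<le> 2 ^ Suc j * s \<and> 2 ^ Suc j * s < 2}" for j :: nat
  have "A i \<inter> A j = {}" if "i < j" for i j
  proof -
    have False if "s \<in> A i" "s \<in> A j" for s
    proof -
      have "s > 0" using \<open>s \<in> A i\<close> pos_if_dyadic_multiple_ge_1[of "Suc i" s] by (simp add: A_def del: power_Suc)
      have "(2::real) ^ Suc i \<le> 2 ^ j"
        using \<open>i < j\<close> by (intro power_increasing) simp_all
      then have "2 ^ Suc i * s \<le> 2 ^ j * s"
        using \<open>s > 0\<close> by (intro mult_right_mono) simp_all
      then show False using that by (simp add: A_def)
    qed
    then show ?thesis by blast
  qed
  then have dj: "disjoint_family A"
    unfolding disjoint_family_on_def by (metis inf_commute linorder_neqE_nat)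
  have "(\<Sum>j. indicator {1..<2} (2 ^ Suc j * s)) = (\<Sum>j. indicator (A j) s :: ennreal)"
    by (intro suminf_cong) (auto simp: A_def indicator_def)
  also have "\<dots> = indicator (\<Union>j. A j) s" by (rule suminf_indicator[OF dj])
  also have "\<dots> \<le> indicator {0<..} s"
  proof -
    have "s > 0" if "1 \<le> 2 ^ Suc j * s" for j
      using pos_if_dyadic_multiple_ge_1[of "Suc j" s] that by blast
    then show ?thesis by (auto simp: A_def indicator_def)
  qed
  finally show ?thesis .
qed

text \<open>
  In the application \<open>D\<close> is the difference of two distribution functions, so that it is bounded and continuous
  from the right. One-sided averages over \<open>[x, x + s]\<close> therefore recover \<open>D x\<close> as \<open>s\<close> tends to zero.
\<close>

locale bounded_borel_function =
  fixes D :: "real \<Rightarrow> real" and B :: real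
  assumes meas [measurable]: "D \<in> borel_measurable borel"
    and bound: "\<And>x. \<bar>D x\<bar> \<le> B"
begin

definition avg :: "real \<Rightarrow> real \<Rightarrow> real" where
  "avg x s = (\<integral>y. D (x + s * y) \<partial>unit_unif)"

definition incr_norm :: "real \<Rightarrow> ennreal" where
  "incr_norm s = (\<integral>\<^sup>+z. ennreal ((D (z + s) - D z)\<^sup>2) \<partial>lborel)"

lemma integrable_unit [simp]:
  assumes "f \<in> borel_measurable borel" shows "integrable unit_unif (\<lambda>y. D (f y))"
proof -
  interpret prob_space unit_unif by (rule prob_space_unit_unif)
  have [measurable]: "f \<in> borel_measurable unit_unif" using assms by (intro measurable_restrict_space1) simp
  show ?thesis by (rule integrable_const_bound[of _ B]) (use bound in simp_all)
qed

text \<open>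
  An average over an interval is the mean of the averages over its two halves, so passing from scale \<open>s\<close> to
  \<open>2 s\<close> involves only an increment of length \<open>s\<close>.
\<close>

lemma avg_double:
  assumes "s > 0"
  shows "avg x (2 * s) = (avg x s + avg (x + s) s) / 2"
proof -
  let ?I = "\<lambda>y. indicator {0..1} y :: real"
  have av: "avg x s = (\<integral>y. ?I y * D (x + s * y) \<partial>lborel)" for x s
    unfolding avg_def by (subst integral_restrict_space) simp_all
  have int: "integrable lborel (\<lambda>y. ?I y * D (x + s * y))" for x s
  proof -
    have "integrable unit_unif (\<lambda>y. D (x + s * y))" by (rule integrable_unit) simp
    then show ?thesis by (subst (asm) integrable_restrict_space) simp_all
  qed
  have "avg x (2 * s) = (1/2) * (\<integral>y. ?I (0 + (1/2) * y) * D (x + (2 * s) * (0 + (1/2) * y)) \<partial>lborel)"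
    unfolding av by (subst lborel_integral_real_affine[where c="1/2" and t=0]) simp_all
  also have "(\<integral>y. ?I (0 + (1/2) * y) * D (x + (2 * s) * (0 + (1/2) * y)) \<partial>lborel)
    = (\<integral>y. ?I y * D (x + s * y) + ?I (-1 + 1 * y) * D (x + s + s * (-1 + 1 * y)) \<partial>lborel)"
  proof (rule integral_cong_AE)
    have "AE y in lborel. y \<noteq> (1::real)" by (rule AE_lborel_singleton)
    then show "AE y in lborel. ?I (0 + (1/2) * y) * D (x + (2 * s) * (0 + (1/2) * y))
       = ?I y * D (x + s * y) + ?I (-1 + 1 * y) * D (x + s + s * (-1 + 1 * y))"
      by eventually_elim (auto simp: indicator_def algebra_simps)
  qed simp_all
  also have "\<dots> = avg x s + (\<integral>y. ?I (-1 + 1 * y) * D (x + s + s * (-1 + 1 * y)) \<partial>lborel)"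
    unfolding av
    by (rule Bochner_Integration.integral_add[OF int])
      (use lborel_integrable_real_affine[OF int[of "x + s" s], of 1 "-1"] in simp)
  also have "(\<integral>y. ?I (-1 + 1 * y) * D (x + s + s * (-1 + 1 * y)) \<partial>lborel) = avg (x + s) s"
    unfolding av by (subst lborel_integral_real_affine[where c=1 and t="-1"]) simp_all
  finally show ?thesis by simp
qed

lemma avg_step:
  assumes s: "s > 0"
  shows "ennreal ((avg x (2 * s) - avg x s)\<^sup>2) \<le> ennreal (1 / (4 * s)) * incr_norm s"
proof -
  have "avg x (2 * s) - avg x s = (avg (x + s) s - avg x s) / 2"
    unfolding avg_double[OF s] by (simp add: field_simps)
  also have "avg (x + s) s - avg x s = (\<integral>y. D (x + s * y + s) - D (x + s * y) \<partial>unit_unif)"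
    unfolding avg_def by (subst Bochner_Integration.integral_diff) (simp_all add: algebra_simps)
  finally have e: "(avg x (2 * s) - avg x s)\<^sup>2 = 1/4 * (\<integral>y. D (x + s * y + s) - D (x + s * y) \<partial>unit_unif)\<^sup>2"
    by (simp only: power_divide) simp
  have "ennreal ((\<integral>y. D (x + s * y + s) - D (x + s * y) \<partial>unit_unif)\<^sup>2)
      \<le> (\<integral>\<^sup>+y. ennreal ((D (x + s * y + s) - D (x + s * y))\<^sup>2) \<partial>lborel)"
  proof (rule square_mean_unit_le)
    show "\<bar>D (x + s * y + s) - D (x + s * y)\<bar> \<le> 2 * B" for y
      using bound[of "x + s * y + s"] bound[of "x + s * y"] by linarith
  qed simp
  also have "\<dots> = ennreal (1 / s) * incr_norm s"
    unfolding incr_norm_def using nn_integral_shift_scale[OF s, of "\<lambda>z. ennreal ((D (z + s) - D z)\<^sup>2)" x] by simp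
  finally have "ennreal ((avg x (2 * s) - avg x s)\<^sup>2) \<le> ennreal (1/4) * (ennreal (1 / s) * incr_norm s)"
    unfolding e by (subst ennreal_mult) (auto intro!: mult_left_mono)
  also have "\<dots> = ennreal (1 / (4 * s)) * incr_norm s"
    using s by (simp only: mult.assoc[symmetric] ennreal_mult'[symmetric]) (simp add: ennreal_mult'[symmetric])
  finally show ?thesis .
qed

lemma avg_le:
  assumes s: "s \<ge> 1"
  shows "ennreal ((avg x s)\<^sup>2) \<le> (\<integral>\<^sup>+z. ennreal ((D z)\<^sup>2) \<partial>lborel)"
proof -
  have "ennreal ((avg x s)\<^sup>2) \<le> (\<integral>\<^sup>+y. ennreal ((D (x + s * y))\<^sup>2) \<partial>lborel)"
    unfolding avg_def by (rule square_mean_unit_le[of _ B]) (use bound in simp_all)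
  also have "\<dots> = ennreal (1 / s) * (\<integral>\<^sup>+z. ennreal ((D z)\<^sup>2) \<partial>lborel)"
    using s by (intro nn_integral_shift_scale) simp_all
  also have "\<dots> \<le> 1 * (\<integral>\<^sup>+z. ennreal ((D z)\<^sup>2) \<partial>lborel)"
    using s by (intro mult_right_mono) (simp_all add: ennreal_le_1)
  finally show ?thesis by simp
qed

lemma avg_tendsto:
  assumes rc: "continuous (at_right x) D" and s: "\<And>k. s k > 0" "s \<longlonglongrightarrow> 0"
  shows "(\<lambda>k. avg x (s k)) \<longlonglongrightarrow> D x"
proof -
  interpret prob_space unit_unif by (rule prob_space_unit_unif)
  have "(\<lambda>k. \<integral>y. D (x + s k * y) \<partial>unit_unif) \<longlonglongrightarrow> (\<integral>y. D x \<partial>unit_unif)"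
  proof (rule integral_dominated_convergence[where w="\<lambda>_. B"])
    show "AE y in unit_unif. (\<lambda>k. D (x + s k * y)) \<longlonglongrightarrow> D x"
    proof (rule AE_I2)
      fix y :: real assume "y \<in> space unit_unif"
      then have y: "0 \<le> y" "y \<le> 1" by (simp_all add: space_restrict_space)
      show "(\<lambda>k. D (x + s k * y)) \<longlonglongrightarrow> D x"
      proof (cases "y = 0")
        case False
        have "filterlim (\<lambda>k. x + s k * y) (at_right x) sequentially"
          unfolding filterlim_at
        proof
          show "\<forall>\<^sub>F k in sequentially. x + s k * y \<in> {x<..} \<and> x + s k * y \<noteq> x"
            using False y s(1) by (simp add: less_imp_neq[symmetric])
          have "(\<lambda>k. x + s k * y) \<longlonglongrightarrow> x + 0 * y"
            by (intro tendsto_intros s(2))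
          then show "(\<lambda>k. x + s k * y) \<longlonglongrightarrow> x" by simp
        qed
        with rc show ?thesis
          unfolding continuous_within by (rule filterlim_compose)
      qed simp
    qed
  qed (use bound in \<open>auto intro: measurable_restrict_space1\<close>)
  then show ?thesis by (simp add: avg_def measure_restrict_space)
qed

text \<open>
  The value \<open>D x\<close> is the average at scale \<open>\<tau>\<close> plus a telescoping sum of differences of averages at dyadic
  scales. These differences are estimated by \<open>avg_step\<close>, and Cauchy-Schwarz with weights \<open>s powr (2/5)\<close>, whose sum
  over the dyadic scales is geometric, sums them up.
\<close>

lemma square_le_dyadic_sum:
  assumes rc: "continuous (at_right x) D" and \<tau>: "1 \<le> \<tau>" "\<tau> \<le> 2"
  shows "ennreal ((D x)\<^sup>2) \<le> 2 * (\<integral>\<^sup>+z. ennreal ((D z)\<^sup>2) \<partial>lborel)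
     + ennreal (geom_const / 2) * (\<Sum>j. ennreal ((\<tau> / 2 ^ Suc j) powr (-7/5)) * incr_norm (\<tau> / 2 ^ Suc j))"
    (is "_ \<le> ?R")
proof (rule LIMSEQ_le_const2)
  define s where "s j = \<tau> / 2 ^ j" for j :: nat
  have s_pos: "s j > 0" for j using \<tau> by (simp add: s_def)
  have s_Suc: "s j = 2 * s (Suc j)" for j by (simp add: s_def)
  have "s \<longlonglongrightarrow> 0"
    unfolding s_def using tendsto_mult_right_zero[OF LIMSEQ_inverse_realpow_zero[of 2], of \<tau>] by (simp add: divide_inverse)
  then have "(\<lambda>k. avg x (s k)) \<longlonglongrightarrow> D x" using avg_tendsto[OF rc, of s] s_pos by simp
  then show "(\<lambda>k. ennreal ((avg x (s k))\<^sup>2)) \<longlonglongrightarrow> ennreal ((D x)\<^sup>2)"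
    by (intro tendsto_intros) 
  define d where "d j = avg x (s j) - avg x (s (Suc j))" for j
  have d_le: "ennreal ((d j)\<^sup>2) \<le> ennreal (1 / (4 * s (Suc j))) * incr_norm (s (Suc j))" for j
    using avg_step[OF s_pos[of "Suc j"], of x] by (simp add: d_def s_Suc[symmetric])
  have "ennreal ((avg x (s k))\<^sup>2) \<le> ?R" for k
  proof -
    \<comment> \<open>the Cauchy-Schwarz weights\<close>
    define b where "b j = s (Suc j) powr (1/5)" for j
    have b: "b j > 0" for j using s_pos[of "Suc j"] by (simp add: b_def)
    have b0: "b j \<noteq> 0" for j using b[of j] by simp
    have b2: "(b j)\<^sup>2 = s (Suc j) powr (2/5)" for j
      using s_pos by (simp add: b_def power2_eq_square powr_add[symmetric])
    have tel: "avg x (s k) = avg x \<tau> - (\<Sum>j<k. d j)"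
      unfolding d_def by (subst sum_lessThan_telescope') (simp add: s_def)
    have "(avg x (s k))\<^sup>2 \<le> 2 * (avg x \<tau>)\<^sup>2 + 2 * (\<Sum>j<k. d j)\<^sup>2"
      unfolding tel using zero_le_power2[of "avg x \<tau> + (\<Sum>j<k. d j)"]
      by (simp add: power2_eq_square algebra_simps)
    also have "(\<Sum>j<k. d j)\<^sup>2 = (\<Sum>j<k. b j * (d j / b j))\<^sup>2"
      using b0 by simp
    also have "\<dots> \<le> (\<Sum>j<k. (b j)\<^sup>2) * (\<Sum>j<k. (d j / b j)\<^sup>2)"
      by (rule Cauchy_Schwarz_ineq_sum)
    also have "\<dots> \<le> geom_const * (\<Sum>j<k. (d j / b j)\<^sup>2)"
      unfolding b2 using \<tau> by (intro mult_right_mono) (auto simp: s_def intro: sum_dyadic_powr_le sum_nonneg simp del: power_Suc)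
    finally have "(avg x (s k))\<^sup>2 \<le> 2 * (avg x \<tau>)\<^sup>2 + 2 * geom_const * (\<Sum>j<k. (d j / b j)\<^sup>2)"
      by simp
    then have "ennreal ((avg x (s k))\<^sup>2) \<le> ennreal (2 * (avg x \<tau>)\<^sup>2 + 2 * geom_const * (\<Sum>j<k. (d j / b j)\<^sup>2))"
      by (rule ennreal_leI)
    also have "\<dots> = 2 * ennreal ((avg x \<tau>)\<^sup>2) + ennreal (2 * geom_const) * (\<Sum>j<k. ennreal ((d j / b j)\<^sup>2))"
      using geom_const_pos by (simp add: ennreal_plus ennreal_mult sum_nonneg sum_ennreal)
    also have "\<dots> \<le> 2 * (\<integral>\<^sup>+z. ennreal ((D z)\<^sup>2) \<partial>lborel)
       + ennreal (2 * geom_const) * (\<Sum>j<k. ennreal (1/4) * (ennreal (s (Suc j) powr (-7/5)) * incr_norm (s (Suc j))))"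
    proof (intro add_mono mult_left_mono avg_le \<tau> sum_mono)
      fix j
      have "ennreal ((d j / b j)\<^sup>2) = ennreal (1 / (b j)\<^sup>2) * ennreal ((d j)\<^sup>2)"
        by (simp add: ennreal_mult'[symmetric] power_divide)
      also have "\<dots> \<le> ennreal (1 / (b j)\<^sup>2) * (ennreal (1 / (4 * s (Suc j))) * incr_norm (s (Suc j)))"
        by (intro mult_left_mono d_le) simp
      also have "\<dots> = ennreal (1 / (b j)\<^sup>2 * (1 / (4 * s (Suc j)))) * incr_norm (s (Suc j))"
        using s_pos[of "Suc j"] by (simp only: mult.assoc[symmetric], subst ennreal_mult) simp_all
      also have "1 / (b j)\<^sup>2 * (1 / (4 * s (Suc j))) = 1/4 * s (Suc j) powr (-7/5)"
      proof -
        have "s (Suc j) powr (-7/5) = s (Suc j) powr (- (2/5) + - 1)" by simp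
        also have "\<dots> = 1 / s (Suc j) powr (2/5) * (1 / s (Suc j))"
          unfolding powr_add powr_minus_divide using s_pos[of "Suc j"] by simp
        finally show ?thesis by (simp add: b2)
      qed
      also have "ennreal (1/4 * s (Suc j) powr (-7/5)) * incr_norm (s (Suc j))
        = ennreal (1/4) * (ennreal (s (Suc j) powr (-7/5)) * incr_norm (s (Suc j)))"
        by (subst ennreal_mult) (simp_all add: mult.assoc)
      finally show "ennreal ((d j / b j)\<^sup>2) \<le> ennreal (1/4) * (ennreal (s (Suc j) powr (-7/5)) * incr_norm (s (Suc j)))" .
    qed simp_all
    also have "ennreal (2 * geom_const) * (\<Sum>j<k. ennreal (1/4) * (ennreal (s (Suc j) powr (-7/5)) * incr_norm (s (Suc j))))
       = ennreal (geom_const / 2) * (\<Sum>j<k. ennreal (s (Suc j) powr (-7/5)) * incr_norm (s (Suc j)))"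
    proof -
      have "ennreal (2 * geom_const) * ennreal (1/4) = ennreal (geom_const / 2)"
        using geom_const_pos by (subst ennreal_mult[symmetric]) simp_all
      then show ?thesis
        by (simp only: sum_distrib_left[symmetric]) (simp only: mult.assoc[symmetric])
    qed
    also have "2 * (\<integral>\<^sup>+z. ennreal ((D z)\<^sup>2) \<partial>lborel) + \<dots> \<le> ?R"
      unfolding s_def by (intro add_left_mono mult_left_mono sum_le_suminf) simp_all
    finally show ?thesis .
  qed
  then show "\<exists>N. \<forall>k\<ge>N. ennreal ((avg x (s k))\<^sup>2) \<le> ?R" by blast
qed

lemma incr_norm_measurable [measurable]: "incr_norm \<in> borel_measurable borel"
  unfolding incr_norm_def[abs_def] by measurable

text \<open>
  A form of the Sobolev embedding of fractional order above 1/2 into the bounded functions. Averaging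
  \<open>square_le_dyadic_sum\<close> over the initial scale \<open>\<tau>\<close> between 1 and 2 turns the dyadic sum into an integral over all
  scales below 1.
\<close>

theorem square_le_fractional_norm:
  assumes rc: "continuous (at_right x) D"
  shows "ennreal ((D x)\<^sup>2) \<le> 2 * (\<integral>\<^sup>+z. ennreal ((D z)\<^sup>2) \<partial>lborel)
     + ennreal geom_const * (\<integral>\<^sup>+s. riesz_weight s * incr_norm s \<partial>lborel)"
proof -
  let ?I = "\<lambda>\<tau>::real. indicator {1..<2} \<tau> :: ennreal"
  let ?E = "\<integral>\<^sup>+z. ennreal ((D z)\<^sup>2) \<partial>lborel"
  let ?g = "\<lambda>s. ennreal (s powr (-7/5)) * incr_norm s"
  have one: "(\<integral>\<^sup>+\<tau>. ?I \<tau> \<partial>lborel) = 1" by simp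
  have "ennreal ((D x)\<^sup>2) = (\<integral>\<^sup>+\<tau>. ennreal ((D x)\<^sup>2) * ?I \<tau> \<partial>lborel)"
    by (simp add: nn_integral_cmult)
  also have "\<dots> \<le> (\<integral>\<^sup>+\<tau>. (2 * ?E + ennreal (geom_const / 2) * (\<Sum>j. ?g (\<tau> / 2 ^ Suc j))) * ?I \<tau> \<partial>lborel)"
  proof (rule nn_integral_mono)
    fix \<tau> :: real
    show "ennreal ((D x)\<^sup>2) * ?I \<tau> \<le> (2 * ?E + ennreal (geom_const / 2) * (\<Sum>j. ?g (\<tau> / 2 ^ Suc j))) * ?I \<tau>"
      using square_le_dyadic_sum[OF rc, of \<tau>] by (cases "\<tau> \<in> {1..<2}") simp_all
  qed
  also have "\<dots> = (\<integral>\<^sup>+\<tau>. 2 * ?E * ?I \<tau> + ennreal (geom_const / 2) * (\<Sum>j. ?g (\<tau> / 2 ^ Suc j) * ?I \<tau>) \<partial>lborel)"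
    by (intro nn_integral_cong) (simp only: distrib_right mult.assoc ennreal_suminf_multc[symmetric])
  also have "\<dots> = 2 * ?E + ennreal (geom_const / 2) * (\<Sum>j. \<integral>\<^sup>+\<tau>. ?g (\<tau> / 2 ^ Suc j) * ?I \<tau> \<partial>lborel)"
  proof -
    define G where "G j \<tau> = ?g (\<tau> / 2 ^ Suc j) * ?I \<tau>" for j :: nat and \<tau>
    have [measurable]: "G j \<in> borel_measurable borel" for j
      unfolding G_def[abs_def] by measurable
    have "(\<integral>\<^sup>+\<tau>. 2 * ?E * ?I \<tau> + ennreal (geom_const / 2) * (\<Sum>j. G j \<tau>) \<partial>lborel)
      = 2 * ?E * (\<integral>\<^sup>+\<tau>. ?I \<tau> \<partial>lborel) + ennreal (geom_const / 2) * (\<Sum>j. \<integral>\<^sup>+\<tau>. G j \<tau> \<partial>lborel)"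
      by (simp add: nn_integral_add nn_integral_cmult nn_integral_suminf)
    then show ?thesis unfolding G_def one by simp
  qed
  also have "(\<Sum>j. \<integral>\<^sup>+\<tau>. ?g (\<tau> / 2 ^ Suc j) * ?I \<tau> \<partial>lborel)
     \<le> (\<Sum>j. \<integral>\<^sup>+s. 2 * (ennreal (s powr (-12/5)) * incr_norm s * ?I (2 ^ Suc j * s)) \<partial>lborel)"
  proof (intro suminf_le allI)
    fix j :: nat
    have "(\<integral>\<^sup>+\<tau>. ?g (\<tau> / 2 ^ Suc j) * ?I \<tau> \<partial>lborel)
       = ennreal (2 ^ Suc j) * (\<integral>\<^sup>+s. ?g ((0 + 2 ^ Suc j * s) / 2 ^ Suc j) * ?I (0 + 2 ^ Suc j * s) \<partial>lborel)"
      by (subst nn_integral_real_affine[of _ "2 ^ Suc j" 0]) simp_all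
    also have "\<dots> = (\<integral>\<^sup>+s. ennreal (2 ^ Suc j) * (?g ((0 + 2 ^ Suc j * s) / 2 ^ Suc j) * ?I (0 + 2 ^ Suc j * s)) \<partial>lborel)"
      by (rule nn_integral_cmult[symmetric]) measurable
    also have "\<dots> \<le> (\<integral>\<^sup>+s. 2 * (ennreal (s powr (-12/5)) * incr_norm s * ?I (2 ^ Suc j * s)) \<partial>lborel)"
    proof (rule nn_integral_mono)
      fix s :: real
      show "ennreal (2 ^ Suc j) * (?g ((0 + 2 ^ Suc j * s) / 2 ^ Suc j) * ?I (0 + 2 ^ Suc j * s))
         \<le> 2 * (ennreal (s powr (-12/5)) * incr_norm s * ?I (2 ^ Suc j * s))"
      proof (cases "2 ^ Suc j * s \<in> {1..<2}")
        case True
        then have "s > 0" using pos_if_dyadic_multiple_ge_1[of "Suc j" s] unfolding atLeastLessThan_iff by blast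
        \<comment> \<open>on the \<open>j\<close>-th dyadic interval \<open>2 ^ Suc j\<close> is below \<open>2 / s\<close>, which supplies the weight\<close>
        have "2 ^ Suc j * s powr (-7/5) \<le> (2 / s) * s powr (-7/5)"
          using True \<open>s > 0\<close> by (intro mult_right_mono) (simp_all add: field_simps)
        also have "\<dots> = 2 * (s powr (-1) * s powr (-7/5))"
          using \<open>s > 0\<close> powr_minus_divide[of s 1] by simp
        also have "s powr (-1) * s powr (-7/5) = s powr (-12/5)"
          using powr_add[of s "-1" "-7/5"] by simp
        finally have "ennreal (2 ^ Suc j * s powr (-7/5)) \<le> ennreal (2 * s powr (-12/5))"
          by (rule ennreal_leI)
        then have "ennreal (2 ^ Suc j) * ennreal (s powr (-7/5)) \<le> 2 * ennreal (s powr (-12/5))"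
          by (simp add: ennreal_mult)
        from mult_right_mono[OF this, of "incr_norm s"] show ?thesis
          using True by (simp add: mult.assoc)
      qed simp
    qed
    finally show "(\<integral>\<^sup>+\<tau>. ?g (\<tau> / 2 ^ Suc j) * ?I \<tau> \<partial>lborel)
      \<le> (\<integral>\<^sup>+s. 2 * (ennreal (s powr (-12/5)) * incr_norm s * ?I (2 ^ Suc j * s)) \<partial>lborel)" .
  qed simp_all
  also have "\<dots> = (\<integral>\<^sup>+s. (\<Sum>j. 2 * (ennreal (s powr (-12/5)) * incr_norm s * ?I (2 ^ Suc j * s))) \<partial>lborel)"
    by (rule nn_integral_suminf[symmetric]) measurable
  also have "\<dots> = (\<integral>\<^sup>+s. 2 * (ennreal (s powr (-12/5)) * incr_norm s * (\<Sum>j. ?I (2 ^ Suc j * s))) \<partial>lborel)"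
    by (simp only: ennreal_suminf_cmult)
  also have "\<dots> \<le> (\<integral>\<^sup>+s. 2 * (riesz_weight s * incr_norm s) \<partial>lborel)"
  proof (rule nn_integral_mono)
    fix s :: real
    have "ennreal (s powr (-12/5)) * incr_norm s * (\<Sum>j. ?I (2 ^ Suc j * s))
       \<le> ennreal (s powr (-12/5)) * incr_norm s * indicator {0<..} s"
      by (intro mult_left_mono sum_dyadic_indicator_le) simp
    then show "2 * (ennreal (s powr (-12/5)) * incr_norm s * (\<Sum>j. ?I (2 ^ Suc j * s))) \<le> 2 * (riesz_weight s * incr_norm s)"
      by (intro mult_left_mono) (simp_all add: riesz_weight_def mult_ac)
  qed
  also have "\<dots> = 2 * (\<integral>\<^sup>+s. riesz_weight s * incr_norm s \<partial>lborel)"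
    by (rule nn_integral_cmult) measurable
  finally have "ennreal ((D x)\<^sup>2) \<le> 2 * ?E + ennreal (geom_const / 2) * (2 * (\<integral>\<^sup>+s. riesz_weight s * incr_norm s \<partial>lborel))"
    by (simp add: add_left_mono mult_left_mono)
  also have "ennreal (geom_const / 2) * (2 * (\<integral>\<^sup>+s. riesz_weight s * incr_norm s \<partial>lborel))
     = ennreal geom_const * (\<integral>\<^sup>+s. riesz_weight s * incr_norm s \<partial>lborel)"
  proof -
    have "ennreal (geom_const / 2) * 2 = ennreal geom_const"
      using geom_const_pos by (subst ennreal_numeral[symmetric], subst ennreal_mult[symmetric]) simp_all
    then show ?thesis by (simp only: mult.assoc[symmetric])
  qed
  finally show ?thesis .
qed

end

section \<open>Taylor expansions for small perturbations\<close>

text \<open>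
  With \<open>s = sqrt (1 - x)\<close>, the remainder of the cubic Taylor polynomial at \<open>x = 0\<close> is a polynomial in
  \<open>s\<close> with a fourfold zero at \<open>s = 1\<close>. Its cofactor has positive coefficients, so that the sign is visible for all
  \<open>x \<le> 1\<close> and not only near zero.
\<close>

lemma sqrt_taylor_remainder:
  fixes s :: real
  shows "1 - (1 - s\<^sup>2) / 2 - (1 - s\<^sup>2)\<^sup>2 / 8 - (1 - s\<^sup>2) ^ 3 / 16 - s = (1 - s) ^ 4 * (s\<^sup>2 + 4 * s + 5) / 16"
proof -
  have "16 - 8 * (1 - s\<^sup>2) - 2 * (1 - s\<^sup>2)\<^sup>2 - (1 - s\<^sup>2) ^ 3 - 16 * s = (1 - s) ^ 4 * (s\<^sup>2 + 4 * s + 5)"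
    by algebra
  then show ?thesis by linarith
qed

text \<open>
  The factor \<open>(1 - s) ^ 4\<close> of the remainder is compared with \<open>x ^ 4 = ((1 - s) (1 + s)) ^ 4\<close>.
\<close>

lemma sqrt_taylor_bounds:
  fixes x :: real
  assumes "x \<le> 1"
  shows "sqrt (1 - x) \<le> 1 - x / 2 - x\<^sup>2 / 8 - x ^ 3 / 16"
    and "1 - x / 2 - x\<^sup>2 / 8 - x ^ 3 / 16 - 5/16 * x ^ 4 \<le> sqrt (1 - x)"
proof -
  define s where "s = sqrt (1 - x)"
  have s: "s \<ge> 0" "x = 1 - s\<^sup>2" using assms by (simp_all add: s_def)
  have r: "1 - x / 2 - x\<^sup>2 / 8 - x ^ 3 / 16 - s = (1 - s) ^ 4 * (s\<^sup>2 + 4 * s + 5) / 16"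
    unfolding s(2) by (rule sqrt_taylor_remainder)
  have "(1 - s) ^ 4 * (s\<^sup>2 + 4 * s + 5) / 16 \<ge> 0"
    using s(1) by (intro divide_nonneg_nonneg mult_nonneg_nonneg) simp_all
  then show "sqrt (1 - x) \<le> 1 - x / 2 - x\<^sup>2 / 8 - x ^ 3 / 16"
    using r by (simp add: s_def)
  have "5 * (1 + s) ^ 4 = (s\<^sup>2 + 4 * s + 5) + (16 * s + 29 * s\<^sup>2 + 20 * s ^ 3 + 5 * s ^ 4)"
    by algebra
  then have "s\<^sup>2 + 4 * s + 5 \<le> 5 * (1 + s) ^ 4"
    using s(1) by simp
  then have "(1 - s) ^ 4 * (s\<^sup>2 + 4 * s + 5) / 16 \<le> (1 - s) ^ 4 * (5 * (1 + s) ^ 4) / 16"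
    by (intro divide_right_mono mult_left_mono) simp_all
  also have "\<dots> = 5/16 * x ^ 4"
    unfolding s(2) by (simp add: power_mult_distrib[symmetric]) (simp add: power2_eq_square algebra_simps)
  finally show "1 - x / 2 - x\<^sup>2 / 8 - x ^ 3 / 16 - 5/16 * x ^ 4 \<le> sqrt (1 - x)"
    using r by (simp add: s_def)
qed

text \<open>
  The same method with \<open>s = (1 - x) powr (1/5)\<close>. The function is unbounded at \<open>x = 1\<close>, so that it has to remain as a
  factor of the remainder.
\<close>

lemma fifth_root_taylor_bounds:
  fixes x :: real
  assumes "x < 1"
  shows "1 + x / 5 + 3/25 * x\<^sup>2 + 11/125 * x ^ 3 \<le> (1 - x) powr (-1/5)"
    and "(1 - x) powr (-1/5) \<le> 1 + x / 5 + 3/25 * x\<^sup>2 + 11/125 * x ^ 3 + 7 * (x ^ 4 * (1 - x) powr (-1/5))"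
proof -
  define s where "s = (1 - x) powr (1/5)"
  have s: "s > 0" using assms by (simp add: s_def)
  have "s ^ 5 = 1 - x" using assms by (simp add: s_def powr_power)
  then have x: "x = 1 - s ^ 5" by simp
  have inv: "(1 - x) powr (-1/5) = 1 / s"
    using powr_minus_divide[of "1 - x" "1/5"] by (simp add: s_def)
  \<comment> \<open>the quotient of the remainder by \<open>(1 - s) ^ 4\<close>, found by polynomial division\<close>
  define Q where "Q = 125 + 324 * s + 546 * s^2 + 740 * s^3 + 855 * s^4 + 840 * s^5 + 732 * s^6 + 568 * s^7 + 385 * s^8 + 220 * s^9 + 110 * s^10 + 44 * s^11 + 11 * s^12"
  have Q: "Q \<ge> 0" using s by (simp add: Q_def)
  have "125 - s * (125 + 25 * x + 15 * x\<^sup>2 + 11 * x ^ 3) = (1 - s) ^ 4 * Q"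
    unfolding x Q_def by algebra
  then have r: "1 / s - (1 + x / 5 + 3/25 * x\<^sup>2 + 11/125 * x ^ 3) = (1 - s) ^ 4 * Q / (125 * s)"
    using s by (simp add: field_simps)
  have "(1 - s) ^ 4 * Q / (125 * s) \<ge> 0"
    using s Q by simp
  then show "1 + x / 5 + 3/25 * x\<^sup>2 + 11/125 * x ^ 3 \<le> (1 - x) powr (-1/5)"
    unfolding inv using r by linarith
  \<comment> \<open>\<open>x = (1 - s) W\<close>; the factor 7 makes all coefficients of \<open>875 W ^ 4 - Q\<close> positive\<close>
  define W where "W = 1 + s + s^2 + s^3 + s^4"
  have "875 * W ^ 4 = Q + (750 + 3176 * s + 8204 * s^2 + 16760 * s^3 + 29770 * s^4 + 44660 * s^5 + 58768 * s^6 + 69432 * s^7 + 73990 * s^8 + 69780 * s^9 + 59390 * s^10 + 45456 * s^11 + 30614 * s^12 + 17500 * s^13 + 8750 * s^14 + 3500 * s^15 + 875 * s^16)"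
    unfolding W_def Q_def by algebra
  then have "Q \<le> 875 * W ^ 4" using s by simp
  then have "(1 - s) ^ 4 * Q / (125 * s) \<le> (1 - s) ^ 4 * (875 * W ^ 4) / (125 * s)"
    using s by (intro divide_right_mono mult_left_mono) simp_all
  also have "\<dots> = 7 * (((1 - s) * W) ^ 4 * (1 / s))"
    by (simp add: power_mult_distrib)
  also have "(1 - s) * W = x" unfolding x W_def by algebra
  finally show "(1 - x) powr (-1/5) \<le> 1 + x / 5 + 3/25 * x\<^sup>2 + 11/125 * x ^ 3 + 7 * (x ^ 4 * (1 - x) powr (-1/5))"
    unfolding inv using r by linarith
qed

text \<open>
  Fourth powers are traded for tenth powers: if \<open>E x ^ 10\<close> is of order \<open>n\<close> to the power -5, then both terms on the right
  have mean of order \<open>n\<close> to the power -2.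
\<close>

lemma fourth_power_le:
  fixes x :: real and n :: nat
  assumes "n \<ge> 1"
  shows "x ^ 4 \<le> 1 / (real n)\<^sup>2 + real n ^ 3 * x ^ 10"
proof (cases "x\<^sup>2 \<le> 1 / real n")
  case True
  have "x ^ 4 = (x\<^sup>2)\<^sup>2" by simp
  also have "\<dots> \<le> (1 / real n)\<^sup>2" using True by (intro power_mono) simp_all
  finally show ?thesis by (simp add: power_divide add_increasing2)
next
  case False
  then have "1 \<le> real n * x\<^sup>2" using assms by (simp add: field_simps)
  then have "1 \<le> (real n * x\<^sup>2) ^ 3" by simp
  then have "x ^ 4 * 1 \<le> x ^ 4 * (real n * x\<^sup>2) ^ 3" by (intro mult_left_mono) simp_all
  also have "\<dots> = real n ^ 3 * x ^ 10" by (simp add: power_mult_distrib flip: power_mult power_add)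
  finally show ?thesis by (simp add: add_increasing)
qed

text \<open>
  Away from \<open>x = 1\<close> the singular factor is bounded. Near \<open>x = 1\<close> the fourth power is at most twice a fifth power, and the
  arithmetic-geometric mean inequality with factor \<open>n ^ 3\<close> separates \<open>x ^ 10\<close> from the squared singular factor. After division by \<open>n ^ 3\<close> a
  negative moment of order \<open>n\<close> is small enough; the moment of order ten is what makes such a crude bound sufficient.
\<close>

lemma fourth_power_fifth_root_le:
  fixes x :: real and n :: nat
  assumes "x < 1" and n: "n \<ge> 1"
  shows "x ^ 4 * (1 - x) powr (-1/5)
    \<le> 2 / (real n)\<^sup>2 + 3 * (real n ^ 3 * x ^ 10) + (1 - x) powr (-2/5) / real n ^ 3"
proof -
  let ?p = "(1 - x) powr (-1/5)" and ?N = "real n ^ 3"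
  have p2: "?p\<^sup>2 = (1 - x) powr (-2/5)"
    using powr_add[of "1 - x" "-1/5" "-1/5"] by (simp add: power2_eq_square)
  have N: "?N > 0" using n by simp
  have nn: "?N * x ^ 10 \<ge> 0" "(1 - x) powr (-2/5) / ?N \<ge> 0" "1 / (real n)\<^sup>2 \<ge> 0" by simp_all
  show ?thesis
  \<comment> \<open>the threshold \<open>2 powr (-5)\<close> makes the fifth root a rational number\<close>
  proof (cases "1 - x \<ge> 1/32")
    case True
    have "?p \<le> (1/32) powr (-1/5)" using True by (intro powr_mono2') simp_all
    also have "(1/32::real) powr (-1/5) = 2"
    proof -
      have "(1/32::real) = 2 powr (-5)" by (simp add: powr_minus powr_numeral)
      then have "(1/32::real) powr (-1/5) = 2 powr 1" by (simp only: powr_powr) simp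
      then show ?thesis by simp
    qed
    finally have "x ^ 4 * ?p \<le> x ^ 4 * 2" by (intro mult_left_mono) simp_all
    then show ?thesis using fourth_power_le[OF n, of x] nn by linarith
  next
    case False
    then have "x \<ge> 1/2" by simp
    then have "x ^ 4 * 1 \<le> x ^ 4 * (2 * x)" by (intro mult_left_mono) simp_all
    also have "\<dots> = 2 * x ^ 5" by (simp add: numeral_eq_Suc)
    finally have "x ^ 4 * ?p \<le> 2 * x ^ 5 * ?p" by (intro mult_right_mono) simp_all
    also have "\<dots> \<le> ?N * x ^ 10 + ?p\<^sup>2 / ?N"
    proof -
      have "0 \<le> (?N * x ^ 5 - ?p)\<^sup>2 / ?N" using N by simp
      also have "\<dots> = ?N * x ^ 10 - 2 * x ^ 5 * ?p + ?p\<^sup>2 / ?N"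
      proof -
        have "(K * x ^ 5 - p)\<^sup>2 / K = K * (x ^ 5 * x ^ 5) - 2 * x ^ 5 * p + p\<^sup>2 / K" if "K > 0" for K p :: real
          using that by (simp add: power2_eq_square field_simps)
        from this[OF N] show ?thesis by (simp flip: power_add)
      qed
      finally show ?thesis by simp
    qed
    finally show ?thesis unfolding p2 using nn by linarith
  qed
qed

text \<open>
  The function \<open>f\<close> may take negative values, where it is dominated trivially by an extended nonnegative
  integrand.
\<close>

lemma ennreal_integral_le_nn_integral:
  fixes f g :: "'a \<Rightarrow> real"
  assumes f: "integrable M f" and [measurable]: "g \<in> borel_measurable M" and le: "AE x in M. f x \<le> g x"
  shows "ennreal (\<integral>x. f x \<partial>M) \<le> (\<integral>\<^sup>+x. ennreal (g x) \<partial>M)"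
proof -
  have i: "integrable M (\<lambda>x. max 0 (f x))" using f by simp
  have "(\<integral>x. f x \<partial>M) \<le> (\<integral>x. max 0 (f x) \<partial>M)"
    by (rule integral_mono[OF f i]) simp
  then have "ennreal (\<integral>x. f x \<partial>M) \<le> ennreal (\<integral>x. max 0 (f x) \<partial>M)" by (rule ennreal_leI)
  also have "\<dots> = (\<integral>\<^sup>+x. ennreal (max 0 (f x)) \<partial>M)"
    by (rule nn_integral_eq_integral[OF i, symmetric]) simp
  also have "\<dots> \<le> (\<integral>\<^sup>+x. ennreal (g x) \<partial>M)"
    using le by (intro nn_integral_mono_AE) (auto elim!: eventually_mono simp: max_def ennreal_neg intro: ennreal_leI)
  finally show ?thesis .
qed

text \<open>
  A centered random variable \<open>x\<close> with three moments. The lengths studied below are \<open>sqrt (1 - x)\<close> up to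
  normalization; the cubic Taylor polynomials give the one-sided bounds with the favourable sign of the remainder.
\<close>

locale small_perturbation = prob_space +
  fixes x :: "'a \<Rightarrow> real"
  assumes meas [measurable]: "x \<in> borel_measurable M"
    and int2: "integrable M (\<lambda>\<omega>. (x \<omega>)\<^sup>2)" and int3: "integrable M (\<lambda>\<omega>. x \<omega> ^ 3)"
    and mean: "expectation x = 0"
begin

lemma int1: "integrable M x"
proof (rule Bochner_Integration.integrable_bound)
  show "integrable M (\<lambda>\<omega>. 1 + (x \<omega>)\<^sup>2)" using int2 by simp
  have "\<bar>t\<bar> \<le> 1 + t\<^sup>2" for t :: real
    using zero_le_power2[of "\<bar>t\<bar> - 1"] by (simp add: power2_diff)
  then show "AE \<omega> in M. norm (x \<omega>) \<le> norm (1 + (x \<omega>)\<^sup>2)" by simp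
qed simp

lemma expectation_cubic:
  shows "integrable M (\<lambda>\<omega>. 1 + a * x \<omega> + b * (x \<omega>)\<^sup>2 + c * x \<omega> ^ 3)"
    and "expectation (\<lambda>\<omega>. 1 + a * x \<omega> + b * (x \<omega>)\<^sup>2 + c * x \<omega> ^ 3)
      = 1 + b * expectation (\<lambda>\<omega>. (x \<omega>)\<^sup>2) + c * expectation (\<lambda>\<omega>. x \<omega> ^ 3)"
  using int1 int2 int3 mean prob_space by simp_all

lemma sqrt_moment_upper:
  assumes "AE \<omega> in M. x \<omega> \<le> 1"
  shows "(\<integral>\<^sup>+\<omega>. ennreal (sqrt (1 - x \<omega>)) \<partial>M)
    \<le> ennreal (1 - expectation (\<lambda>\<omega>. (x \<omega>)\<^sup>2) / 8 - expectation (\<lambda>\<omega>. x \<omega> ^ 3) / 16)"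
proof -
  let ?P = "\<lambda>\<omega>. 1 + (-1/2) * x \<omega> + (-1/8) * (x \<omega>)\<^sup>2 + (-1/16) * x \<omega> ^ 3"
  have le: "AE \<omega> in M. sqrt (1 - x \<omega>) \<le> ?P \<omega> \<and> 0 \<le> ?P \<omega>"
    using assms
  proof eventually_elim
    case (elim \<omega>)
    then show ?case using sqrt_taylor_bounds(1)[of "x \<omega>"] real_sqrt_ge_zero[of "1 - x \<omega>"] by linarith
  qed
  then have "(\<integral>\<^sup>+\<omega>. ennreal (sqrt (1 - x \<omega>)) \<partial>M) \<le> (\<integral>\<^sup>+\<omega>. ennreal (?P \<omega>) \<partial>M)"
    by (intro nn_integral_mono_AE) (auto elim!: eventually_mono intro: ennreal_leI)
  also have "\<dots> = ennreal (expectation ?P)"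
    using le by (intro nn_integral_eq_integral expectation_cubic) (auto elim!: eventually_mono)
  also have "expectation ?P = 1 - expectation (\<lambda>\<omega>. (x \<omega>)\<^sup>2) / 8 - expectation (\<lambda>\<omega>. x \<omega> ^ 3) / 16"
    unfolding expectation_cubic by simp
  finally show ?thesis .
qed

lemma fifth_root_moment_lower:
  assumes "AE \<omega> in M. x \<omega> < 1"
  shows "ennreal (1 + 3/25 * expectation (\<lambda>\<omega>. (x \<omega>)\<^sup>2) + 11/125 * expectation (\<lambda>\<omega>. x \<omega> ^ 3))
    \<le> (\<integral>\<^sup>+\<omega>. ennreal ((1 - x \<omega>) powr (-1/5)) \<partial>M)"
proof -
  have "ennreal (expectation (\<lambda>\<omega>. 1 + 1/5 * x \<omega> + 3/25 * (x \<omega>)\<^sup>2 + 11/125 * x \<omega> ^ 3))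
    \<le> (\<integral>\<^sup>+\<omega>. ennreal ((1 - x \<omega>) powr (-1/5)) \<partial>M)"
    using assms by (intro ennreal_integral_le_nn_integral expectation_cubic)
      (auto elim!: eventually_mono dest!: fifth_root_taylor_bounds(1))
  then show ?thesis unfolding expectation_cubic .
qed

end

text \<open>
  The tenth moment is that of a variable of size \<open>1 / sqrt n\<close>. It makes the Taylor remainders negligible, which
  gives the opposite bounds.
\<close>

locale concentrated_perturbation = small_perturbation +
  fixes n :: nat and A :: real
  assumes n: "n \<ge> 1" and int10: "integrable M (\<lambda>\<omega>. x \<omega> ^ 10)"
    and moment10: "expectation (\<lambda>\<omega>. x \<omega> ^ 10) \<le> A / real n ^ 5"
begin

lemma scaled_moment10: "real n ^ 3 * expectation (\<lambda>\<omega>. x \<omega> ^ 10) \<le> A / (real n)\<^sup>2"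
proof -
  have "real n ^ 3 * expectation (\<lambda>\<omega>. x \<omega> ^ 10) \<le> real n ^ 3 * (A / real n ^ 5)"
    using moment10 by (intro mult_left_mono) simp_all
  also have "\<dots> = A / (real n)\<^sup>2"
    using n by (simp add: field_simps flip: power_add)
  finally show ?thesis .
qed

lemma sqrt_moment_lower:
  assumes "AE \<omega> in M. x \<omega> \<le> 1"
  shows "ennreal (1 - expectation (\<lambda>\<omega>. (x \<omega>)\<^sup>2) / 8 - expectation (\<lambda>\<omega>. x \<omega> ^ 3) / 16 - (1 + A) / (real n)\<^sup>2)
    \<le> (\<integral>\<^sup>+\<omega>. ennreal (sqrt (1 - x \<omega>)) \<partial>M)"
proof -
  let ?P = "\<lambda>\<omega>. 1 + (-1/2) * x \<omega> + (-1/8) * (x \<omega>)\<^sup>2 + (-1/16) * x \<omega> ^ 3"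
  let ?f = "\<lambda>\<omega>. ?P \<omega> - (1 / (real n)\<^sup>2 + real n ^ 3 * x \<omega> ^ 10)"
  have "1 - expectation (\<lambda>\<omega>. (x \<omega>)\<^sup>2) / 8 - expectation (\<lambda>\<omega>. x \<omega> ^ 3) / 16 - (1 + A) / (real n)\<^sup>2 \<le> expectation ?f"
  proof -
    have "expectation ?f = expectation ?P - (1 / (real n)\<^sup>2 + real n ^ 3 * expectation (\<lambda>\<omega>. x \<omega> ^ 10))"
      using int10 by (subst Bochner_Integration.integral_diff[OF expectation_cubic(1)]) (simp_all add: prob_space)
    then show ?thesis
      unfolding expectation_cubic using scaled_moment10 by (simp add: add_divide_distrib)
  qed
  then have "ennreal (1 - expectation (\<lambda>\<omega>. (x \<omega>)\<^sup>2) / 8 - expectation (\<lambda>\<omega>. x \<omega> ^ 3) / 16 - (1 + A) / (real n)\<^sup>2) \<le> ennreal (expectation ?f)"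
    by (rule ennreal_leI)
  also have "\<dots> \<le> (\<integral>\<^sup>+\<omega>. ennreal (sqrt (1 - x \<omega>)) \<partial>M)"
  proof (rule ennreal_integral_le_nn_integral)
    show "integrable M ?f" using int10 by (intro Bochner_Integration.integrable_diff expectation_cubic(1)) simp
    show "AE \<omega> in M. ?f \<omega> \<le> sqrt (1 - x \<omega>)"
      using assms
    proof eventually_elim
      case (elim \<omega>)
      have "x \<omega> ^ 4 \<ge> 0" by simp
      then show ?case using sqrt_taylor_bounds(2)[OF elim] fourth_power_le[OF n, of "x \<omega>"] by linarith
    qed
  qed simp
  finally show ?thesis .
qed

lemma fifth_root_moment_upper:
  assumes lt: "AE \<omega> in M. x \<omega> < 1"
    and B: "(\<integral>\<^sup>+\<omega>. ennreal ((1 - x \<omega>) powr (-2/5)) \<partial>M) \<le> ennreal (B * real n)" "B \<ge> 0"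
  shows "(\<integral>\<^sup>+\<omega>. ennreal ((1 - x \<omega>) powr (-1/5)) \<partial>M)
    \<le> ennreal (1 + 3/25 * expectation (\<lambda>\<omega>. (x \<omega>)\<^sup>2) + 11/125 * expectation (\<lambda>\<omega>. x \<omega> ^ 3) + 7 * (2 + 3 * A + B) / (real n)\<^sup>2)"
proof -
  let ?q = "\<lambda>\<omega>. (1 - x \<omega>) powr (-2/5)"
  let ?P = "\<lambda>\<omega>. 1 + 1/5 * x \<omega> + 3/25 * (x \<omega>)\<^sup>2 + 11/125 * x \<omega> ^ 3"
  let ?f = "\<lambda>\<omega>. ?P \<omega> + 7 * (2 / (real n)\<^sup>2 + 3 * (real n ^ 3 * x \<omega> ^ 10) + ?q \<omega> / real n ^ 3)"
  have iq: "integrable M ?q"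
    using B(1) by (intro integrableI_nonneg) (auto simp: less_top[symmetric] top_unique)
  have "ennreal (expectation ?q) \<le> ennreal (B * real n)"
    using B(1) by (subst (asm) nn_integral_eq_integral[OF iq]) simp_all
  then have "expectation ?q \<le> B * real n"
    using B(2) by (subst (asm) ennreal_le_iff) simp_all
  then have q: "expectation ?q / real n ^ 3 \<le> B / (real n)\<^sup>2"
    using n by (simp add: field_simps power2_eq_square power3_eq_cube)
  have le: "AE \<omega> in M. (1 - x \<omega>) powr (-1/5) \<le> ?f \<omega>"
    using lt
  proof eventually_elim
    case (elim \<omega>)
    show ?case
      by (rule order_trans[OF fifth_root_taylor_bounds(2)[OF elim]])
        (use fourth_power_fifth_root_le[OF elim n] in simp)
  qed
  have f: "integrable M ?f"
    using int10 iq by (intro Bochner_Integration.integrable_add[OF expectation_cubic(1)]) simp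
  have "(\<integral>\<^sup>+\<omega>. ennreal ((1 - x \<omega>) powr (-1/5)) \<partial>M) \<le> (\<integral>\<^sup>+\<omega>. ennreal (?f \<omega>) \<partial>M)"
    using le by (intro nn_integral_mono_AE) (auto elim!: eventually_mono intro: ennreal_leI)
  also have "\<dots> = ennreal (expectation ?f)"
  proof (rule nn_integral_eq_integral[OF f])
    show "AE \<omega> in M. 0 \<le> ?f \<omega>"
      using le by eventually_elim (rule order_trans[OF powr_ge_zero])
  qed
  also have "\<dots> \<le> ennreal (1 + 3/25 * expectation (\<lambda>\<omega>. (x \<omega>)\<^sup>2) + 11/125 * expectation (\<lambda>\<omega>. x \<omega> ^ 3) + 7 * (2 + 3 * A + B) / (real n)\<^sup>2)"
  proof (rule ennreal_leI)
    have "expectation ?f = expectation ?P + 7 * (2 / (real n)\<^sup>2 + 3 * (real n ^ 3 * expectation (\<lambda>\<omega>. x \<omega> ^ 10)) + expectation ?q / real n ^ 3)"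
      using int10 iq by (subst Bochner_Integration.integral_add[OF expectation_cubic(1)]) (simp_all add: prob_space)
    also have "\<dots> \<le> expectation ?P + 7 * (2 / (real n)\<^sup>2 + 3 * (A / (real n)\<^sup>2) + B / (real n)\<^sup>2)"
      using scaled_moment10 q by (intro add_left_mono mult_left_mono add_mono) simp_all
    also have "\<dots> = 1 + 3/25 * expectation (\<lambda>\<omega>. (x \<omega>)\<^sup>2) + 11/125 * expectation (\<lambda>\<omega>. x \<omega> ^ 3) + 7 * (2 + 3 * A + B) / (real n)\<^sup>2"
      unfolding expectation_cubic by (simp add: add_divide_distrib)
    finally show "expectation ?f \<le> \<dots>" .
  qed
  finally show ?thesis .
qed

end

section \<open>Moments of Gaussian quadratic forms\<close>

text \<open>
  For independent centered variables the mixed terms in the square and the cube of the sum have mean zero.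
\<close>

lemma (in prob_space) indep_sum_centered_moments:
  fixes Y :: "'i \<Rightarrow> 'a \<Rightarrow> real"
  assumes "finite I" "indep_vars (\<lambda>_. borel) Y I"
    and "\<And>i. i \<in> I \<Longrightarrow> integrable M (Y i)" "\<And>i. i \<in> I \<Longrightarrow> integrable M (\<lambda>\<omega>. (Y i \<omega>)\<^sup>2)"
      "\<And>i. i \<in> I \<Longrightarrow> integrable M (\<lambda>\<omega>. Y i \<omega> ^ 3)" "\<And>i. i \<in> I \<Longrightarrow> expectation (Y i) = 0"
  defines "S \<equiv> \<lambda>J \<omega>. \<Sum>i\<in>J. Y i \<omega>"
  shows "integrable M (S I) \<and> integrable M (\<lambda>\<omega>. (S I \<omega>)\<^sup>2) \<and> integrable M (\<lambda>\<omega>. S I \<omega> ^ 3)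
    \<and> expectation (S I) = 0
    \<and> expectation (\<lambda>\<omega>. (S I \<omega>)\<^sup>2) = (\<Sum>i\<in>I. expectation (\<lambda>\<omega>. (Y i \<omega>)\<^sup>2))
    \<and> expectation (\<lambda>\<omega>. S I \<omega> ^ 3) = (\<Sum>i\<in>I. expectation (\<lambda>\<omega>. Y i \<omega> ^ 3))"
  using assms(1-6)
proof (induction I rule: finite_induct)
  case empty
  then show ?case by (simp add: S_def)
next
  case (insert i I)
  have IH: "integrable M (S I)" "integrable M (\<lambda>\<omega>. (S I \<omega>)\<^sup>2)" "integrable M (\<lambda>\<omega>. S I \<omega> ^ 3)"
    "expectation (S I) = 0"
    "expectation (\<lambda>\<omega>. (S I \<omega>)\<^sup>2) = (\<Sum>i\<in>I. expectation (\<lambda>\<omega>. (Y i \<omega>)\<^sup>2))"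
    "expectation (\<lambda>\<omega>. S I \<omega> ^ 3) = (\<Sum>i\<in>I. expectation (\<lambda>\<omega>. Y i \<omega> ^ 3))"
    using insert.IH insert.prems indep_vars_subset[OF insert.prems(1), of I] by auto
  have Yi: "integrable M (Y i)" "integrable M (\<lambda>\<omega>. (Y i \<omega>)\<^sup>2)" "integrable M (\<lambda>\<omega>. Y i \<omega> ^ 3)" "expectation (Y i) = 0"
    using insert.prems by auto
  have ind: "indep_var borel (Y i) borel (S I)"
    unfolding S_def by (rule indep_vars_sum[OF insert.hyps insert.prems(1)])
  have ind': "indep_var borel (\<lambda>\<omega>. Y i \<omega> ^ a) borel (\<lambda>\<omega>. S I \<omega> ^ b)" for a b
    using indep_var_compose[OF ind, of "\<lambda>x. x ^ a" borel "\<lambda>x. x ^ b" borel] by (simp add: o_def)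
  have pr: "integrable M (\<lambda>\<omega>. Y i \<omega> * S I \<omega>)" "expectation (\<lambda>\<omega>. Y i \<omega> * S I \<omega>) = 0"
    "integrable M (\<lambda>\<omega>. (Y i \<omega>)\<^sup>2 * S I \<omega>)" "expectation (\<lambda>\<omega>. (Y i \<omega>)\<^sup>2 * S I \<omega>) = 0"
    "integrable M (\<lambda>\<omega>. Y i \<omega> * (S I \<omega>)\<^sup>2)" "expectation (\<lambda>\<omega>. Y i \<omega> * (S I \<omega>)\<^sup>2) = 0"
    using indep_var_integrable[OF ind'[of 1 1]] indep_var_integrable[OF ind'[of 2 1]] indep_var_integrable[OF ind'[of 1 2]]
      indep_var_lebesgue_integral[OF ind'[of 1 1]] indep_var_lebesgue_integral[OF ind'[of 2 1]]
      indep_var_lebesgue_integral[OF ind'[of 1 2]] Yi IH(1-4)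
    by simp_all
  have S: "S (insert i I) \<omega> = Y i \<omega> + S I \<omega>" for \<omega>
    using insert.hyps by (simp add: S_def)
  have S2: "(S (insert i I) \<omega>)\<^sup>2 = (Y i \<omega>)\<^sup>2 + 2 * (Y i \<omega> * S I \<omega>) + (S I \<omega>)\<^sup>2" for \<omega>
    unfolding S by (simp add: power2_sum)
  have S3: "S (insert i I) \<omega> ^ 3 = Y i \<omega> ^ 3 + 3 * ((Y i \<omega>)\<^sup>2 * S I \<omega>) + 3 * (Y i \<omega> * (S I \<omega>)\<^sup>2) + S I \<omega> ^ 3" for \<omega>
    unfolding S by (simp add: power3_eq_cube power2_eq_square algebra_simps)
  have "S (insert i I) = (\<lambda>\<omega>. Y i \<omega> + S I \<omega>)" using S by auto
  then show ?case
    unfolding S2 S3 using IH Yi pr insert.hyps by simp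
qed

lemma distr_gauss_component:
  assumes "i \<in> {1..n}"
  shows "distr (gauss n) std_normal_distribution (\<lambda>x. x i) = std_normal_distribution"
  unfolding gauss_def using assms by (intro distr_PiM_component prob_space_normal_density) simp_all

lemma component_measurable_gauss:
  assumes "i \<in> {1..n}" shows "(\<lambda>x. x i) \<in> gauss n \<rightarrow>\<^sub>M std_normal_distribution"
  unfolding gauss_def using assms by simp

lemma integrable_gauss_component:
  fixes f :: "real \<Rightarrow> real"
  assumes "i \<in> {1..n}" "integrable std_normal_distribution f"
  shows "integrable (gauss n) (\<lambda>x. f (x i))" "(\<integral>x. f (x i) \<partial>gauss n) = (\<integral>z. f z \<partial>std_normal_distribution)"
proof -
  have m: "(\<lambda>x. x i) \<in> gauss n \<rightarrow>\<^sub>M std_normal_distribution" by (rule component_measurable_gauss) fact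
  have f [measurable]: "f \<in> borel_measurable std_normal_distribution" using assms(2) by simp
  show "integrable (gauss n) (\<lambda>x. f (x i))"
    using integrable_distr_eq[OF m f] assms by (simp add: distr_gauss_component)
  show "(\<integral>x. f (x i) \<partial>gauss n) = (\<integral>z. f z \<partial>std_normal_distribution)"
    using integral_distr[OF m f] assms(1) by (simp add: distr_gauss_component)
qed

lemma std_normal_power_integrable: "integrable std_normal_distribution (\<lambda>z. z ^ k)"
  using integrable_std_normal_moment[of k] by (subst integrable_density) simp_all

lemma std_normal_moments:
  "(\<integral>z. z \<partial>std_normal_distribution) = 0" "(\<integral>z. z\<^sup>2 \<partial>std_normal_distribution) = 1"
  "(\<integral>z. z ^ 3 \<partial>std_normal_distribution) = 0" "(\<integral>z. z ^ 4 \<partial>std_normal_distribution) = 3"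
  "(\<integral>z. z ^ 5 \<partial>std_normal_distribution) = 0" "(\<integral>z. z ^ 6 \<partial>std_normal_distribution) = 15"
proof -
  have d: "(\<integral>z. f z \<partial>std_normal_distribution) = (\<integral>z. std_normal_density z * f z \<partial>lborel)"
    if "f \<in> borel_measurable borel" for f :: "real \<Rightarrow> real"
    using that by (subst integral_density) simp_all
  show "(\<integral>z. z \<partial>std_normal_distribution) = 0" "(\<integral>z. z ^ 3 \<partial>std_normal_distribution) = 0" "(\<integral>z. z ^ 5 \<partial>std_normal_distribution) = 0"
    using integral_std_normal_moment_odd[of 0] integral_std_normal_moment_odd[of 1] integral_std_normal_moment_odd[of 2]
    by (simp_all add: d)
  show "(\<integral>z. z\<^sup>2 \<partial>std_normal_distribution) = 1" "(\<integral>z. z ^ 4 \<partial>std_normal_distribution) = 3" "(\<integral>z. z ^ 6 \<partial>std_normal_distribution) = 15"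
    using integral_std_normal_moment_even[of 1] integral_std_normal_moment_even[of 2] integral_std_normal_moment_even[of 3]
    by (simp_all add: d fact_numeral)
qed

text \<open>
  Expand and insert the first six moments of the normal law; the odd ones vanish.
\<close>

lemma gauss_perturbation_moments:
  fixes v :: real
  defines "f \<equiv> \<lambda>z. 1 - z\<^sup>2 + 2 * v * z"
  shows "integrable std_normal_distribution f" "integrable std_normal_distribution (\<lambda>z. (f z)\<^sup>2)"
    "integrable std_normal_distribution (\<lambda>z. f z ^ 3)"
    "(\<integral>z. f z \<partial>std_normal_distribution) = 0"
    "(\<integral>z. (f z)\<^sup>2 \<partial>std_normal_distribution) = 2 + 4 * v\<^sup>2"
    "(\<integral>z. f z ^ 3 \<partial>std_normal_distribution) = - 8 - 24 * v\<^sup>2"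
proof -
  interpret prob_space std_normal_distribution by (rule prob_space_normal_density) simp
  note i = std_normal_power_integrable
  have i1: "integrable std_normal_distribution (\<lambda>z::real. z)" using i[of 1] by simp
  have e2: "(f z)\<^sup>2 = 1 + 4 * v * z + (4 * v\<^sup>2 - 2) * z\<^sup>2 + (- 4 * v) * z ^ 3 + z ^ 4" for z
    unfolding f_def by algebra
  have e3: "f z ^ 3 = 1 + 6 * v * z + (12 * v\<^sup>2 - 3) * z\<^sup>2 + (8 * v ^ 3 - 12 * v) * z ^ 3 + (3 - 12 * v\<^sup>2) * z ^ 4
     + 6 * v * z ^ 5 + (-1) * z ^ 6" for z
    unfolding f_def by algebra
  show "integrable std_normal_distribution f" "(\<integral>z. f z \<partial>std_normal_distribution) = 0"
    unfolding f_def using i i1 std_normal_moments prob_space by simp_all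
  show "integrable std_normal_distribution (\<lambda>z. (f z)\<^sup>2)" "(\<integral>z. (f z)\<^sup>2 \<partial>std_normal_distribution) = 2 + 4 * v\<^sup>2"
    unfolding e2 using i i1 std_normal_moments prob_space by simp_all
  show "integrable std_normal_distribution (\<lambda>z. f z ^ 3)"
    unfolding e3 by (intro Bochner_Integration.integrable_add integrable_mult_right i i1) simp
  show "(\<integral>z. f z ^ 3 \<partial>std_normal_distribution) = - 8 - 24 * v\<^sup>2"
    unfolding e3 using i i1 std_normal_moments prob_space by (simp add: algebra_simps)
qed

lemma gauss_quadratic_sum_moments:
  fixes v :: "nat \<Rightarrow> real" and n :: nat
  assumes n: "n \<ge> 1"
  defines "S \<equiv> \<lambda>x. \<Sum>i=1..n. 1 - (x i)\<^sup>2 + 2 * v i * x i"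
  shows "integrable (gauss n) (\<lambda>x. (S x)\<^sup>2)" "integrable (gauss n) (\<lambda>x. S x ^ 3)"
    "(\<integral>x. S x \<partial>gauss n) = 0" "(\<integral>x. (S x)\<^sup>2 \<partial>gauss n) = 2 * real n + 4 * (\<Sum>i=1..n. (v i)\<^sup>2)"
    "(\<integral>x. S x ^ 3 \<partial>gauss n) = - 8 * real n - 24 * (\<Sum>i=1..n. (v i)\<^sup>2)"
proof -
  interpret prob_space "gauss n" by (rule prob_space_gauss)
  let ?Y = "\<lambda>i x. 1 - (x i)\<^sup>2 + 2 * v i * x i"
  have ind: "indep_vars (\<lambda>_. borel) ?Y {1..n}"
    using indep_vars_compose2[OF indep_vars_gauss[OF n], of "\<lambda>i z. 1 - z\<^sup>2 + 2 * v i * z" "\<lambda>_. borel"] by simp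
  have m: "integrable (gauss n) (?Y i)" "integrable (gauss n) (\<lambda>x. (?Y i x)\<^sup>2)" "integrable (gauss n) (\<lambda>x. ?Y i x ^ 3)"
    "expectation (?Y i) = 0" "expectation (\<lambda>x. (?Y i x)\<^sup>2) = 2 + 4 * (v i)\<^sup>2" "expectation (\<lambda>x. ?Y i x ^ 3) = - 8 - 24 * (v i)\<^sup>2"
    if "i \<in> {1..n}" for i
    using integrable_gauss_component[OF that gauss_perturbation_moments(1)[of "v i"]]
      integrable_gauss_component[OF that gauss_perturbation_moments(2)[of "v i"]]
      integrable_gauss_component[OF that gauss_perturbation_moments(3)[of "v i"]]
      gauss_perturbation_moments(4-6)[of "v i"] by simp_all
  have *: "integrable (gauss n) (\<lambda>x. (S x)\<^sup>2) \<and> integrable (gauss n) (\<lambda>x. S x ^ 3) \<and> expectation S = 0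
    \<and> expectation (\<lambda>x. (S x)\<^sup>2) = (\<Sum>i=1..n. expectation (\<lambda>x. (?Y i x)\<^sup>2))
    \<and> expectation (\<lambda>x. S x ^ 3) = (\<Sum>i=1..n. expectation (\<lambda>x. ?Y i x ^ 3))"
    using indep_sum_centered_moments[OF finite_atLeastAtMost ind m(1-4)] unfolding S_def by blast
  have s2: "(\<Sum>i=1..n. expectation (\<lambda>x. (?Y i x)\<^sup>2)) = (\<Sum>i=1..n. 2 + 4 * (v i)\<^sup>2)"
    by (intro sum.cong refl m(5))
  have s3: "(\<Sum>i=1..n. expectation (\<lambda>x. ?Y i x ^ 3)) = (\<Sum>i=1..n. - 8 - 24 * (v i)\<^sup>2)"
    by (intro sum.cong refl m(6))
  show "integrable (gauss n) (\<lambda>x. (S x)\<^sup>2)" "integrable (gauss n) (\<lambda>x. S x ^ 3)" "(\<integral>x. S x \<partial>gauss n) = 0"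
    using * by simp_all
  show "(\<integral>x. (S x)\<^sup>2 \<partial>gauss n) = 2 * real n + 4 * (\<Sum>i=1..n. (v i)\<^sup>2)"
    using * unfolding s2 by (simp add: sum.distrib sum_distrib_left)
  show "(\<integral>x. S x ^ 3 \<partial>gauss n) = - 8 * real n - 24 * (\<Sum>i=1..n. (v i)\<^sup>2)"
    using * unfolding s3 by (simp add: sum_subtractf sum_distrib_left)
qed

lemma power_le_fact_exp:
  fixes x :: real
  assumes "x \<ge> 0" shows "x ^ k \<le> fact k * exp x"
proof -
  have s: "(\<lambda>n. x ^ n /\<^sub>R fact n) sums exp x" by (rule exp_converges)
  have "(\<Sum>n\<in>{k}. x ^ n /\<^sub>R fact n) \<le> (\<Sum>n. x ^ n /\<^sub>R fact n)"
    using s assms by (intro sum_le_suminf) (auto simp: sums_iff)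
  then show ?thesis using s by (simp add: sums_iff field_simps)
qed

text \<open>
  Bound the tenth power by exponentials of both signs, using a single term of the exponential series.
\<close>

lemma tenth_moment_from_exponential:
  fixes S :: "'a \<Rightarrow> real"
  assumes [measurable]: "S \<in> borel_measurable M" and l: "l > 0" and K: "K \<ge> 0"
    and e: "(\<integral>\<^sup>+\<omega>. ennreal (exp (l * S \<omega>)) \<partial>M) \<le> ennreal K" "(\<integral>\<^sup>+\<omega>. ennreal (exp (- l * S \<omega>)) \<partial>M) \<le> ennreal K"
  shows "integrable M (\<lambda>\<omega>. S \<omega> ^ 10)" "(\<integral>\<omega>. S \<omega> ^ 10 \<partial>M) \<le> 2 * fact 10 * K / l ^ 10"
proof -
  have pt: "S \<omega> ^ 10 \<le> fact 10 / l ^ 10 * (exp (l * S \<omega>) + exp (- l * S \<omega>))" for \<omega>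
  proof -
    have "\<bar>l * S \<omega>\<bar> ^ 10 \<le> fact 10 * exp \<bar>l * S \<omega>\<bar>" by (rule power_le_fact_exp) simp
    also have "exp \<bar>l * S \<omega>\<bar> \<le> exp (l * S \<omega>) + exp (- l * S \<omega>)"
      by (auto simp: abs_if)
    finally have "\<bar>l * S \<omega>\<bar> ^ 10 \<le> fact 10 * (exp (l * S \<omega>) + exp (- l * S \<omega>))" by simp
    moreover have "\<bar>l * S \<omega>\<bar> ^ 10 = l ^ 10 * S \<omega> ^ 10" by (simp add: power_mult_distrib)
    ultimately show ?thesis using l by (simp add: field_simps)
  qed
  have "(\<integral>\<^sup>+\<omega>. ennreal (S \<omega> ^ 10) \<partial>M)
    \<le> (\<integral>\<^sup>+\<omega>. ennreal (fact 10 / l ^ 10) * (ennreal (exp (l * S \<omega>)) + ennreal (exp (- l * S \<omega>))) \<partial>M)"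
    using l by (intro nn_integral_mono) (simp add: ennreal_mult'[symmetric] ennreal_plus[symmetric] pt[simplified] ennreal_leI del: ennreal_plus)
  also have "\<dots> = ennreal (fact 10 / l ^ 10) * ((\<integral>\<^sup>+\<omega>. ennreal (exp (l * S \<omega>)) \<partial>M) + (\<integral>\<^sup>+\<omega>. ennreal (exp (- l * S \<omega>)) \<partial>M))"
    by (subst nn_integral_cmult) (simp_all add: nn_integral_add)
  also have "\<dots> \<le> ennreal (fact 10 / l ^ 10) * (ennreal K + ennreal K)"
    by (intro mult_left_mono add_mono e) simp
  also have "\<dots> = ennreal (2 * fact 10 * K / l ^ 10)"
    using l K by (simp add: ennreal_plus[symmetric] ennreal_mult'[symmetric] del: ennreal_plus)
  finally have le: "(\<integral>\<^sup>+\<omega>. ennreal (S \<omega> ^ 10) \<partial>M) \<le> ennreal (2 * fact 10 * K / l ^ 10)" .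
  show i: "integrable M (\<lambda>\<omega>. S \<omega> ^ 10)"
    using le by (intro integrableI_nonneg) (auto simp: less_top[symmetric] top_unique)
  show "(\<integral>\<omega>. S \<omega> ^ 10 \<partial>M) \<le> 2 * fact 10 * K / l ^ 10"
    using le l K by (subst (asm) nn_integral_eq_integral[OF i]) simp_all
qed

text \<open>
  The integrand is a multiple of the density of a normal law with variance \<open>1 / (1 + 2 l)\<close>. The logarithm
  of the factor \<open>exp l / sqrt (1 + 2 l)\<close> has no linear term in \<open>l\<close>, because \<open>1 - z\<^sup>2\<close> is
  centered.
\<close>

lemma std_normal_exp_quadratic:
  assumes l: "\<bar>l\<bar> \<le> 1/4"
  shows "(\<integral>\<^sup>+z. ennreal (exp (l * (1 - z\<^sup>2))) \<partial>std_normal_distribution) \<le> ennreal (exp (4 * l\<^sup>2))"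
proof -
  define \<sigma> where "\<sigma> = 1 / sqrt (1 + 2 * l)"
  have p: "1 + 2 * l > 0" using l by (simp add: abs_le_iff)
  have s: "\<sigma> > 0" "\<sigma>\<^sup>2 = 1 / (1 + 2 * l)" using p by (simp_all add: \<sigma>_def power_divide)
  have d: "std_normal_density z * exp (l * (1 - z\<^sup>2)) = (exp l * \<sigma>) * normal_density 0 \<sigma> z" for z
  proof -
    have "sqrt (2 * pi * \<sigma>\<^sup>2) = sqrt (2 * pi) * \<sigma>"
      using s(1) by (simp add: real_sqrt_mult)
    moreover have "- (z\<^sup>2) / (2 * \<sigma>\<^sup>2) = - z\<^sup>2 / 2 - l * z\<^sup>2"
      using p unfolding s(2) by (simp add: field_simps)
    moreover have "exp (- z\<^sup>2 / 2) * exp (l * (1 - z\<^sup>2)) = exp l * exp (- z\<^sup>2 / 2 - l * z\<^sup>2)"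
      by (simp add: exp_add[symmetric] algebra_simps)
    ultimately show ?thesis
      using s(1) by (simp add: normal_density_def)
  qed
  have "(\<integral>\<^sup>+z. ennreal (exp (l * (1 - z\<^sup>2))) \<partial>std_normal_distribution)
     = (\<integral>\<^sup>+z. ennreal (std_normal_density z) * ennreal (exp (l * (1 - z\<^sup>2))) \<partial>lborel)"
    by (subst nn_integral_density) simp_all
  also have "\<dots> = (\<integral>\<^sup>+z. ennreal (exp l * \<sigma>) * ennreal (normal_density 0 \<sigma> z) \<partial>lborel)"
    using s(1) by (intro nn_integral_cong) (simp add: ennreal_mult'[symmetric] d)
  also have "\<dots> = ennreal (exp l * \<sigma>) * (\<integral>\<^sup>+z. ennreal (normal_density 0 \<sigma> z) \<partial>lborel)"
    by (rule nn_integral_cmult) simp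
  also have "(\<integral>\<^sup>+z. ennreal (normal_density 0 \<sigma> z) \<partial>lborel) = 1"
    using nn_integral_eq_integral[OF integrable_normal_density[OF s(1), of 0]] integral_normal_density[OF s(1), of 0] by simp
  also have "ennreal (exp l * \<sigma>) * 1 \<le> ennreal (exp (4 * l\<^sup>2))"
  proof -
    have "2 * l - 8 * l\<^sup>2 \<le> ln (1 + 2 * l)"
    proof (cases "l \<ge> 0")
      case True
      then have "2 * l - (2 * l)\<^sup>2 \<le> ln (1 + 2 * l)"
        using l by (intro ln_one_plus_pos_lower_bound) simp_all
      then have "2 * l - 4 * l\<^sup>2 \<le> ln (1 + 2 * l)" by (simp add: power_mult_distrib)
      moreover have "0 \<le> l\<^sup>2" by simp
      ultimately show ?thesis by linarith
    next
      case False
      then have "- (- 2 * l) - 2 * (- 2 * l)\<^sup>2 \<le> ln (1 - (- 2 * l))"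
        using l by (intro ln_one_minus_pos_lower_bound) simp_all
      then show ?thesis by (simp add: power_mult_distrib)
    qed
    then have "exp l * \<sigma> \<le> exp l * exp (4 * l\<^sup>2 - l)"
    proof (intro mult_left_mono)
      assume a: "2 * l - 8 * l\<^sup>2 \<le> ln (1 + 2 * l)"
      have "\<sigma> = exp (- ln (1 + 2 * l) / 2)"
        using p by (simp add: \<sigma>_def exp_minus inverse_eq_divide ln_sqrt[symmetric])
      also have "\<dots> \<le> exp (4 * l\<^sup>2 - l)" using a by simp
      finally show "\<sigma> \<le> exp (4 * l\<^sup>2 - l)" .
    qed simp
    then show ?thesis by (simp add: exp_add[symmetric] ennreal_leI)
  qed
  finally show ?thesis .
qed

lemma gauss_exp_quadratic:
  assumes "\<bar>l\<bar> \<le> 1/4"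
  shows "(\<integral>\<^sup>+x. ennreal (exp (l * (\<Sum>i=1..n. 1 - (x i)\<^sup>2))) \<partial>gauss n) \<le> ennreal (exp (4 * real n * l\<^sup>2))"
proof -
  interpret product_sigma_finite "\<lambda>_::nat. std_normal_distribution"
    by (intro product_sigma_finite.intro prob_space_imp_sigma_finite prob_space_normal_density) simp
  have "(\<integral>\<^sup>+x. ennreal (exp (l * (\<Sum>i=1..n. 1 - (x i)\<^sup>2))) \<partial>gauss n)
     = (\<integral>\<^sup>+x. (\<Prod>i=1..n. ennreal (exp (l * (1 - (x i)\<^sup>2)))) \<partial>gauss n)"
    by (simp add: sum_distrib_left exp_sum prod_ennreal)
  also have "\<dots> = (\<Prod>i=1..n. \<integral>\<^sup>+z. ennreal (exp (l * (1 - z\<^sup>2))) \<partial>std_normal_distribution)"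
    unfolding gauss_def by (rule product_nn_integral_prod) simp_all
  also have "\<dots> \<le> (\<Prod>i=1..n. ennreal (exp (4 * l\<^sup>2)))"
    by (intro prod_mono_ennreal std_normal_exp_quadratic assms)
  also have "\<dots> = ennreal (exp (4 * real n * l\<^sup>2))"
    by (simp add: ennreal_power exp_of_nat_mult[symmetric] mult_ac)
  finally show ?thesis .
qed

lemma nn_integral_powr_symmetric:
  assumes c: "c \<ge> 0"
  shows "(\<integral>\<^sup>+z. ennreal (\<bar>z\<bar> powr (-4/5)) * indicator {-c..c} z \<partial>lborel) \<le> ennreal (10 * c powr (1/5))"
proof -
  have I: "((\<lambda>z. z powr (-4/5)) has_integral (c powr (-4/5+1) / (-4/5+1))) {0..c}"
    by (rule has_integral_powr_from_0) (use c in simp_all)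
  have p: "(\<integral>\<^sup>+z. ennreal (z powr (-4/5)) * indicator {0..c} z \<partial>lborel) = ennreal (5 * c powr (1/5))"
    using nn_integral_has_integral_lebesgue'[OF _ I] by simp
  have n: "(\<integral>\<^sup>+z. ennreal ((-z) powr (-4/5)) * indicator {0..c} (-z) \<partial>lborel) = ennreal (5 * c powr (1/5))"
    unfolding p[symmetric] by (subst nn_integral_real_affine[of "\<lambda>z. ennreal (z powr (-4/5)) * indicator {0..c} z" "-1" 0]) simp_all
  have "(\<integral>\<^sup>+z. ennreal (\<bar>z\<bar> powr (-4/5)) * indicator {-c..c} z \<partial>lborel)
     \<le> (\<integral>\<^sup>+z. ennreal (z powr (-4/5)) * indicator {0..c} z + ennreal ((-z) powr (-4/5)) * indicator {0..c} (-z) \<partial>lborel)"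
    by (intro nn_integral_mono) (auto simp: indicator_def abs_if)
  also have "\<dots> = ennreal (5 * c powr (1/5)) + ennreal (5 * c powr (1/5))"
    by (subst nn_integral_add) (simp_all only: p n, simp_all)
  also have "\<dots> = ennreal (10 * c powr (1/5))"
    by (simp add: ennreal_plus[symmetric] del: ennreal_plus)
  finally show ?thesis .
qed

lemma std_normal_negative_moment:
  "(\<integral>\<^sup>+z. ennreal (\<bar>z\<bar> powr (-4/5)) \<partial>std_normal_distribution) \<le> ennreal 11"
proof -
  interpret prob_space std_normal_distribution by (rule prob_space_normal_density) simp
  have "(\<integral>\<^sup>+z. ennreal (\<bar>z\<bar> powr (-4/5)) \<partial>std_normal_distribution)
      \<le> (\<integral>\<^sup>+z. ennreal (\<bar>z\<bar> powr (-4/5)) * indicator {-1..1} z + 1 \<partial>std_normal_distribution)"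
  proof (rule nn_integral_mono)
    fix z :: real
    have "\<bar>z\<bar> powr (-4/5) \<le> 1" if "z \<notin> {-1..1}"
      using that powr_mono2'[of "-4/5" 1 "\<bar>z\<bar>"] by (auto simp: abs_if split: if_splits)
    then show "ennreal (\<bar>z\<bar> powr (-4/5)) \<le> ennreal (\<bar>z\<bar> powr (-4/5)) * indicator {-1..1} z + 1"
      by (cases "z \<in> {-1..1}") (auto simp: ennreal_le_1)
  qed
  also have "\<dots> = (\<integral>\<^sup>+z. ennreal (\<bar>z\<bar> powr (-4/5)) * indicator {-1..1} z \<partial>std_normal_distribution) + 1"
    by (subst nn_integral_add) (simp_all add: emeasure_space_1[simplified])
  also have "(\<integral>\<^sup>+z. ennreal (\<bar>z\<bar> powr (-4/5)) * indicator {-1..1} z \<partial>std_normal_distribution)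
     = (\<integral>\<^sup>+z. ennreal (std_normal_density z) * (ennreal (\<bar>z\<bar> powr (-4/5)) * indicator {-1..1} z) \<partial>lborel)"
    by (subst nn_integral_density) simp_all
  also have "\<dots> \<le> (\<integral>\<^sup>+z. ennreal (\<bar>z\<bar> powr (-4/5)) * indicator {-1..1} z \<partial>lborel)"
  proof (rule nn_integral_mono)
    fix z :: real
    have "std_normal_density z \<le> 1 / sqrt (2 * pi)"
      by (simp add: std_normal_density_def divide_right_mono)
    also have "\<dots> \<le> 1" using pi_gt3 by simp
    finally have "ennreal (std_normal_density z) * (ennreal (\<bar>z\<bar> powr (-4/5)) * indicator {-1..1} z)
      \<le> 1 * (ennreal (\<bar>z\<bar> powr (-4/5)) * indicator {-1..1} z)"
      by (intro mult_right_mono) (simp_all add: ennreal_le_1)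
    then show "ennreal (std_normal_density z) * (ennreal (\<bar>z\<bar> powr (-4/5)) * indicator {-1..1} z)
      \<le> ennreal (\<bar>z\<bar> powr (-4/5)) * indicator {-1..1} z" by simp
  qed
  also have "\<dots> \<le> ennreal (10 * 1 powr (1/5))" by (rule nn_integral_powr_symmetric) simp
  finally have "(\<integral>\<^sup>+z. ennreal (\<bar>z\<bar> powr (-4/5)) \<partial>std_normal_distribution) \<le> ennreal 10 + 1"
    by (simp add: add_right_mono)
  also have "\<dots> = ennreal 11" by simp
  finally show ?thesis .
qed

lemma AE_gauss_neq:
  assumes n: "n \<ge> 1"
  shows "AE x in gauss n. euclid_norm n (\<lambda>i. x i - v i) > 0"
proof -
  have "AE z in std_normal_distribution. z \<noteq> v 1"
    by (subst AE_density) (use AE_lborel_singleton[of "v 1"] in auto)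
  then have "AE x in gauss n. x 1 \<noteq> v 1"
    unfolding gauss_def using n by (intro AE_PiM_component prob_space_normal_density) simp_all
  then show ?thesis
  proof eventually_elim
    case (elim x)
    then have "euclid_norm n (\<lambda>i. x i - v i) \<noteq> 0" using n by (auto simp: euclid_norm_eq_0_iff)
    then show ?case using euclid_norm_nonneg[of n "\<lambda>i. x i - v i"] by linarith
  qed
qed

text \<open>
  The squared distance from \<open>G\<close> to a fixed point \<open>v\<close> with \<open>|v|\<^sup>2 = n\<close> is \<open>2 n\<close> minus a sum of independent
  centered variables, so its moments are explicit. Only \<open>|v|\<close> enters: any vector with constant length behaves as
  \<open>X\<close> does here.
\<close>

lemma gauss_shift_perturbation:
  fixes v :: "nat \<Rightarrow> real"
  assumes n: "n \<ge> 1" and v: "(euclid_norm n v)\<^sup>2 = real n"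
  defines "\<zeta> \<equiv> \<lambda>x. 1 - (euclid_norm n (\<lambda>i. x i - v i))\<^sup>2 / (2 * real n)"
  shows "small_perturbation (gauss n) \<zeta>"
    and "(\<integral>x. (\<zeta> x)\<^sup>2 \<partial>gauss n) = 3 / (2 * real n)"
    and "(\<integral>x. \<zeta> x ^ 3 \<partial>gauss n) = - 4 / (real n)\<^sup>2"
    and "AE x in gauss n. \<zeta> x < 1"
proof -
  let ?S = "\<lambda>x. \<Sum>i=1..n. 1 - (x i)\<^sup>2 + 2 * v i * x i"
  have sv: "(\<Sum>i=1..n. (v i)\<^sup>2) = real n" using v by (simp add: euclid_norm_power2)
  have S: "2 * real n - (euclid_norm n (\<lambda>i. x i - v i))\<^sup>2 = ?S x" for x
  proof -
    have "(euclid_norm n (\<lambda>i. x i - v i))\<^sup>2 = (\<Sum>i=1..n. (x i)\<^sup>2 - 2 * v i * x i) + real n"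
      unfolding euclid_norm_power2 sv[symmetric] sum.distrib[symmetric]
      by (intro sum.cong refl) (simp add: power2_diff)
    then show ?thesis by (simp add: sum.distrib sum_subtractf)
  qed
  have "(euclid_norm n (\<lambda>i. x i - v i))\<^sup>2 = 2 * real n - ?S x" for x
    using S[of x] by linarith
  then have z: "\<zeta> x = ?S x / (2 * real n)" for x
    using n by (simp add: \<zeta>_def diff_divide_distrib)
  then have zf: "\<zeta> = (\<lambda>x. ?S x / (2 * real n))" by auto
  have z2: "(\<zeta> x)\<^sup>2 = (?S x)\<^sup>2 / (4 * (real n)\<^sup>2)" and z3: "\<zeta> x ^ 3 = ?S x ^ 3 / (8 * real n ^ 3)" for x
    unfolding z by (simp_all add: power_divide power_mult_distrib)
  note m = gauss_quadratic_sum_moments[OF n, of v, unfolded sv]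
  show "small_perturbation (gauss n) \<zeta>"
    unfolding small_perturbation_def small_perturbation_axioms_def z2 z3
    using m prob_space_gauss by (auto simp: zf)
  show "(\<integral>x. (\<zeta> x)\<^sup>2 \<partial>gauss n) = 3 / (2 * real n)"
    unfolding z2 using m(4) n by (simp add: field_simps power2_eq_square)
  show "(\<integral>x. \<zeta> x ^ 3 \<partial>gauss n) = - 4 / (real n)\<^sup>2"
    unfolding z3 using m(5) n by (simp add: field_simps power2_eq_square power3_eq_cube)
  show "AE x in gauss n. \<zeta> x < 1"
    using AE_gauss_neq[OF n, of v] by eventually_elim (use n in \<open>simp add: \<zeta>_def\<close>)
qed

definition gauss_moment_const :: real where
  "gauss_moment_const = 2 * fact 10 * exp (1/4) * 4 ^ 10"

text \<open>
  Here exponential moments give the tenth moment, and the squared length is bounded below by one squared coordinate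
  for the negative moment, at the cost of a factor \<open>n\<close>.
\<close>

lemma gauss_norm_perturbation:
  assumes n: "n \<ge> 1"
  defines "\<kappa> \<equiv> \<lambda>x. 1 - (euclid_norm n x)\<^sup>2 / real n"
  shows "concentrated_perturbation (gauss n) \<kappa> n gauss_moment_const"
    and "(\<integral>x. (\<kappa> x)\<^sup>2 \<partial>gauss n) = 2 / real n"
    and "(\<integral>x. \<kappa> x ^ 3 \<partial>gauss n) = - 8 / (real n)\<^sup>2"
    and "AE x in gauss n. \<kappa> x < 1"
    and "(\<integral>\<^sup>+x. ennreal ((1 - \<kappa> x) powr (-2/5)) \<partial>gauss n) \<le> ennreal (11 * real n)"
proof -
  let ?S = "\<lambda>x::nat \<Rightarrow> real. \<Sum>i=1..n. 1 - (x i)\<^sup>2"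
  have k: "\<kappa> x = ?S x / real n" for x
    using n by (simp add: \<kappa>_def euclid_norm_power2 sum_subtractf field_simps)
  then have kf: "\<kappa> = (\<lambda>x. ?S x / real n)" by auto
  have k2: "(\<kappa> x)\<^sup>2 = (?S x)\<^sup>2 / (real n)\<^sup>2" and k3: "\<kappa> x ^ 3 = ?S x ^ 3 / real n ^ 3"
    and k10: "\<kappa> x ^ 10 = ?S x ^ 10 / real n ^ 10" for x
    unfolding k by (simp_all add: power_divide)
  note m = gauss_quadratic_sum_moments[OF n, of "\<lambda>_. 0", simplified]
  \<comment> \<open>the scale on which the exponential moments are bounded in \<open>n\<close>, within the range \<open>|l| \<le> 1/4\<close>\<close>
  define l where "l = 1 / (4 * sqrt (real n))"
  have l: "l > 0" "\<bar>l\<bar> \<le> 1/4" "\<bar>- l\<bar> \<le> 1/4" "4 * real n * l\<^sup>2 = 1/4" "l ^ 10 = 1 / (4 ^ 10 * real n ^ 5)"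
  proof -
    have "sqrt (real n) \<ge> 1" using n by simp
    then show "l > 0" "\<bar>l\<bar> \<le> 1/4" "\<bar>- l\<bar> \<le> 1/4" by (simp_all add: l_def field_simps)
    show "4 * real n * l\<^sup>2 = 1/4" using n by (simp add: l_def power_divide power_mult_distrib)
    have "sqrt (real n) ^ 10 = (sqrt (real n) ^ 2) ^ 5" by (simp only: power_mult[symmetric]) simp
    then show "l ^ 10 = 1 / (4 ^ 10 * real n ^ 5)" by (simp add: l_def power_divide power_mult_distrib)
  qed
  have m10: "integrable (gauss n) (\<lambda>x. ?S x ^ 10)" "(\<integral>x. ?S x ^ 10 \<partial>gauss n) \<le> 2 * fact 10 * exp (1/4) / l ^ 10"
    using tenth_moment_from_exponential[of ?S "gauss n" l "exp (1/4)"] l(1)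
      gauss_exp_quadratic[OF l(2), of n] gauss_exp_quadratic[OF l(3), of n] l(4) by simp_all
  have "(\<integral>x. \<kappa> x ^ 10 \<partial>gauss n) = (\<integral>x. ?S x ^ 10 \<partial>gauss n) / real n ^ 10"
    unfolding k10 by simp
  also have "\<dots> \<le> 2 * fact 10 * exp (1/4) / l ^ 10 / real n ^ 10"
    using m10(2) by (rule divide_right_mono) simp
  also have "\<dots> = gauss_moment_const / real n ^ 5"
    unfolding l(5) gauss_moment_const_def using n by (simp add: field_simps flip: power_add)
  finally have mk10: "(\<integral>x. \<kappa> x ^ 10 \<partial>gauss n) \<le> gauss_moment_const / real n ^ 5" .
  have "small_perturbation (gauss n) \<kappa>"
    unfolding small_perturbation_def small_perturbation_axioms_def k2 k3
    using m prob_space_gauss by (auto simp: kf)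
  then show "concentrated_perturbation (gauss n) \<kappa> n gauss_moment_const"
    unfolding concentrated_perturbation_def concentrated_perturbation_axioms_def
    using n mk10 m10(1) by (simp add: k10)
  show "(\<integral>x. (\<kappa> x)\<^sup>2 \<partial>gauss n) = 2 / real n"
    unfolding k2 using m(4) n by (simp add: field_simps power2_eq_square)
  show "(\<integral>x. \<kappa> x ^ 3 \<partial>gauss n) = - 8 / (real n)\<^sup>2"
    unfolding k3 using m(5) n by (simp add: field_simps power2_eq_square power3_eq_cube)
  show "AE x in gauss n. \<kappa> x < 1"
    using AE_gauss_neq[OF n, of "\<lambda>_. 0"] by eventually_elim (use n in \<open>simp add: \<kappa>_def\<close>)
  show "(\<integral>\<^sup>+x. ennreal ((1 - \<kappa> x) powr (-2/5)) \<partial>gauss n) \<le> ennreal (11 * real n)"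
  proof -
    have meas: "(\<lambda>x. x 1) \<in> gauss n \<rightarrow>\<^sub>M std_normal_distribution" using n by (intro component_measurable_gauss) simp
    have "AE z in std_normal_distribution. z \<noteq> 0"
      by (subst AE_density) (use AE_lborel_singleton[of "0::real"] in auto)
    then have "AE x in gauss n. x 1 \<noteq> 0"
      unfolding gauss_def using n by (intro AE_PiM_component prob_space_normal_density) simp_all
    then have "AE x in gauss n. ennreal ((1 - \<kappa> x) powr (-2/5)) \<le> ennreal (real n) * ennreal (\<bar>x 1\<bar> powr (-4/5))"
    proof eventually_elim
      case (elim x)
      have "(x 1)\<^sup>2 \<le> (euclid_norm n x)\<^sup>2"
        unfolding euclid_norm_power2 using n by (intro member_le_sum) auto
      then have "(x 1)\<^sup>2 / real n \<le> 1 - \<kappa> x"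
        unfolding \<kappa>_def by (simp add: divide_right_mono)
      then have "(1 - \<kappa> x) powr (-2/5) \<le> ((x 1)\<^sup>2 / real n) powr (-2/5)"
        using elim n by (intro powr_mono2') simp_all
      also have "\<dots> = ((x 1)\<^sup>2) powr (-2/5) * real n powr (2/5)"
        by (simp add: powr_divide powr_minus_divide)
      also have "((x 1)\<^sup>2) powr (-2/5) = \<bar>x 1\<bar> powr (-4/5)"
        using elim powr_powr[of "\<bar>x 1\<bar>" 2 "-2/5"] by (simp add: powr_numeral)
      also have "\<bar>x 1\<bar> powr (-4/5) * real n powr (2/5) \<le> \<bar>x 1\<bar> powr (-4/5) * real n powr 1"
        using n by (intro mult_left_mono powr_mono) simp_all
      finally have "(1 - \<kappa> x) powr (-2/5) \<le> real n * \<bar>x 1\<bar> powr (-4/5)" by (simp add: mult.commute)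
      then show ?case by (simp add: ennreal_mult'[symmetric] ennreal_leI)
    qed
    then have "(\<integral>\<^sup>+x. ennreal ((1 - \<kappa> x) powr (-2/5)) \<partial>gauss n)
      \<le> (\<integral>\<^sup>+x. ennreal (real n) * ennreal (\<bar>x 1\<bar> powr (-4/5)) \<partial>gauss n)"
      by (rule nn_integral_mono_AE)
    also have "\<dots> = ennreal (real n) * (\<integral>\<^sup>+x. ennreal (\<bar>x 1\<bar> powr (-4/5)) \<partial>gauss n)"
      using n by (intro nn_integral_cmult) simp
    also have "(\<integral>\<^sup>+x. ennreal (\<bar>x 1\<bar> powr (-4/5)) \<partial>gauss n) = (\<integral>\<^sup>+z. ennreal (\<bar>z\<bar> powr (-4/5)) \<partial>std_normal_distribution)"
      using nn_integral_distr[OF meas, of "\<lambda>z. ennreal (\<bar>z\<bar> powr (-4/5))"] n by (simp add: distr_gauss_component)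
    also have "ennreal (real n) * \<dots> \<le> ennreal (real n) * ennreal 11"
      by (intro mult_left_mono std_normal_negative_moment) simp
    also have "\<dots> = ennreal (11 * real n)" by (simp add: ennreal_mult mult.commute)
    finally show ?thesis .
  qed
qed

section \<open>Lacunary cosine sums\<close>

lemma sets_unif_circle: "sets unif_circle = sets (restrict_space borel {-pi<..<pi})"
  by (simp add: unif_circle_def cong: sets_restrict_space_cong)

lemma space_unif_circle: "space unif_circle = {-pi<..<pi}"
  by (simp add: unif_circle_def space_restrict_space)

lemma measurable_unif_circle: "f \<in> borel_measurable borel \<Longrightarrow> f \<in> borel_measurable unif_circle"
  by (subst measurable_cong_sets[OF sets_unif_circle refl]) (rule measurable_restrict_space1)

lemma nn_integral_unif_circle:
  assumes [measurable]: "f \<in> borel_measurable borel"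
  shows "(\<integral>\<^sup>+t. f t \<partial>unif_circle) = ennreal (1 / (2 * pi)) * (\<integral>\<^sup>+t. f t * indicator {-pi..pi} t \<partial>lborel)"
proof -
  have [measurable]: "f \<in> borel_measurable (restrict_space lborel {-pi<..<pi})"
    by (intro measurable_restrict_space1) simp
  have "(\<integral>\<^sup>+t. f t \<partial>unif_circle) = ennreal (1 / (2 * pi)) * (\<integral>\<^sup>+t. f t \<partial>restrict_space lborel {-pi<..<pi})"
    unfolding unif_circle_def by (subst nn_integral_density) (simp_all add: nn_integral_cmult)
  also have "(\<integral>\<^sup>+t. f t \<partial>restrict_space lborel {-pi<..<pi}) = (\<integral>\<^sup>+t. f t * indicator {-pi<..<pi} t \<partial>lborel)"
    by (rule nn_integral_restrict_space) simp
  also have "\<dots> = (\<integral>\<^sup>+t. f t * indicator {-pi..pi} t \<partial>lborel)"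
  proof (rule nn_integral_cong_AE)
    show "AE t in lborel. f t * indicator {-pi<..<pi} t = f t * indicator {-pi..pi} t"
      using AE_lborel_singleton[of "-pi"] AE_lborel_singleton[of pi]
      by eventually_elim (auto simp: indicator_def)
  qed
  finally show ?thesis .
qed

lemma integral_unif_circle_FTC:
  fixes f F :: "real \<Rightarrow> real"
  assumes F: "\<And>t. (F has_real_derivative f t) (at t)" and f: "continuous_on UNIV f"
  shows "(\<integral>t. f t \<partial>unif_circle) = (F pi - F (-pi)) / (2 * pi)"
proof -
  have [measurable]: "f \<in> borel_measurable borel" by (rule borel_measurable_continuous_onI[OF f])
  have [measurable]: "f \<in> borel_measurable (restrict_space lborel {-pi<..<pi})"
    by (intro measurable_restrict_space1) simp
  have "(\<integral>t. f t \<partial>unif_circle) = (\<integral>t. 1 / (2 * pi) * f t \<partial>restrict_space lborel {-pi<..<pi})"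
    unfolding unif_circle_def by (subst integral_density) simp_all
  also have "\<dots> = 1 / (2 * pi) * (\<integral>t. indicator {-pi<..<pi} t *\<^sub>R f t \<partial>lborel)"
    by (simp add: integral_restrict_space)
  also have "(\<integral>t. indicator {-pi<..<pi} t *\<^sub>R f t \<partial>lborel) = (\<integral>t. indicator {-pi..pi} t *\<^sub>R f t \<partial>lborel)"
  proof (rule integral_cong_AE)
    show "AE t in lborel. indicator {-pi<..<pi} t *\<^sub>R f t = indicator {-pi..pi} t *\<^sub>R f t"
      using AE_lborel_singleton[of "-pi"] AE_lborel_singleton[of pi]
      by eventually_elim (auto simp: indicator_def)
  qed simp_all
  also have "\<dots> = F pi - F (-pi)"
  proof (rule integral_FTC_Icc)
    show "- pi \<le> pi" by simp
    show "(F has_vector_derivative f t) (at t within {-pi..pi})" for t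
      using F[of t] by (simp add: has_real_derivative_iff_has_vector_derivative has_vector_derivative_at_within)
    show "continuous_on {-pi..pi} f" by (rule continuous_on_subset[OF f]) simp
  qed
  finally show ?thesis by simp
qed

lemma circle_mean_cos:
  assumes "M \<noteq> (0::int)"
  shows "(\<integral>t. cos (of_int M * (t - s)) \<partial>unif_circle) = 0"
proof -
  let ?F = "\<lambda>t. sin (of_int M * (t - s)) / of_int M"
  have "(\<integral>t. cos (of_int M * (t - s)) \<partial>unif_circle) = (?F pi - ?F (-pi)) / (2 * pi)"
  proof (rule integral_unif_circle_FTC)
    show "(?F has_real_derivative cos (of_int M * (t - s))) (at t)" for t
      using assms by (auto intro!: derivative_eq_intros)
  qed (intro continuous_intros)
  also have "sin (of_int M * (pi - s)) = sin (of_int M * (- pi - s) + of_int M * (2 * pi))"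
    by (simp add: algebra_simps)
  also have "\<dots> = sin (of_int M * (- pi - s))"
    by (simp only: sin_add cos_int_2pin sin_int_2pin mult.commute[of _ "2 * pi"])
  finally show ?thesis by simp
qed

lemma integrable_circle:
  assumes "continuous_on UNIV (f :: real \<Rightarrow> real)"
  shows "integrable unif_circle f"
proof -
  interpret prob_space unif_circle by (rule prob_space_unif_circle)
  have "compact (f ` {-pi..pi})"
    by (intro compact_continuous_image continuous_on_subset[OF assms]) auto
  then obtain B where "\<forall>x\<in>f ` {-pi..pi}. norm x \<le> B"
    using compact_imp_bounded bounded_iff by blast
  then have B: "\<And>t. t \<in> {-pi..pi} \<Longrightarrow> \<bar>f t\<bar> \<le> B" by simp
  show ?thesis
  proof (rule integrable_const_bound)
    show "AE t in unif_circle. norm (f t) \<le> B"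
      using B by (intro AE_I2) (simp add: space_unif_circle)
    show "f \<in> borel_measurable unif_circle"
      by (intro measurable_unif_circle borel_measurable_continuous_onI assms)
  qed
qed

text \<open>
  Expanding the product produces only frequencies up to the sum of the \<open>r i\<close>, all smaller than \<open>M\<close>. The
  induction adds or subtracts one \<open>r i\<close> from \<open>M\<close> at a time.
\<close>

lemma riesz_product_orthogonal:
  fixes r :: "nat \<Rightarrow> nat" and c d :: real
  assumes "finite A" "M > (\<Sum>i\<in>A. int (r i))"
  shows "(\<integral>t. (\<Prod>i\<in>A. c + d * cos (real (r i) * (t - s))) * cos (of_int M * (t - s)) \<partial>unif_circle) = 0"
  using assms
proof (induction A arbitrary: M rule: finite_induct)
  case empty
  then show ?case using circle_mean_cos[of M s] by simp
next
  case (insert b A)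
  let ?P = "\<lambda>t. \<Prod>i\<in>A. c + d * cos (real (r i) * (t - s))"
  have cont: "continuous_on UNIV (\<lambda>t. ?P t * cos (of_int K * (t - s)))" for K :: int
    by (intro continuous_intros)
  note int = integrable_circle[OF cont]
  have "(\<Sum>i\<in>A. int (r i)) \<ge> 0" by (simp add: sum_nonneg)
  then have M: "M > (\<Sum>i\<in>A. int (r i))" "M - int (r b) > (\<Sum>i\<in>A. int (r i))" "M + int (r b) > (\<Sum>i\<in>A. int (r i))"
    using insert by auto
  have "(\<Prod>i\<in>insert b A. c + d * cos (real (r i) * (t - s))) * cos (of_int M * (t - s))
    = c * (?P t * cos (of_int M * (t - s))) + d / 2 * (?P t * cos (of_int (M - int (r b)) * (t - s)))
      + d / 2 * (?P t * cos (of_int (M + int (r b)) * (t - s)))" for t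
  proof -
    have "cos (real (r b) * (t - s)) * cos (of_int M * (t - s))
      = (cos (of_int (M - int (r b)) * (t - s)) + cos (of_int (M + int (r b)) * (t - s))) / 2"
      using cos_times_cos[of "of_int M * (t - s)" "real (r b) * (t - s)"] by (simp add: algebra_simps)
    moreover have "(c + d * x) * P * y = c * (P * y) + d / 2 * (P * u) + d / 2 * (P * v)"
      if "x * y = (u + v) / 2" for x y u v P :: real
    proof -
      have "(c + d * x) * P * y = c * (P * y) + d * P * (x * y)" by (simp add: algebra_simps)
      then show ?thesis unfolding that by (simp add: algebra_simps)
    qed
    ultimately show ?thesis
      unfolding prod.insert[OF insert.hyps] by blast
  qed
  then show ?case
    using insert.IH[OF M(1)] insert.IH[OF M(2)] insert.IH[OF M(3)] int[of M] int[of "M - int (r b)"] int[of "M + int (r b)"] by simp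
qed

text \<open>
  Each frequency exceeds the sum of the previous ones, as frequencies double; hence each new factor is orthogonal
  to the product so far, and only the constant terms survive. The second conjunct is that frequency comparison, carried along by
  the same induction.
\<close>

lemma riesz_product_mean:
  fixes r :: "nat \<Rightarrow> nat" and c d :: real
  assumes "finite A" "\<And>i. i \<in> A \<Longrightarrow> r i > 0" "\<And>i j. i \<in> A \<Longrightarrow> j \<in> A \<Longrightarrow> i < j \<Longrightarrow> r j \<ge> 2 * r i"
  shows "(\<integral>t. (\<Prod>i\<in>A. c + d * cos (real (r i) * (t - s))) \<partial>unif_circle) = c ^ card A
    \<and> (\<forall>b. (\<forall>i\<in>A. b \<ge> 2 * r i) \<longrightarrow> b > 0 \<longrightarrow> b > (\<Sum>i\<in>A. r i))"
  using assms
proof (induction A rule: finite_linorder_max_induct)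
  case empty
  interpret prob_space unif_circle by (rule prob_space_unif_circle)
  show ?case by (simp add: prob_space)
next
  case (insert b A)
  let ?P = "\<lambda>t. \<Prod>i\<in>A. c + d * cos (real (r i) * (t - s))"
  have b: "b \<notin> A" using insert.hyps by auto
  have IH: "(\<integral>t. ?P t \<partial>unif_circle) = c ^ card A" "\<And>b'. (\<forall>i\<in>A. b' \<ge> 2 * r i) \<Longrightarrow> b' > 0 \<Longrightarrow> b' > (\<Sum>i\<in>A. r i)"
    using insert.IH insert.prems by auto
  have lt: "r b > (\<Sum>i\<in>A. r i)" using insert.hyps insert.prems by (intro IH(2)) auto
  have ort: "(\<integral>t. ?P t * cos (of_int (int (r b)) * (t - s)) \<partial>unif_circle) = 0"
    using lt insert.hyps(1) by (intro riesz_product_orthogonal) (simp_all flip: of_nat_sum)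
  have int: "integrable unif_circle ?P" "integrable unif_circle (\<lambda>t. ?P t * cos (of_int (int (r b)) * (t - s)))"
    by (intro integrable_circle continuous_intros)+
  have "(\<Prod>i\<in>insert b A. c + d * cos (real (r i) * (t - s))) = c * ?P t + d * (?P t * cos (of_int (int (r b)) * (t - s)))" for t
    using insert.hyps(1) b by (simp add: algebra_simps)
  then have "(\<integral>t. (\<Prod>i\<in>insert b A. c + d * cos (real (r i) * (t - s))) \<partial>unif_circle) = c ^ card (insert b A)"
    using int IH(1) ort insert.hyps(1) b by simp
  moreover have "b' > (\<Sum>i\<in>insert b A. r i)" if "\<forall>i\<in>insert b A. b' \<ge> 2 * r i" for b'
    using that lt insert.hyps(1) b by simp
  ultimately show ?case by blast
qed

text \<open>
  By convexity the exponential lies below its chord between the endpoints.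
\<close>

lemma exp_le_chord:
  fixes l y :: real
  assumes "\<bar>y\<bar> \<le> 1"
  shows "exp (l * y) \<le> cosh l + sinh l * y"
proof -
  have "exp ((1 - (1 + y) / 2) *\<^sub>R (- l) + ((1 + y) / 2) *\<^sub>R l) \<le> (1 - (1 + y) / 2) * exp (- l) + ((1 + y) / 2) * exp l"
    using assms by (intro convex_onD[OF exp_convex]) (auto simp: abs_le_iff)
  also have "(1 - (1 + y) / 2) *\<^sub>R (- l) + ((1 + y) / 2) *\<^sub>R l = l * y" by (simp add: field_simps)
  finally show ?thesis by (simp add: cosh_field_def sinh_field_def field_simps)
qed

lemma cosh_le_exp_square:
  fixes l :: real
  assumes "\<bar>l\<bar> \<le> 1" shows "cosh l \<le> exp (l\<^sup>2)"
proof -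
  define a where "a = \<bar>l\<bar>"
  have a: "0 \<le> a" "a \<le> 1" using assms by (simp_all add: a_def)
  have "exp a \<le> 1 + a + a\<^sup>2" by (rule exp_bound) (use a in simp_all)
  moreover have "exp (- a) \<le> 1 - a + a\<^sup>2"
  proof -
    have "exp (- a) = 1 / exp a" by (simp add: exp_minus inverse_eq_divide)
    also have "\<dots> \<le> 1 / (1 + a)" using a exp_ge_add_one_self[of a] by (intro divide_left_mono) simp_all
    also have "1 \<le> (1 + a) * (1 - a + a\<^sup>2)" using a by (simp add: algebra_simps power2_eq_square)
    then have "1 / (1 + a) \<le> 1 - a + a\<^sup>2" using a by (simp add: field_simps)
    finally show ?thesis .
  qed
  ultimately have "cosh a \<le> 1 + a\<^sup>2" by (simp add: cosh_field_def)
  also have "\<dots> \<le> exp (a\<^sup>2)" by (rule exp_ge_add_one_self)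
  finally show ?thesis by (auto simp: a_def abs_if split: if_splits)
qed

text \<open>
  The chord bound replaces the exponential of the sum by a Riesz product, whose mean is explicit. The cosines behave
  like independent bounded variables.
\<close>

lemma dissociate_exp_moment:
  fixes r :: "nat \<Rightarrow> nat"
  assumes A: "finite A" "\<And>i. i \<in> A \<Longrightarrow> r i > 0" "\<And>i j. i \<in> A \<Longrightarrow> j \<in> A \<Longrightarrow> i < j \<Longrightarrow> r j \<ge> 2 * r i"
    and l: "\<bar>l\<bar> \<le> 1"
  shows "(\<integral>\<^sup>+t. ennreal (exp (l * (\<Sum>i\<in>A. cos (real (r i) * (t - s))))) \<partial>unif_circle) \<le> ennreal (exp (real (card A) * l\<^sup>2))"
proof -
  let ?P = "\<lambda>t. \<Prod>i\<in>A. cosh l + sinh l * cos (real (r i) * (t - s))"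
  have le: "exp (l * cos (real (r i) * (t - s))) \<le> cosh l + sinh l * cos (real (r i) * (t - s))" for i t
    by (rule exp_le_chord) simp
  have "(\<integral>\<^sup>+t. ennreal (exp (l * (\<Sum>i\<in>A. cos (real (r i) * (t - s))))) \<partial>unif_circle) \<le> (\<integral>\<^sup>+t. ennreal (?P t) \<partial>unif_circle)"
    unfolding sum_distrib_left exp_sum[OF A(1)]
    by (intro nn_integral_mono ennreal_leI prod_mono conjI le) simp
  also have "\<dots> = ennreal (\<integral>t. ?P t \<partial>unif_circle)"
    by (intro nn_integral_eq_integral integrable_circle continuous_intros AE_I2 prod_nonneg order_trans[OF _ le]) simp
  also have "(\<integral>t. ?P t \<partial>unif_circle) = cosh l ^ card A"
    using riesz_product_mean[OF A, where c="cosh l" and d="sinh l" and s=s] by simp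
  also have "\<dots> \<le> exp (l\<^sup>2) ^ card A"
    by (intro power_mono cosh_le_exp_square l cosh_real_nonneg)
  also have "\<dots> = exp (real (card A) * l\<^sup>2)" by (simp add: exp_of_nat_mult)
  finally show ?thesis by (simp add: ennreal_leI)
qed

text \<open>
  The choice \<open>l = 1 / sqrt N\<close> makes the exponential moment bounded.
\<close>

lemma dissociate_tenth_moment:
  fixes r :: "nat \<Rightarrow> nat" and N :: nat
  assumes A: "finite A" "\<And>i. i \<in> A \<Longrightarrow> r i > 0" "\<And>i j. i \<in> A \<Longrightarrow> j \<in> A \<Longrightarrow> i < j \<Longrightarrow> r j \<ge> 2 * r i"
    and N: "card A \<le> N" "N \<ge> 1"
  shows "(\<integral>t. (\<Sum>i\<in>A. cos (real (r i) * (t - s))) ^ 10 \<partial>unif_circle) \<le> 2 * fact 10 * exp 1 * real N ^ 5"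
proof -
  let ?S = "\<lambda>t. \<Sum>i\<in>A. cos (real (r i) * (t - s))"
  define l where "l = 1 / sqrt (real N)"
  have l: "l > 0" "\<bar>l\<bar> \<le> 1" "\<bar>- l\<bar> \<le> 1" "l\<^sup>2 = 1 / real N" "l ^ 10 = 1 / real N ^ 5"
  proof -
    have "sqrt (real N) ^ 10 = (sqrt (real N) ^ 2) ^ 5" by (simp only: power_mult[symmetric]) simp
    then show "l > 0" "\<bar>l\<bar> \<le> 1" "\<bar>- l\<bar> \<le> 1" "l\<^sup>2 = 1 / real N" "l ^ 10 = 1 / real N ^ 5"
      using N by (simp_all add: l_def power_divide)
  qed
  have "exp (real (card A) * l\<^sup>2) \<le> exp 1"
    using N unfolding l(4) by (simp add: field_simps)
  then have e: "ennreal (exp (real (card A) * l\<^sup>2)) \<le> ennreal (exp 1)" by (rule ennreal_leI)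
  have m: "?S \<in> borel_measurable unif_circle" by (intro measurable_unif_circle) simp
  have "(\<integral>t. ?S t ^ 10 \<partial>unif_circle) \<le> 2 * fact 10 * exp 1 / l ^ 10"
    using tenth_moment_from_exponential(2)[OF m l(1), of "exp 1"]
      order_trans[OF dissociate_exp_moment[OF A l(2), where s=s] e] order_trans[OF dissociate_exp_moment[OF A l(3), where s=s]] e by simp
  then show ?thesis unfolding l(5) using N by (simp add: field_simps)
qed

text \<open>
  The sum is at most the number of terms times the largest one in absolute value.
\<close>

lemma abs_sum_power10_le:
  fixes f :: "nat \<Rightarrow> real"
  shows "(\<Sum>r<L. f r) ^ 10 \<le> real L ^ 10 * (\<Sum>r<L. f r ^ 10)"
proof (cases "L = 0")
  case False
  then have "Max ((\<lambda>r. \<bar>f r\<bar>) ` {..<L}) \<in> (\<lambda>r. \<bar>f r\<bar>) ` {..<L}"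
    by (intro Max_in) auto
  then obtain k where "k < L" "Max ((\<lambda>r. \<bar>f r\<bar>) ` {..<L}) = \<bar>f k\<bar>" by auto
  then have k: "k < L" "\<And>r. r < L \<Longrightarrow> \<bar>f r\<bar> \<le> \<bar>f k\<bar>"
    using Max_ge[of "(\<lambda>r. \<bar>f r\<bar>) ` {..<L}"] by auto
  have "\<bar>\<Sum>r<L. f r\<bar> \<le> (\<Sum>r<L. \<bar>f k\<bar>)"
    using k by (intro order_trans[OF sum_abs] sum_mono) simp
  then have "\<bar>\<Sum>r<L. f r\<bar> \<le> real L * \<bar>f k\<bar>" by simp
  then have "\<bar>\<Sum>r<L. f r\<bar> ^ 10 \<le> (real L * \<bar>f k\<bar>) ^ 10" by (intro power_mono) simp_all
  also have "\<dots> = real L ^ 10 * f k ^ 10" by (simp add: power_mult_distrib)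
  also have "\<dots> \<le> real L ^ 10 * (\<Sum>r<L. f r ^ 10)"
    using k(1) by (intro mult_left_mono member_le_sum) auto
  finally show ?thesis by simp
qed simp

lemma circle_mean_cos_nat:
  assumes "M > (0::nat)"
  shows "(\<integral>t. cos (real M * (t - s)) \<partial>unif_circle) = 0"
  using circle_mean_cos[of "int M" s] assms by simp

lemma circle_mean_cos_of_bool:
  "(\<integral>t. cos (of_int M * (t - s)) \<partial>unif_circle) = of_bool (M = 0)"
proof (cases "M = 0")
  case True
  interpret prob_space unif_circle by (rule prob_space_unif_circle)
  show ?thesis using True by (simp add: prob_space)
qed (simp add: circle_mean_cos)

lemma circle_mean_cos_cos:
  assumes "a > 0" "b > (0::nat)"
  shows "(\<integral>t. cos (real a * (t - s)) * cos (real b * (t - s)) \<partial>unif_circle) = of_bool (a = b) / 2"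
proof -
  have e: "cos (real a * (t - s)) * cos (real b * (t - s))
    = (cos (of_int (int a - int b) * (t - s)) + cos (of_int (int a + int b) * (t - s))) / 2" for t
    by (simp only: cos_times_cos of_int_diff of_int_add of_int_of_nat_eq distrib_right left_diff_distrib)
  have i: "integrable unif_circle (\<lambda>t. cos (of_int K * (t - s)))" for K :: int
    by (intro integrable_circle continuous_intros)
  have "(\<integral>t. cos (real a * (t - s)) * cos (real b * (t - s)) \<partial>unif_circle)
    = ((\<integral>t. cos (of_int (int a - int b) * (t - s)) \<partial>unif_circle) + (\<integral>t. cos (of_int (int a + int b) * (t - s)) \<partial>unif_circle)) / 2"
    unfolding e using i[of "int a - int b"] i[of "int a + int b"] by simp
  also have "\<dots> = of_bool (a = b) / 2"
    unfolding circle_mean_cos_of_bool using assms by simp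
  finally show ?thesis .
qed

lemma circle_mean_cos_cos_cos:
  assumes "a > 0" "b > 0" "c > (0::nat)"
  shows "(\<integral>t. cos (real a * (t - s)) * cos (real b * (t - s)) * cos (real c * (t - s)) \<partial>unif_circle)
    = (of_bool (a + b = c) + of_bool (a + c = b) + of_bool (b + c = a)) / 4"
proof -
  have p: "cos x * cos y * cos z = (cos (x + y + z) + cos (x + y - z) + cos (x + z - y) + cos (y + z - x)) / 4" for x y z :: real
  proof -
    have "cos x * cos y * cos z = (cos (x - y) * cos z + cos (x + y) * cos z) / 2"
      unfolding cos_times_cos[of x y] by (simp add: field_simps)
    also have "cos (x - y) * cos z = (cos (x - y - z) + cos (x - y + z)) / 2" by (rule cos_times_cos)
    also have "cos (x + y) * cos z = (cos (x + y - z) + cos (x + y + z)) / 2" by (rule cos_times_cos)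
    also have "cos (x - y - z) = cos (y + z - x)"
      using cos_minus[of "y + z - x"] by (simp add: algebra_simps)
    also have "x - y + z = x + z - y" by simp
    finally show ?thesis by (simp add: field_simps)
  qed
  have e: "cos (real a * (t - s)) * cos (real b * (t - s)) * cos (real c * (t - s))
    = (cos (of_int (int a + int b + int c) * (t - s)) + cos (of_int (int a + int b - int c) * (t - s))
      + cos (of_int (int a + int c - int b) * (t - s)) + cos (of_int (int b + int c - int a) * (t - s))) / 4" for t
    by (simp only: p of_int_diff of_int_add of_int_of_nat_eq distrib_right left_diff_distrib)
  have i: "integrable unif_circle (\<lambda>t. cos (of_int K * (t - s)))" for K :: int
    by (intro integrable_circle continuous_intros)
  have "(\<integral>t. cos (real a * (t - s)) * cos (real b * (t - s)) * cos (real c * (t - s)) \<partial>unif_circle)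
    = ((\<integral>t. cos (of_int (int a + int b + int c) * (t - s)) \<partial>unif_circle)
     + (\<integral>t. cos (of_int (int a + int b - int c) * (t - s)) \<partial>unif_circle)
     + (\<integral>t. cos (of_int (int a + int c - int b) * (t - s)) \<partial>unif_circle)
     + (\<integral>t. cos (of_int (int b + int c - int a) * (t - s)) \<partial>unif_circle)) / 4"
    unfolding e using i[of "int a + int b + int c"] i[of "int a + int b - int c"] i[of "int a + int c - int b"] i[of "int b + int c - int a"]
    by simp
  also have "\<dots> = (of_bool (a + b = c) + of_bool (a + c = b) + of_bool (b + c = a)) / 4"
  proof -
    have "int a + int b + int c \<noteq> 0" "int a + int b - int c = 0 \<longleftrightarrow> a + b = c"
      "int a + int c - int b = 0 \<longleftrightarrow> a + c = b" "int b + int c - int a = 0 \<longleftrightarrow> b + c = a"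
      using assms by linarith+
    then show ?thesis unfolding circle_mean_cos_of_bool by simp
  qed
  finally show ?thesis .
qed

text \<open>
  From the quartic Taylor bound for the cosine, with \<open>pi\<^sup>2 \<le> 10\<close>.
\<close>

lemma one_minus_cos_lower:
  fixes y :: real
  assumes "\<bar>y\<bar> \<le> pi"
  shows "y\<^sup>2 / 12 \<le> 1 - cos y"
proof -
  obtain u where "cos y = (\<Sum>m<4. cos_coeff m * y ^ m) + (cos (u + 1/2 * real 4 * pi) / fact 4) * y ^ 4"
    using Maclaurin_cos_expansion[of y 4] by blast
  moreover have "(\<Sum>m<4. cos_coeff m * y ^ m) = 1 - y\<^sup>2 / 2"
  proof -
    have "{..<4::nat} = {0, 1, 2, 3}" by auto
    then show ?thesis by (simp add: cos_coeff_def fact_numeral)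
  qed
  moreover have "(cos (u + 1/2 * real 4 * pi) / fact 4) * y ^ 4 \<le> 1 / 24 * y ^ 4"
    by (intro mult_right_mono) (simp_all add: fact_numeral)
  ultimately have "cos y \<le> 1 - y\<^sup>2 / 2 + y ^ 4 / 24" by linarith
  moreover have "y ^ 4 / 24 \<le> 10 * y\<^sup>2 / 24"
  proof -
    have "pi \<le> 63/20" by (rule order_trans[OF pi_approx(2)]) simp
    with assms have "\<bar>y\<bar> \<le> 63/20" by linarith
    then have "\<bar>y\<bar>\<^sup>2 \<le> (63/20)\<^sup>2" by (intro power_mono) simp_all
    then have "y\<^sup>2 \<le> 10" by (simp add: power2_eq_square)
    then have "y\<^sup>2 * y\<^sup>2 \<le> 10 * y\<^sup>2" by (intro mult_right_mono) simp_all
    then show ?thesis by (simp flip: power_add)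
  qed
  ultimately show ?thesis by simp
qed

lemma nn_integral_one_minus_cos:
  "(\<integral>\<^sup>+y. ennreal ((1 - cos y) powr (-2/5)) * indicator {-pi..<pi} y \<partial>lborel) \<le> ennreal 480"
proof -
  have "(\<integral>\<^sup>+y. ennreal ((1 - cos y) powr (-2/5)) * indicator {-pi..<pi} y \<partial>lborel)
     \<le> (\<integral>\<^sup>+y. ennreal 12 * (ennreal (\<bar>y\<bar> powr (-4/5)) * indicator {-pi..pi} y) \<partial>lborel)"
  proof (rule nn_integral_mono)
    fix y :: real
    show "ennreal ((1 - cos y) powr (-2/5)) * indicator {-pi..<pi} y
       \<le> ennreal 12 * (ennreal (\<bar>y\<bar> powr (-4/5)) * indicator {-pi..pi} y)"
    proof (cases "y \<in> {-pi..<pi} \<and> y \<noteq> 0")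
      case True
      then have "(1 - cos y) powr (-2/5) \<le> (y\<^sup>2 / 12) powr (-2/5)"
        by (intro powr_mono2' one_minus_cos_lower) (auto simp: abs_le_iff)
      also have "\<dots> = (y\<^sup>2) powr (-2/5) * 12 powr (2/5)"
        by (simp add: powr_divide powr_minus_divide)
      also have "(y\<^sup>2) powr (-2/5) = \<bar>y\<bar> powr (-4/5)"
        using True powr_powr[of "\<bar>y\<bar>" 2 "-2/5"] by (simp add: powr_numeral)
      also have "\<bar>y\<bar> powr (-4/5) * 12 powr (2/5) \<le> \<bar>y\<bar> powr (-4/5) * 12 powr 1"
        by (intro mult_left_mono powr_mono) simp_all
      finally have "(1 - cos y) powr (-2/5) \<le> 12 * \<bar>y\<bar> powr (-4/5)" by simp
      then have "ennreal ((1 - cos y) powr (-2/5)) \<le> ennreal 12 * ennreal (\<bar>y\<bar> powr (-4/5))"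
        by (subst ennreal_mult[symmetric]) (simp_all add: ennreal_leI)
      then show ?thesis using True by simp
    qed auto
  qed
  also have "\<dots> = ennreal 12 * (\<integral>\<^sup>+y. ennreal (\<bar>y\<bar> powr (-4/5)) * indicator {-pi..pi} y \<partial>lborel)"
    by (rule nn_integral_cmult) measurable
  also have "\<dots> \<le> ennreal 12 * ennreal (10 * pi powr (1/5))"
    by (intro mult_left_mono nn_integral_powr_symmetric) simp_all
  also have "\<dots> = ennreal (12 * (10 * pi powr (1/5)))"
    by (rule ennreal_mult[symmetric]) simp_all
  also have "\<dots> \<le> ennreal 480"
  proof (rule ennreal_leI)
    have "pi powr (1/5) \<le> pi powr 1" using pi_gt3 by (intro powr_mono) simp_all
    also have "\<dots> \<le> 4" using pi_less_4 by simp
    finally show "12 * (10 * pi powr (1/5)) \<le> 480" by simp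
  qed
  finally show ?thesis .
qed

text \<open>
  The substitution \<open>x = m (t - s)\<close> maps the interval to one of length \<open>2 pi m\<close>, which is covered by \<open>m + 1\<close> periods;
  the factor 2 bounds \<open>(m + 1) / m\<close>.
\<close>

lemma nn_integral_periodic_dilate:
  fixes g :: "real \<Rightarrow> ennreal" and m :: nat
  assumes [measurable]: "g \<in> borel_measurable borel" and per: "\<And>x j. g (x + 2 * pi * of_int j) = g x" and m: "m > 0"
  shows "(\<integral>\<^sup>+t. g (real m * (t - s)) * indicator {-pi..pi} t \<partial>lborel)
    \<le> 2 * (\<integral>\<^sup>+y. g y * indicator {-pi..<pi} y \<partial>lborel)"
proof -
  let ?I = "\<integral>\<^sup>+y. g y * indicator {-pi..<pi} y \<partial>lborel"
  define J where "J j = {-pi + 2 * pi * of_int j..<pi + 2 * pi * of_int j}" for j :: int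
  \<comment> \<open>the first period that meets the dilated interval\<close>
  define j0 where "j0 = \<lfloor>(real m * (- pi - s) + pi) / (2 * pi)\<rfloor>"
  have [measurable]: "J j \<in> sets borel" for j by (simp add: J_def)
  have I: "(\<integral>\<^sup>+x. g x * indicator (J j) x \<partial>lborel) = ?I" for j
  proof -
    have "(\<integral>\<^sup>+x. g x * indicator (J j) x \<partial>lborel)
      = (\<integral>\<^sup>+y. g (2 * pi * of_int j + 1 * y) * indicator (J j) (2 * pi * of_int j + 1 * y) \<partial>lborel)"
      by (subst nn_integral_real_affine[of _ 1 "2 * pi * of_int j"]) (simp_all add: J_def)
    also have "\<dots> = ?I"
    proof (intro nn_integral_cong)
      fix y
      have "g (2 * pi * of_int j + 1 * y) = g y" using per[of y j] by (simp add: add.commute)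
      then show "g (2 * pi * of_int j + 1 * y) * indicator (J j) (2 * pi * of_int j + 1 * y) = g y * indicator {-pi..<pi} y"
        by (simp add: J_def indicator_def)
    qed
    finally show ?thesis .
  qed
  have cover: "x \<in> J \<lfloor>(x + pi) / (2 * pi)\<rfloor>" for x
  proof -
    have "of_int \<lfloor>(x + pi) / (2 * pi)\<rfloor> \<le> (x + pi) / (2 * pi)" "(x + pi) / (2 * pi) < of_int \<lfloor>(x + pi) / (2 * pi)\<rfloor> + 1"
      by linarith+
    then have "of_int \<lfloor>(x + pi) / (2 * pi)\<rfloor> * (2 * pi) \<le> x + pi" "x + pi < (of_int \<lfloor>(x + pi) / (2 * pi)\<rfloor> + 1) * (2 * pi)"
      by (simp_all only: pos_le_divide_eq pos_divide_less_eq pi_gt_zero mult_pos_pos zero_less_numeral)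
    then show ?thesis by (simp add: J_def algebra_simps)
  qed
  have "(\<integral>\<^sup>+t. g (real m * (t - s)) * indicator {-pi..pi} t \<partial>lborel)
    = ennreal (1 / real m) * (\<integral>\<^sup>+x. g (real m * (s + 1 / real m * x - s)) * indicator {-pi..pi} (s + 1 / real m * x) \<partial>lborel)"
    using m by (subst nn_integral_real_affine[of _ "1 / real m" s]) simp_all
  also have "(\<integral>\<^sup>+x. g (real m * (s + 1 / real m * x - s)) * indicator {-pi..pi} (s + 1 / real m * x) \<partial>lborel)
    \<le> (\<integral>\<^sup>+x. (\<Sum>j\<in>{j0..j0 + int m}. g x * indicator (J j) x) \<partial>lborel)"
  proof (rule nn_integral_mono)
    fix x :: real
    show "g (real m * (s + 1 / real m * x - s)) * indicator {-pi..pi} (s + 1 / real m * x)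
       \<le> (\<Sum>j\<in>{j0..j0 + int m}. g x * indicator (J j) x)"
    proof (cases "s + 1 / real m * x \<in> {-pi..pi}")
      case True
      then have x: "real m * (- pi - s) \<le> x" "x \<le> real m * (- pi - s) + real m * (2 * pi)"
        using m by (simp_all add: field_simps)
      let ?j = "\<lfloor>(x + pi) / (2 * pi)\<rfloor>"
      have "j0 \<le> ?j" unfolding j0_def using x(1) by (intro floor_mono divide_right_mono) simp_all
      have "(x + pi) / (2 * pi) \<le> (real m * (- pi - s) + pi + real m * (2 * pi)) / (2 * pi)"
        using x(2) by (intro divide_right_mono) simp_all
      also have "\<dots> = (real m * (- pi - s) + pi) / (2 * pi) + real m"
        by (subst add_divide_distrib) simp
      finally have "?j \<le> \<lfloor>(real m * (- pi - s) + pi) / (2 * pi) + real m\<rfloor>"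
        by (rule floor_mono)
      then have "?j \<le> j0 + int m" unfolding j0_def by simp
      with \<open>j0 \<le> ?j\<close> have "g x * indicator (J ?j) x \<le> (\<Sum>j\<in>{j0..j0 + int m}. g x * indicator (J j) x)"
        by (intro member_le_sum) simp_all
      then show ?thesis using True m cover[of x] by simp
    qed simp
  qed
  also have "\<dots> = (\<Sum>j\<in>{j0..j0 + int m}. ?I)"
    by (subst nn_integral_sum) (simp_all add: I)
  also have "\<dots> = ennreal (real m + 1) * ?I"
    by (simp add: ennreal_of_nat_eq_real_of_nat)
  also have "ennreal (1 / real m) * (ennreal (real m + 1) * ?I) = ennreal ((real m + 1) / real m) * ?I"
  proof -
    have "ennreal (1 / real m) * ennreal (real m + 1) = ennreal ((real m + 1) / real m)"
      using m by (subst ennreal_mult[symmetric]) simp_all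
    then show ?thesis by (simp only: mult.assoc[symmetric])
  qed
  also have "\<dots> \<le> ennreal 2 * ?I"
    using m by (intro mult_right_mono ennreal_leI) (simp_all add: field_simps)
  finally show ?thesis by (simp add: mult_left_mono)
qed

lemma circle_negative_moment:
  assumes m: "m > (0::nat)"
  shows "(\<integral>\<^sup>+t. ennreal ((1 - cos (real m * (t - s))) powr (-2/5)) \<partial>unif_circle) \<le> ennreal 480"
proof -
  have "(\<integral>\<^sup>+t. ennreal ((1 - cos (real m * (t - s))) powr (-2/5)) \<partial>unif_circle)
     = ennreal (1 / (2 * pi)) * (\<integral>\<^sup>+t. ennreal ((1 - cos (real m * (t - s))) powr (-2/5)) * indicator {-pi..pi} t \<partial>lborel)"
    by (rule nn_integral_unif_circle) measurable
  also have "\<dots> \<le> ennreal (1 / 2) * (2 * ennreal 480)"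
  proof (intro mult_mono)
    have "(\<integral>\<^sup>+t. ennreal ((1 - cos (real m * (t - s))) powr (-2/5)) * indicator {-pi..pi} t \<partial>lborel)
      \<le> 2 * (\<integral>\<^sup>+y. ennreal ((1 - cos y) powr (-2/5)) * indicator {-pi..<pi} y \<partial>lborel)"
    proof (rule nn_integral_periodic_dilate[of "\<lambda>y. ennreal ((1 - cos y) powr (-2/5))", OF _ _ m])
      show "ennreal ((1 - cos (x + 2 * pi * of_int j)) powr (-2/5)) = ennreal ((1 - cos x) powr (-2/5))" for x j
        by (simp only: cos_add cos_int_2pin sin_int_2pin) simp
    qed measurable
    also have "\<dots> \<le> 2 * ennreal 480" by (intro mult_left_mono nn_integral_one_minus_cos) simp
    finally show "(\<integral>\<^sup>+t. ennreal ((1 - cos (real m * (t - s))) powr (-2/5)) * indicator {-pi..pi} t \<partial>lborel) \<le> 2 * ennreal 480" .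
    show "ennreal (1 / (2 * pi)) \<le> ennreal (1 / 2)"
      using pi_gt3 by (intro ennreal_leI) (simp add: field_simps)
  qed simp_all
  also have "\<dots> = ennreal (1/2 * (2 * 480))"
    by (subst ennreal_mult) (simp_all add: ennreal_mult)
  finally show ?thesis by simp
qed

text \<open>
  A number of steps after which the frequencies have more than doubled; it depends on \<open>q\<close> only.
\<close>

definition lacunary_gap :: "real \<Rightarrow> nat" where
  "lacunary_gap q = (SOME L. 2 < q ^ L)"

locale lacunary =
  fixes q :: real and N :: nat and m :: "nat \<Rightarrow> nat"
  assumes q: "q > 1" and N: "N \<ge> 1" and pos: "\<And>k. k \<in> {1..N} \<Longrightarrow> m k > 0"
    and ratio: "\<And>k. 1 \<le> k \<Longrightarrow> k < N \<Longrightarrow> real (m (k + 1)) \<ge> q * real (m k)"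
begin

abbreviation L where "L \<equiv> lacunary_gap q"

lemma gap: "2 < q ^ L"
  unfolding lacunary_gap_def using real_arch_pow[OF q, of 2] by (rule someI_ex)

lemma gap_pos: "L \<ge> 1"
  using gap by (cases L) simp_all

lemma growth:
  assumes "1 \<le> j" "j \<le> k" "k \<le> N" shows "q ^ (k - j) * real (m j) \<le> real (m k)"
  using assms(2,3)
proof (induction k rule: dec_induct)
  case (step k)
  then have "q ^ (Suc k - j) * real (m j) = q * (q ^ (k - j) * real (m j))"
    by (simp add: Suc_diff_le)
  also have "\<dots> \<le> q * real (m k)" using step q by (intro mult_left_mono) simp_all
  also have "\<dots> \<le> real (m (Suc k))" using ratio[of k] step assms(1) by (simp add: Suc_eq_plus1)
  finally show ?case .
qed simp

lemma strictly_increasing: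
  assumes "1 \<le> j" "j < k" "k \<le> N" shows "m j < m k"
proof -
  have "1 < q ^ (k - j)" using q assms by (intro one_less_power) simp_all
  then have "1 * real (m j) < q ^ (k - j) * real (m j)"
    using pos[of j] assms by (intro mult_strict_right_mono) simp_all
  then show ?thesis using growth[of j k] assms by simp
qed

lemma frequency_inj: "inj_on m {1..N}"
  by (rule inj_onI) (metis atLeastAtMost_iff linorder_neqE_nat order_less_irrefl strictly_increasing)

lemma doubling:
  assumes "1 \<le> j" "j + L \<le> k" "k \<le> N" shows "2 * m j < m k"
proof -
  have "q ^ L \<le> q ^ (k - j)" using q assms by (intro power_increasing) simp_all
  then have "2 * real (m j) < q ^ (k - j) * real (m j)"
    using gap pos[of j] assms by (intro mult_strict_right_mono) simp_all
  then show ?thesis using growth[of j k] assms by simp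
qed

definition cos_sum :: "real \<Rightarrow> real \<Rightarrow> real" where
  "cos_sum s t = (\<Sum>k=1..N. cos (real (m k) * (t - s)))"

lemma cos_sum_continuous: "continuous_on UNIV (cos_sum s)"
  unfolding cos_sum_def by (intro continuous_intros)

lemma cos_sum_mean: "(\<integral>t. cos_sum s t \<partial>unif_circle) = 0"
proof -
  have "integrable unif_circle (\<lambda>t. cos (real M * (t - s)))" for M :: nat
    by (intro integrable_circle continuous_intros)
  then show ?thesis
    unfolding cos_sum_def using pos by (simp add: circle_mean_cos_nat)
qed

text \<open>
  Distinct frequencies are orthogonal.
\<close>

lemma cos_sum_variance: "(\<integral>t. (cos_sum s t)\<^sup>2 \<partial>unif_circle) = real N / 2"
proof -
  have i: "integrable unif_circle (\<lambda>t. cos (real a * (t - s)) * cos (real b * (t - s)))" for a b :: nat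
    by (intro integrable_circle continuous_intros)
  have "(\<integral>t. (cos_sum s t)\<^sup>2 \<partial>unif_circle)
    = (\<integral>t. (\<Sum>j=1..N. \<Sum>k=1..N. cos (real (m j) * (t - s)) * cos (real (m k) * (t - s))) \<partial>unif_circle)"
    unfolding cos_sum_def power2_eq_square sum_product ..
  also have "\<dots> = (\<Sum>j=1..N. \<Sum>k=1..N. \<integral>t. cos (real (m j) * (t - s)) * cos (real (m k) * (t - s)) \<partial>unif_circle)"
    using i by (simp add: Bochner_Integration.integral_sum)
  also have "\<dots> = (\<Sum>j=1..N. \<Sum>k=1..N. if k = j then 1 / 2 else 0)"
    using pos frequency_inj by (intro sum.cong refl) (auto simp: circle_mean_cos_cos inj_on_eq_iff)
  also have "\<dots> = real N / 2" by (simp add: sum.delta)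
  finally show ?thesis .
qed

text \<open>
  In a solution of \<open>m j + m k = m l\<close> one summand, say \<open>m j\<close>, is at least half of \<open>m l\<close>. Then \<open>l\<close> is within
  \<open>L\<close> of \<open>j\<close>, since the frequencies more than double over \<open>L\<close> steps, and \<open>j\<close> and \<open>l\<close> determine \<open>k\<close>.
\<close>

lemma additive_relations_le:
  "(\<Sum>j=1..N. \<Sum>k=1..N. \<Sum>l=1..N. of_bool (m j + m k = m l)) \<le> 2 * real N * real L"
proof -
  let ?D = "\<Sum>j=1..N. \<Sum>k=1..N. \<Sum>l=1..N. of_bool (m j + m k = m l \<and> m l \<le> 2 * m j) :: real"
  have one: "(\<Sum>k=1..N. of_bool (m j + m k = m l \<and> m l \<le> 2 * m j) :: real) \<le> of_bool (l \<in> {j<..<j + L})"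
    if jl: "j \<in> {1..N}" "l \<in> {1..N}" for j l
  proof (cases "\<exists>k\<in>{1..N}. m j + m k = m l \<and> m l \<le> 2 * m j")
    case True
    then obtain k where k: "k \<in> {1..N}" "m j + m k = m l" "m l \<le> 2 * m j" by blast
    have "m j < m l" using k pos[of k] by simp
    then have "j < l" using strictly_increasing[of l j] jl
      by (metis atLeastAtMost_iff linorder_neqE_nat order_less_asym)
    moreover have "l < j + L" using doubling[of j l] k jl by (auto simp: not_less intro: ccontr)
    moreover have "(\<Sum>k'=1..N. of_bool (m j + m k' = m l \<and> m l \<le> 2 * m j) :: real) = (\<Sum>k'=1..N. if k' = k then 1 else 0)"
    proof (intro sum.cong refl)
      fix k' assume "k' \<in> {1..N}"
      then have "m j + m k' = m l \<longleftrightarrow> k' = k"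
        using k frequency_inj by (metis add_left_cancel inj_onD)
      then show "(of_bool (m j + m k' = m l \<and> m l \<le> 2 * m j) :: real) = (if k' = k then 1 else 0)"
        using k(3) by simp
    qed
    ultimately show ?thesis using k(1) by simp
  next
    case False
    then have "(\<Sum>k=1..N. of_bool (m j + m k = m l \<and> m l \<le> 2 * m j) :: real) = 0"
      by (intro sum.neutral) auto
    then show ?thesis by simp
  qed
  have "?D \<le> (\<Sum>j=1..N. real L)"
  proof (rule sum_mono)
    fix j assume j: "j \<in> {1..N}"
    have "(\<Sum>k=1..N. \<Sum>l=1..N. of_bool (m j + m k = m l \<and> m l \<le> 2 * m j) :: real)
      = (\<Sum>l=1..N. \<Sum>k=1..N. of_bool (m j + m k = m l \<and> m l \<le> 2 * m j))"
      by (rule sum.swap)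
    also have "\<dots> \<le> (\<Sum>l=1..N. of_bool (l \<in> {j<..<j + L}))"
      by (intro sum_mono one j)
    also have "\<dots> = real (card ({1..N} \<inter> {j<..<j + L}))"
      by (simp add: of_bool_def sum.If_cases Int_def)
    also have "\<dots> \<le> real (card {j<..<j + L})" by (intro of_nat_mono card_mono) auto
    also have "\<dots> \<le> real L" by simp
    finally show "(\<Sum>k=1..N. \<Sum>l=1..N. of_bool (m j + m k = m l \<and> m l \<le> 2 * m j) :: real) \<le> real L" .
  qed
  then have D: "?D \<le> real N * real L" by simp
  have "(\<Sum>j=1..N. \<Sum>k=1..N. \<Sum>l=1..N. of_bool (m j + m k = m l) :: real)
    \<le> (\<Sum>j=1..N. \<Sum>k=1..N. \<Sum>l=1..N. of_bool (m j + m k = m l \<and> m l \<le> 2 * m j) + of_bool (m k + m j = m l \<and> m l \<le> 2 * m k))"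
    by (intro sum_mono) auto
  also have "\<dots> = ?D + (\<Sum>j=1..N. \<Sum>k=1..N. \<Sum>l=1..N. of_bool (m k + m j = m l \<and> m l \<le> 2 * m k))"
    by (simp only: sum.distrib)
  also have "(\<Sum>j=1..N. \<Sum>k=1..N. \<Sum>l=1..N. of_bool (m k + m j = m l \<and> m l \<le> 2 * m k) :: real) = ?D"
    by (rule sum.swap)
  finally show ?thesis using D by simp
qed

text \<open>
  The mean of a product of three cosines is 1/4 for each additive relation among the frequencies, in the three
  possible positions.
\<close>

lemma cos_sum_third_moment: "(\<integral>t. cos_sum s t ^ 3 \<partial>unif_circle) \<le> 3/2 * real N * real L"
proof -
  let ?c = "\<lambda>a t. cos (real (m a) * (t - s))"
  let ?C = "\<Sum>j=1..N. \<Sum>k=1..N. \<Sum>l=1..N. of_bool (m j + m k = m l) :: real"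
  have i: "integrable unif_circle (\<lambda>t. cos (real a * (t - s)) * cos (real b * (t - s)) * cos (real c * (t - s)))" for a b c :: nat
    by (intro integrable_circle continuous_intros)
  have "cos_sum s t ^ 3 = (\<Sum>j=1..N. \<Sum>k=1..N. \<Sum>l=1..N. ?c j t * ?c k t * ?c l t)" for t
    unfolding cos_sum_def power3_eq_cube by (simp add: sum_product sum_distrib_left sum_distrib_right mult_ac)
  then have "(\<integral>t. cos_sum s t ^ 3 \<partial>unif_circle)
    = (\<integral>t. (\<Sum>j=1..N. \<Sum>k=1..N. \<Sum>l=1..N. ?c j t * ?c k t * ?c l t) \<partial>unif_circle)"
    by simp
  also have "\<dots> = (\<Sum>j=1..N. \<Sum>k=1..N. \<Sum>l=1..N. \<integral>t. ?c j t * ?c k t * ?c l t \<partial>unif_circle)"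
    using i by (simp add: Bochner_Integration.integral_sum)
  also have "\<dots> = (\<Sum>j=1..N. \<Sum>k=1..N. \<Sum>l=1..N. (of_bool (m j + m k = m l) + of_bool (m j + m l = m k) + of_bool (m k + m l = m j)) / 4)"
    using pos by (intro sum.cong refl circle_mean_cos_cos_cos) auto
  also have "\<dots> = (?C + (\<Sum>j=1..N. \<Sum>k=1..N. \<Sum>l=1..N. of_bool (m j + m l = m k))
     + (\<Sum>j=1..N. \<Sum>k=1..N. \<Sum>l=1..N. of_bool (m k + m l = m j))) / 4"
    by (simp only: sum_divide_distrib[symmetric] sum.distrib)
  also have "(\<Sum>j=1..N. \<Sum>k=1..N. \<Sum>l=1..N. of_bool (m j + m l = m k) :: real) = ?C"
    by (intro sum.cong refl sum.swap)
  also have "(\<Sum>j=1..N. \<Sum>k=1..N. \<Sum>l=1..N. of_bool (m k + m l = m j) :: real) = ?C"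
  proof -
    have "(\<Sum>j=1..N. \<Sum>k=1..N. \<Sum>l=1..N. of_bool (m k + m l = m j) :: real)
      = (\<Sum>k=1..N. \<Sum>j=1..N. \<Sum>l=1..N. of_bool (m k + m l = m j))" by (rule sum.swap)
    also have "\<dots> = ?C" by (intro sum.cong refl sum.swap)
    finally show ?thesis .
  qed
  finally show ?thesis using additive_relations_le by simp
qed

text \<open>
  Split the indices into residue classes modulo \<open>L\<close>. Within a class the frequencies at least double, so the class sums are
  controlled by Riesz products.
\<close>

lemma cos_sum_tenth_moment:
  "(\<integral>t. cos_sum s t ^ 10 \<partial>unif_circle) \<le> real L ^ 11 * (2 * fact 10 * exp 1) * real N ^ 5"
proof -
  define A where "A r = {k \<in> {1..N}. k mod L = r}" for r
  let ?S = "\<lambda>r t. \<Sum>k\<in>A r. cos (real (m k) * (t - s))"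
  have "L > 0" using gap_pos by simp
  then have split: "cos_sum s t = (\<Sum>r<L. ?S r t)" for t
    unfolding cos_sum_def A_def by (intro sum.group[symmetric]) auto
  have sep: "m k \<ge> 2 * m j" if "j \<in> A r" "k \<in> A r" "j < k" for j k r
  proof -
    have "L dvd k - j" using that by (auto simp: A_def intro: mod_eq_dvd_iff_nat[THEN iffD1])
    then have "L \<le> k - j" using that(3) by (intro dvd_imp_le) simp_all
    then have "2 * m j < m k" using that by (intro doubling) (auto simp: A_def)
    then show ?thesis by simp
  qed
  have per_class: "(\<integral>t. ?S r t ^ 10 \<partial>unif_circle) \<le> 2 * fact 10 * exp 1 * real N ^ 5" for r
  proof (rule dissociate_tenth_moment)
    have "card (A r) \<le> card {1..N}" by (intro card_mono) (auto simp: A_def)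
    then show "card (A r) \<le> N" by simp
  qed (use sep pos N in \<open>auto simp: A_def\<close>)
  have int: "integrable unif_circle (\<lambda>t. ?S r t ^ 10)" for r
    by (intro integrable_circle continuous_intros)
  have "(\<integral>t. cos_sum s t ^ 10 \<partial>unif_circle) \<le> (\<integral>t. real L ^ 10 * (\<Sum>r<L. ?S r t ^ 10) \<partial>unif_circle)"
  proof (rule integral_mono)
    show "integrable unif_circle (\<lambda>t. cos_sum s t ^ 10)"
      by (intro integrable_circle continuous_intros continuous_on_power cos_sum_continuous)
    show "integrable unif_circle (\<lambda>t. real L ^ 10 * (\<Sum>r<L. ?S r t ^ 10))"
      by (intro integrable_circle continuous_intros)
    show "cos_sum s t ^ 10 \<le> real L ^ 10 * (\<Sum>r<L. ?S r t ^ 10)" for t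
      unfolding split by (rule abs_sum_power10_le)
  qed
  also have "\<dots> = real L ^ 10 * (\<Sum>r<L. \<integral>t. ?S r t ^ 10 \<partial>unif_circle)"
    using int by (simp add: Bochner_Integration.integral_sum)
  also have "\<dots> \<le> real L ^ 10 * (\<Sum>r<L. 2 * fact 10 * exp 1 * real N ^ 5)"
    by (intro mult_left_mono sum_mono per_class) simp
  also have "\<dots> = real L ^ 11 * (2 * fact 10 * exp 1) * real N ^ 5"
    by (simp add: numeral_eq_Suc)
  finally show ?thesis .
qed

definition moment_const :: real where "moment_const = 32 * real L ^ 11 * (2 * fact 10 * exp 1)"

text \<open>
  As \<open>1 - \<xi>\<close> is an average of the nonnegative terms \<open>1 - cos (m\<^sub>k (t - s))\<close>, it is at least \<open>1 / N\<close> times the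
  first of them. This crude bound suffices for the negative moment.
\<close>

lemma lacunary_perturbation:
  fixes s :: real
  defines "\<xi> \<equiv> \<lambda>t. cos_sum s t / real N"
  shows "concentrated_perturbation unif_circle \<xi> (2 * N) moment_const"
    and "(\<integral>t. (\<xi> t)\<^sup>2 \<partial>unif_circle) = 1 / real (2 * N)"
    and "(\<integral>t. \<xi> t ^ 3 \<partial>unif_circle) \<le> 6 * real L / (real (2 * N))\<^sup>2"
    and "AE t in unif_circle. \<xi> t < 1"
    and "(\<integral>\<^sup>+t. ennreal ((1 - \<xi> t) powr (-2/5)) \<partial>unif_circle) \<le> ennreal (480 * real (2 * N))"
proof -
  have N0: "real N > 0" using N by simp
  have cont: "continuous_on UNIV \<xi>"
    unfolding \<xi>_def using N0 by (intro continuous_intros cos_sum_continuous) simp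
  then have meas: "\<xi> \<in> borel_measurable unif_circle"
    by (intro measurable_unif_circle borel_measurable_continuous_onI)
  have int: "integrable unif_circle (\<lambda>t. \<xi> t ^ k)" for k
    by (intro integrable_circle continuous_intros cont)
  have x2: "(\<xi> t)\<^sup>2 = (cos_sum s t)\<^sup>2 / (real N)\<^sup>2" and x3: "\<xi> t ^ 3 = cos_sum s t ^ 3 / real N ^ 3"
    and x10: "\<xi> t ^ 10 = cos_sum s t ^ 10 / real N ^ 10" for t
    by (simp_all add: \<xi>_def power_divide)
  have m10: "(\<integral>t. \<xi> t ^ 10 \<partial>unif_circle) \<le> moment_const / real (2 * N) ^ 5"
  proof -
    have "(\<integral>t. \<xi> t ^ 10 \<partial>unif_circle) = (\<integral>t. cos_sum s t ^ 10 \<partial>unif_circle) / real N ^ 10"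
      unfolding x10 by simp
    also have "\<dots> \<le> real L ^ 11 * (2 * fact 10 * exp 1) * real N ^ 5 / real N ^ 10"
      by (intro divide_right_mono cos_sum_tenth_moment) simp
    also have "\<dots> = moment_const / real (2 * N) ^ 5"
      using N0 by (simp add: moment_const_def power_mult_distrib field_simps flip: power_add)
    finally show ?thesis .
  qed
  have mean: "(\<integral>t. \<xi> t \<partial>unif_circle) = 0"
    unfolding \<xi>_def using cos_sum_mean[of s] by simp
  show "concentrated_perturbation unif_circle \<xi> (2 * N) moment_const"
    unfolding concentrated_perturbation_def concentrated_perturbation_axioms_def small_perturbation_def small_perturbation_axioms_def
    using prob_space_unif_circle meas int mean m10 N by simp
  show "(\<integral>t. (\<xi> t)\<^sup>2 \<partial>unif_circle) = 1 / real (2 * N)"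
    unfolding x2 using cos_sum_variance[of s] N0 by (simp add: field_simps power2_eq_square)
  have "(\<integral>t. \<xi> t ^ 3 \<partial>unif_circle) = (\<integral>t. cos_sum s t ^ 3 \<partial>unif_circle) / real N ^ 3"
    unfolding x3 by simp
  also have "\<dots> \<le> 3/2 * real N * real L / real N ^ 3"
    by (intro divide_right_mono cos_sum_third_moment) simp
  also have "\<dots> = 6 * real L / (real (2 * N))\<^sup>2"
    using N0 by (simp add: field_simps power2_eq_square power3_eq_cube)
  finally show "(\<integral>t. \<xi> t ^ 3 \<partial>unif_circle) \<le> 6 * real L / (real (2 * N))\<^sup>2" .
  let ?w = "\<lambda>t. 1 - cos (real (m 1) * (t - s))"
  have m1: "m 1 > 0" using pos[of 1] N by simp
  have le: "?w t / real N \<le> 1 - \<xi> t" for t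
  proof -
    have "?w t \<le> (\<Sum>k=1..N. 1 - cos (real (m k) * (t - s)))"
      using N by (intro member_le_sum[of 1 "{1..N}" "\<lambda>k. 1 - cos (real (m k) * (t - s))"]) simp_all
    also have "\<dots> = real N - cos_sum s t" by (simp add: cos_sum_def sum_subtractf)
    finally have "?w t / real N \<le> (real N - cos_sum s t) / real N" by (rule divide_right_mono) simp
    also have "\<dots> = 1 - \<xi> t" using N0 by (simp add: \<xi>_def diff_divide_distrib)
    finally show ?thesis .
  qed
  have w: "AE t in unif_circle. ?w t > 0"
  proof -
    have "{t. ?w t = 0} \<subseteq> range (\<lambda>j::int. s + 2 * pi * of_int j / real (m 1))"
    proof
      fix t assume "t \<in> {t. ?w t = 0}"
      then have "cos (real (m 1) * (t - s)) = 1" by simp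
      then obtain j :: int where "real (m 1) * (t - s) = of_int j * 2 * pi" by (auto simp: cos_one_2pi_int)
      then have "t = s + 2 * pi * of_int j / real (m 1)" using m1 by (simp add: field_simps)
      then show "t \<in> range (\<lambda>j::int. s + 2 * pi * of_int j / real (m 1))" by blast
    qed
    then have c: "countable {t. ?w t = 0}" by (rule countable_subset) simp
    then have "AE t in lborel. t \<notin> {t. ?w t = 0}"
      by (intro AE_not_in countable_imp_null_set_lborel)
    then have "AE t in lborel. ?w t > 0" by eventually_elim (auto simp: less_le)
    then have "AE t in restrict_space lborel {-pi<..<pi}. ?w t > 0"
      by (subst AE_restrict_space_iff) (auto elim: eventually_mono)
    then show ?thesis unfolding unif_circle_def by (subst AE_density) (auto elim: eventually_mono intro: measurable_restrict_space1)
  qed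
  then show "AE t in unif_circle. \<xi> t < 1"
  proof eventually_elim
    case (elim t)
    then have "0 < ?w t / real N" using N0 by simp
    then show ?case using le[of t] by linarith
  qed
  have "(\<integral>\<^sup>+t. ennreal ((1 - \<xi> t) powr (-2/5)) \<partial>unif_circle) \<le> (\<integral>\<^sup>+t. ennreal (real N) * ennreal (?w t powr (-2/5)) \<partial>unif_circle)"
  proof (rule nn_integral_mono_AE)
    show "AE t in unif_circle. ennreal ((1 - \<xi> t) powr (-2/5)) \<le> ennreal (real N) * ennreal (?w t powr (-2/5))"
      using w
    proof eventually_elim
      case (elim t)
      have "(1 - \<xi> t) powr (-2/5) \<le> (?w t / real N) powr (-2/5)"
        using elim N0 by (intro powr_mono2' le) simp_all
      also have "\<dots> = ?w t powr (-2/5) * real N powr (2/5)"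
        using elim by (simp add: powr_divide powr_minus_divide)
      also have "\<dots> \<le> ?w t powr (-2/5) * real N powr 1"
        using N by (intro mult_left_mono powr_mono) simp_all
      finally show ?case
        by (subst ennreal_mult[symmetric]) (simp_all add: ennreal_leI mult.commute)
    qed
  qed
  also have "\<dots> = ennreal (real N) * (\<integral>\<^sup>+t. ennreal (?w t powr (-2/5)) \<partial>unif_circle)"
    by (intro nn_integral_cmult measurable_unif_circle) measurable
  also have "\<dots> \<le> ennreal (real N) * ennreal 480"
    by (intro mult_left_mono circle_negative_moment m1) simp
  also have "\<dots> = ennreal (real N * 480)" by (rule ennreal_mult[symmetric]) simp_all
  also have "\<dots> \<le> ennreal (480 * real (2 * N))" by (intro ennreal_leI) simp
  finally show "(\<integral>\<^sup>+t. ennreal ((1 - \<xi> t) powr (-2/5)) \<partial>unif_circle) \<le> ennreal (480 * real (2 * N))" .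
qed

end

section \<open>Averaging energies over the sphere\<close>

lemma component_measurable_sphere:
  assumes "i \<in> {1..n}" shows "(\<lambda>\<theta>. \<theta> i) \<in> borel_measurable (sphere_measure n)"
  by (subst measurable_cong_sets[OF sets_sphere_measure refl])
    (intro measurable_restrict_space1 measurable_component_singleton assms)

lemma component_measurable_gauss_borel:
  assumes "i \<in> {1..n}" shows "(\<lambda>x. x i) \<in> borel_measurable (gauss n)"
  by (subst measurable_cong_sets[OF sets_gauss refl]) (intro measurable_component_singleton assms)

lemma euclid_inner_diff: "euclid_inner n (\<lambda>i. x i - y i) \<theta> = euclid_inner n x \<theta> - euclid_inner n y \<theta>"
  by (simp add: euclid_inner_def sum_subtractf left_diff_distrib)

lemma euclid_inner_commute: "euclid_inner n x y = euclid_inner n y x"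
  by (simp add: euclid_inner_def mult.commute)

text \<open>
  The common factor of all averaged energies with a kernel of degree \<open>e\<close>. It is kept as a factor instead of being divided out,
  because division in the extended nonnegative reals would need it to be finite and nonzero.
\<close>

definition radial_moment :: "nat \<Rightarrow> real \<Rightarrow> ennreal" where
  "radial_moment n e = (\<integral>\<^sup>+x. ennreal (euclid_norm n x powr e) \<partial>gauss n)"

text \<open>
  Average over the direction first, using \<open>nn_integral_sphere_homogeneous\<close> for the vector \<open>b y - a x\<close>. That vector has to be
  nonzero almost surely since the kernel may be infinite at zero.
\<close>

lemma sphere_average_energy:
  fixes a :: "'a \<Rightarrow> nat \<Rightarrow> real" and b :: "'b \<Rightarrow> nat \<Rightarrow> real" and k :: "real \<Rightarrow> ennreal"
  assumes n: "n \<ge> 1" and P: "prob_space A" "prob_space B"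
    and a: "\<And>i. i \<in> {1..n} \<Longrightarrow> (\<lambda>x. a x i) \<in> borel_measurable A"
    and b: "\<And>i. i \<in> {1..n} \<Longrightarrow> (\<lambda>y. b y i) \<in> borel_measurable B"
    and k: "k \<in> borel_measurable borel"
    and hom: "\<And>c r. c > 0 \<Longrightarrow> k (c * r) = ennreal (c powr e) * k r"
    and ne: "\<And>x. x \<in> space A \<Longrightarrow> AE y in B. euclid_norm n (\<lambda>i. b y i - a x i) > 0"
  shows "radial_moment n e * (\<integral>\<^sup>+\<theta>. \<integral>\<^sup>+x. \<integral>\<^sup>+y. k (euclid_inner n (b y) \<theta> - euclid_inner n (a x) \<theta>) \<partial>B \<partial>A \<partial>sphere_measure n)
    = (\<integral>\<^sup>+z. k z \<partial>std_normal_distribution) * (\<integral>\<^sup>+x. \<integral>\<^sup>+y. ennreal (euclid_norm n (\<lambda>i. b y i - a x i) powr e) \<partial>B \<partial>A)"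
    (is "?H * ?E = ?C * ?R")
proof -
  interpret A: prob_space A by fact
  interpret B: prob_space B by fact
  interpret S: prob_space "sphere_measure n" by (rule prob_space_sphere_measure[OF n])
  note [measurable] = a b k component_measurable_sphere[of _ n]
  let ?\<sigma> = "sphere_measure n"
  let ?k = "\<lambda>\<theta> x y. k (euclid_inner n (b y) \<theta> - euclid_inner n (a x) \<theta>)"
  have "?E = (\<integral>\<^sup>+x. \<integral>\<^sup>+\<theta>. \<integral>\<^sup>+y. ?k \<theta> x y \<partial>B \<partial>?\<sigma> \<partial>A)"
    by (intro nn_integral_swap A.sigma_finite_measure_axioms S.sigma_finite_measure_axioms) measurable
  also have "\<dots> = (\<integral>\<^sup>+x. \<integral>\<^sup>+y. \<integral>\<^sup>+\<theta>. ?k \<theta> x y \<partial>?\<sigma> \<partial>B \<partial>A)"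
    by (intro nn_integral_cong nn_integral_swap B.sigma_finite_measure_axioms S.sigma_finite_measure_axioms) measurable
  finally have "?H * ?E = ?H * (\<integral>\<^sup>+x. \<integral>\<^sup>+y. \<integral>\<^sup>+\<theta>. ?k \<theta> x y \<partial>?\<sigma> \<partial>B \<partial>A)" by simp
  also have "\<dots> = (\<integral>\<^sup>+x. \<integral>\<^sup>+y. ?H * (\<integral>\<^sup>+\<theta>. ?k \<theta> x y \<partial>?\<sigma>) \<partial>B \<partial>A)"
    by (subst nn_integral_cmult[symmetric], measurable, intro nn_integral_cong, subst nn_integral_cmult[symmetric], measurable)
  also have "\<dots> = (\<integral>\<^sup>+x. \<integral>\<^sup>+y. ?C * ennreal (euclid_norm n (\<lambda>i. b y i - a x i) powr e) \<partial>B \<partial>A)"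
  proof (rule nn_integral_cong, rule nn_integral_cong_AE)
    fix x assume "x \<in> space A"
    from ne[OF this]
    show "AE y in B. ?H * (\<integral>\<^sup>+\<theta>. ?k \<theta> x y \<partial>?\<sigma>) = ?C * ennreal (euclid_norm n (\<lambda>i. b y i - a x i) powr e)"
    proof eventually_elim
      case (elim y)
      show ?case
        using nn_integral_sphere_homogeneous[OF n elim k hom]
        by (simp add: radial_moment_def euclid_inner_diff mult.commute)
    qed
  qed
  also have "\<dots> = ?C * ?R"
    by (subst nn_integral_cmult[symmetric], measurable, intro nn_integral_cong, subst nn_integral_cmult[symmetric], measurable)
  finally show ?thesis .
qed

text \<open>
  The difference of two independent standard normal variables is \<open>sqrt 2\<close> times a standard normal variable, here obtained as a linear
  form in a two-dimensional Gaussian vector.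
\<close>

lemma std_normal_self_energy:
  fixes k :: "real \<Rightarrow> ennreal"
  assumes k [measurable]: "k \<in> borel_measurable borel"
    and hom: "\<And>c r. c > 0 \<Longrightarrow> k (c * r) = ennreal (c powr e) * k r"
  shows "mutual_energy k std_normal_distribution std_normal_distribution
    = ennreal (sqrt 2 powr e) * (\<integral>\<^sup>+z. k z \<partial>std_normal_distribution)"
proof -
  interpret N: prob_space std_normal_distribution by (rule prob_space_normal_density) simp
  interpret product_sigma_finite "\<lambda>_::nat. std_normal_distribution"
    by (intro product_sigma_finite.intro N.sigma_finite_measure_axioms)
  interpret pair_sigma_finite std_normal_distribution std_normal_distribution
    by (intro pair_sigma_finite.intro N.sigma_finite_measure_axioms)
  define v where "v i = (if i = 1 then - 1 else 1 :: real)" for i :: nat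
  have two: "{1..2::nat} = {1, 2}" by auto
  have inner: "euclid_inner 2 v x = x 2 - x 1" for x
    by (simp add: euclid_inner_def two v_def)
  have norm: "euclid_norm 2 v = sqrt 2"
    by (simp add: euclid_norm_def inner) (simp add: v_def)
  have "mutual_energy k std_normal_distribution std_normal_distribution
    = (\<integral>\<^sup>+z. k (snd z - fst z) \<partial>(std_normal_distribution \<Otimes>\<^sub>M std_normal_distribution))"
    unfolding mutual_energy_def by (subst N.nn_integral_fst[symmetric]) simp_all
  also have "\<dots> = (\<integral>\<^sup>+x. k (x 2 - x 1) \<partial>gauss 2)"
    unfolding gauss_def two by (subst product_nn_integral_pair[of "\<lambda>x y. k (y - x)"]) simp_all
  also have "\<dots> = (\<integral>\<^sup>+z. k (sqrt 2 * z) \<partial>std_normal_distribution)"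
    using nn_integral_gauss_inner[of 2 v k] by (simp add: norm inner)
  also have "\<dots> = ennreal (sqrt 2 powr e) * (\<integral>\<^sup>+z. k z \<partial>std_normal_distribution)"
    by (simp add: hom nn_integral_cmult)
  finally show ?thesis .
qed

lemma real_distribution_std_normal: "real_distribution std_normal_distribution"
  by (rule real_dist_normal_dist)

lemma add_le_imp_le_diff_ennreal:
  assumes "A + ennreal x \<le> ennreal y"
  shows "A \<le> ennreal (y - x)"
proof (cases "x \<ge> 0")
  case True
  show ?thesis
  proof (cases "y \<ge> 0")
    case y: True
    obtain r where r: "A = ennreal r" "r \<ge> 0"
      using assms by (cases A) (auto simp: top_unique)
    then have "r + x \<le> y"
      using assms True y by (simp add: ennreal_plus[symmetric] del: ennreal_plus)
    then show ?thesis using r by (simp add: ennreal_leI)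
  next
    case False
    then have "A + ennreal x = 0" using assms by (simp add: ennreal_neg)
    then show ?thesis by simp
  qed
next
  case False
  then have "A \<le> ennreal y" using assms by (simp add: ennreal_neg)
  also have "\<dots> \<le> ennreal (y - x)" using False by (intro ennreal_leI) simp
  finally show ?thesis .
qed

lemma ennreal_add_ge: "ennreal (x + y) \<le> ennreal x + ennreal y"
proof -
  have "ennreal (x + y) \<le> ennreal (max 0 x + max 0 y)" by (intro ennreal_leI) linarith
  also have "\<dots> = ennreal (max 0 x) + ennreal (max 0 y)" by (rule ennreal_plus) simp_all
  also have "\<dots> = ennreal x + ennreal y" by (simp add: max_def ennreal_neg)
  finally show ?thesis .
qed

lemma rho_dist_square_le:
  assumes "\<And>x. ennreal ((U x - V x)\<^sup>2) \<le> R"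
  shows "(rho_dist U V)\<^sup>2 \<le> R"
proof (cases R)
  case (real r)
  have "rho_dist U V \<le> ennreal (sqrt r)"
    unfolding rho_dist_def
  proof (rule SUP_least)
    fix x
    have "(U x - V x)\<^sup>2 \<le> r" using assms[of x] real by simp
    then have "sqrt ((U x - V x)\<^sup>2) \<le> sqrt r" by (rule real_sqrt_le_mono)
    then show "ennreal \<bar>U x - V x\<bar> \<le> ennreal (sqrt r)" by (simp add: ennreal_leI)
  qed
  then have "(rho_dist U V)\<^sup>2 \<le> (ennreal (sqrt r))\<^sup>2" by (rule power_mono) simp
  also have "\<dots> = R" using real by (simp add: ennreal_power)
  finally show ?thesis .
qed simp

text \<open>
  The difference of two distribution functions is right-continuous and bounded, so the Sobolev bound applies at
  every point.
\<close>

lemma rho_dist_square_le_energy: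
  assumes "real_distribution \<mu>" "real_distribution \<nu>"
  shows "(rho_dist (cdf \<mu>) (cdf \<nu>))\<^sup>2
    \<le> 2 * (\<integral>\<^sup>+z. ennreal ((cdf \<mu> z - cdf \<nu> z)\<^sup>2) \<partial>lborel)
      + ennreal geom_const * (\<integral>\<^sup>+s. riesz_weight s *
          (\<integral>\<^sup>+z. ennreal (((cdf \<mu> (z + s) - cdf \<nu> (z + s)) - (cdf \<mu> z - cdf \<nu> z))\<^sup>2) \<partial>lborel) \<partial>lborel)"
proof (rule rho_dist_square_le)
  fix x
  interpret M: real_distribution \<mu> by fact
  interpret N: real_distribution \<nu> by fact
  interpret bounded_borel_function "\<lambda>x. cdf \<mu> x - cdf \<nu> x" 1
  proof
    show "(\<lambda>x. cdf \<mu> x - cdf \<nu> x) \<in> borel_measurable borel"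
      using cdf_measurable[OF assms(1)] cdf_measurable[OF assms(2)] by measurable
    show "\<bar>cdf \<mu> x - cdf \<nu> x\<bar> \<le> 1" for x
      using M.cdf_nonneg[of x] N.cdf_nonneg[of x] M.cdf_bounded_prob[of x] N.cdf_bounded_prob[of x] by linarith
  qed
  have "continuous (at_right x) (\<lambda>x. cdf \<mu> x - cdf \<nu> x)"
    by (intro continuous_diff M.cdf_is_right_cont N.cdf_is_right_cont)
  from square_le_fractional_norm[OF this]
  show "ennreal ((cdf \<mu> x - cdf \<nu> x)\<^sup>2) \<le> 2 * (\<integral>\<^sup>+z. ennreal ((cdf \<mu> z - cdf \<nu> z)\<^sup>2) \<partial>lborel)
      + ennreal geom_const * (\<integral>\<^sup>+s. riesz_weight s *
          (\<integral>\<^sup>+z. ennreal (((cdf \<mu> (z + s) - cdf \<nu> (z + s)) - (cdf \<mu> z - cdf \<nu> z))\<^sup>2) \<partial>lborel) \<partial>lborel)"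
    unfolding incr_norm_def .
qed

section \<open>The lacunary trigonometric vector\<close>

lemma powr_of_square:
  fixes r A y e :: real
  assumes "r \<ge> 0" "r\<^sup>2 = A * y" "A \<ge> 0" "y \<ge> 0"
  shows "r powr e = A powr (e / 2) * y powr (e / 2)"
proof -
  have "r = (A * y) powr (1/2)"
    using assms by (simp add: powr_half_sqrt flip: assms(2))
  then have "r powr e = (A * y) powr (e / 2)" by (simp add: powr_powr)
  then show ?thesis using assms by (simp add: powr_mult)
qed

lemma sum_pairs: "(\<Sum>i=1..2 * N. f i) = (\<Sum>k=1..N. f (2 * k - 1) + f (2 * k))" for f :: "nat \<Rightarrow> real"
proof (induction N)
  case (Suc N)
  have "{1..2 * Suc N} = insert (2 * Suc N) (insert (2 * Suc N - 1) {1..2 * N})" by auto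
  then have "(\<Sum>i=1..2 * Suc N. f i) = f (2 * Suc N) + (f (2 * Suc N - 1) + (\<Sum>i=1..2 * N. f i))"
    by simp
  then show ?case using Suc by simp
qed simp

context lacunary
begin

definition trig_vec :: "real \<Rightarrow> nat \<Rightarrow> real" where
  "trig_vec t i = (if odd i then sqrt 2 * cos (real (m ((i + 1) div 2)) * t) else sqrt 2 * sin (real (m (i div 2)) * t))"

lemma trig_vec_measurable: "(\<lambda>t. trig_vec t i) \<in> borel_measurable unif_circle"
  unfolding trig_vec_def by (intro measurable_unif_circle) measurable

lemma trig_vec_odd: "k \<ge> 1 \<Longrightarrow> trig_vec t (2 * k - 1) = sqrt 2 * cos (real (m k) * t)"
  and trig_vec_even: "trig_vec t (2 * k) = sqrt 2 * sin (real (m k) * t)"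
  by (auto simp: trig_vec_def elim: evenE)

lemma trig_vec_norm: "(euclid_norm (2 * N) (trig_vec t))\<^sup>2 = real (2 * N)"
proof -
  have "(euclid_norm (2 * N) (trig_vec t))\<^sup>2 = (\<Sum>k=1..N. (trig_vec t (2 * k - 1))\<^sup>2 + (trig_vec t (2 * k))\<^sup>2)"
    unfolding euclid_norm_power2 by (rule sum_pairs)
  also have "\<dots> = (\<Sum>k=1..N. 2)"
  proof (intro sum.cong refl)
    fix k assume "k \<in> {1..N}"
    then have k1: "1 \<le> k" by simp
    have s2: "(sqrt 2 :: real)\<^sup>2 = 2" by simp
    have "(trig_vec t (2 * k - 1))\<^sup>2 + (trig_vec t (2 * k))\<^sup>2
      = 2 * ((sin (real (m k) * t))\<^sup>2 + (cos (real (m k) * t))\<^sup>2)"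
      unfolding trig_vec_odd[OF k1] trig_vec_even power_mult_distrib s2 by (simp only: distrib_left add.commute)
    then show "(trig_vec t (2 * k - 1))\<^sup>2 + (trig_vec t (2 * k))\<^sup>2 = 2"
      by (simp only: sin_cos_squared_add mult_1_right)
  qed
  finally show ?thesis by simp
qed

text \<open>
  Cosine and sine of the same frequency combine by the addition theorem to \<open>cos (m\<^sub>k (t - s))\<close>. The squared distance thus depends
  on \<open>t - s\<close> only.
\<close>

lemma trig_vec_diff_norm:
  "(euclid_norm (2 * N) (\<lambda>i. trig_vec s i - trig_vec t i))\<^sup>2 = 2 * real (2 * N) * (1 - cos_sum t s / real N)"
proof -
  have "(euclid_norm (2 * N) (\<lambda>i. trig_vec s i - trig_vec t i))\<^sup>2
    = (\<Sum>k=1..N. (trig_vec s (2 * k - 1) - trig_vec t (2 * k - 1))\<^sup>2 + (trig_vec s (2 * k) - trig_vec t (2 * k))\<^sup>2)"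
    unfolding euclid_norm_power2 by (rule sum_pairs)
  also have "\<dots> = (\<Sum>k=1..N. 4 - 4 * cos (real (m k) * (s - t)))"
  proof (intro sum.cong refl)
    fix k assume k: "k \<in> {1..N}"
    then have k1: "1 \<le> k" by simp
    let ?a = "real (m k) * s" and ?b = "real (m k) * t"
    have "(trig_vec s (2 * k - 1) - trig_vec t (2 * k - 1))\<^sup>2 + (trig_vec s (2 * k) - trig_vec t (2 * k))\<^sup>2
      = (sqrt 2)\<^sup>2 * ((cos ?a - cos ?b)\<^sup>2 + (sin ?a - sin ?b)\<^sup>2)"
      unfolding trig_vec_odd[OF k1] trig_vec_even right_diff_distrib[symmetric] power_mult_distrib distrib_left ..
    also have "\<dots> = 2 * (((sin ?a)\<^sup>2 + (cos ?a)\<^sup>2) + ((sin ?b)\<^sup>2 + (cos ?b)\<^sup>2) - 2 * (cos ?a * cos ?b + sin ?a * sin ?b))"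
      unfolding real_sqrt_pow2[OF zero_le_numeral] by algebra
    also have "\<dots> = 4 - 4 * cos (?a - ?b)" by (simp add: cos_diff)
    finally show "(trig_vec s (2 * k - 1) - trig_vec t (2 * k - 1))\<^sup>2 + (trig_vec s (2 * k) - trig_vec t (2 * k))\<^sup>2
      = 4 - 4 * cos (real (m k) * (s - t))" by (simp add: right_diff_distrib)
  qed
  also have "\<dots> = 2 * real (2 * N) * (1 - cos_sum t s / real N)"
    using N by (simp add: cos_sum_def sum_subtractf sum_distrib_left field_simps)
  finally show ?thesis .
qed

definition law :: "(nat \<Rightarrow> real) \<Rightarrow> real measure" where
  "law \<theta> = distr unif_circle borel (\<lambda>t. euclid_inner (2 * N) (trig_vec t) \<theta>)"

lemma inner_trig_vec_measurable: "(\<lambda>t. euclid_inner (2 * N) (trig_vec t) \<theta>) \<in> borel_measurable unif_circle"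
  using trig_vec_measurable by measurable

lemma real_distribution_law: "real_distribution (law \<theta>)"
proof -
  interpret prob_space unif_circle by (rule prob_space_unif_circle)
  show ?thesis unfolding law_def by (intro real_distribution_distr) (use inner_trig_vec_measurable in simp)
qed

lemma law_self_energy:
  assumes [measurable]: "k \<in> borel_measurable borel"
  shows "mutual_energy k (law \<theta>) (law \<theta>)
    = (\<integral>\<^sup>+t. \<integral>\<^sup>+s. k (euclid_inner (2 * N) (trig_vec s) \<theta> - euclid_inner (2 * N) (trig_vec t) \<theta>) \<partial>unif_circle \<partial>unif_circle)"
proof -
  interpret prob_space unif_circle by (rule prob_space_unif_circle)
  interpret L: real_distribution "law \<theta>" by (rule real_distribution_law)
  note [measurable] = inner_trig_vec_measurable
  have "mutual_energy k (law \<theta>) (law \<theta>)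
     = (\<integral>\<^sup>+t. \<integral>\<^sup>+y. k (y - euclid_inner (2 * N) (trig_vec t) \<theta>) \<partial>law \<theta> \<partial>unif_circle)"
    unfolding mutual_energy_def by (subst (1) law_def, subst nn_integral_distr) simp_all
  also have "\<dots> = (\<integral>\<^sup>+t. \<integral>\<^sup>+s. k (euclid_inner (2 * N) (trig_vec s) \<theta> - euclid_inner (2 * N) (trig_vec t) \<theta>) \<partial>unif_circle \<partial>unif_circle)"
    unfolding law_def by (intro nn_integral_cong, subst nn_integral_distr) simp_all
  finally show ?thesis .
qed

text \<open>
  The standard normal law is the law of \<open><G, \<theta>>\<close> for any unit vector. This lets it take part in the spherical average on
  the same footing as the projections of \<open>X\<close>.
\<close>

lemma nn_integral_std_normal_gauss:
  assumes "euclid_norm n \<theta> = 1" "g \<in> borel_measurable borel"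
  shows "(\<integral>\<^sup>+z. g z \<partial>std_normal_distribution) = (\<integral>\<^sup>+x. g (euclid_inner n x \<theta>) \<partial>gauss n)"
  using nn_integral_gauss_inner[of n \<theta> g] assms by (simp add: euclid_inner_commute[of n _ \<theta>])

lemma law_normal_energy:
  assumes k [measurable]: "k \<in> borel_measurable borel" and \<theta>: "\<theta> \<in> space (sphere_measure (2 * N))"
  shows "mutual_energy k (law \<theta>) std_normal_distribution
    = (\<integral>\<^sup>+t. \<integral>\<^sup>+x. k (euclid_inner (2 * N) x \<theta> - euclid_inner (2 * N) (trig_vec t) \<theta>) \<partial>gauss (2 * N) \<partial>unif_circle)"
proof -
  interpret Z: prob_space std_normal_distribution by (rule prob_space_normal_density) simp
  note [measurable] = inner_trig_vec_measurable
  have \<theta>1: "euclid_norm (2 * N) \<theta> = 1" using \<theta> by (simp add: space_sphere_measure unit_sphere_def)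
  have "mutual_energy k (law \<theta>) std_normal_distribution
     = (\<integral>\<^sup>+t. \<integral>\<^sup>+y. k (y - euclid_inner (2 * N) (trig_vec t) \<theta>) \<partial>std_normal_distribution \<partial>unif_circle)"
    unfolding mutual_energy_def law_def by (subst nn_integral_distr) simp_all
  also have "\<dots> = (\<integral>\<^sup>+t. \<integral>\<^sup>+x. k (euclid_inner (2 * N) x \<theta> - euclid_inner (2 * N) (trig_vec t) \<theta>) \<partial>gauss (2 * N) \<partial>unif_circle)"
    by (intro nn_integral_cong nn_integral_std_normal_gauss[OF \<theta>1]) simp
  finally show ?thesis .
qed

text \<open>
  Swapping the two laws reflects the kernel. The positive part is not even, so both orders occur in the energy
  distance.
\<close>

lemma normal_law_energy:
  assumes k [measurable]: "k \<in> borel_measurable borel"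
  shows "mutual_energy k std_normal_distribution (law \<theta>) = mutual_energy (\<lambda>r. k (- r)) (law \<theta>) std_normal_distribution"
proof -
  interpret Z: prob_space std_normal_distribution by (rule prob_space_normal_density) simp
  interpret L: real_distribution "law \<theta>" by (rule real_distribution_law)
  have "mutual_energy k std_normal_distribution (law \<theta>) = (\<integral>\<^sup>+y. \<integral>\<^sup>+x. k (y - x) \<partial>std_normal_distribution \<partial>law \<theta>)"
    unfolding mutual_energy_def
    by (intro nn_integral_swap Z.sigma_finite_measure_axioms L.sigma_finite_measure_axioms) measurable
  then show ?thesis by (simp add: mutual_energy_def)
qed

lemma dim_ge_1: "2 * N \<ge> 1"
  using N by simp

text \<open>
  Two independent copies of the vector differ almost surely, since \<open>cos_sum < N\<close> almost everywhere.
\<close>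

lemma average_self_energy:
  fixes k :: "real \<Rightarrow> ennreal"
  assumes k: "k \<in> borel_measurable borel" and hom: "\<And>c r. c > 0 \<Longrightarrow> k (c * r) = ennreal (c powr e) * k r"
  shows "radial_moment (2 * N) e * (\<integral>\<^sup>+\<theta>. mutual_energy k (law \<theta>) (law \<theta>) \<partial>sphere_measure (2 * N))
   = (\<integral>\<^sup>+z. k z \<partial>std_normal_distribution) * (ennreal ((2 * real (2 * N)) powr (e / 2))
      * (\<integral>\<^sup>+t. \<integral>\<^sup>+s. ennreal ((1 - cos_sum t s / real N) powr (e / 2)) \<partial>unif_circle \<partial>unif_circle))"
proof -
  let ?n = "2 * N"
  have ne: "AE s in unif_circle. euclid_norm ?n (\<lambda>i. trig_vec s i - trig_vec t i) > 0" for t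
    using lacunary_perturbation(4)[of t]
  proof eventually_elim
    case (elim s)
    then have "(euclid_norm ?n (\<lambda>i. trig_vec s i - trig_vec t i))\<^sup>2 > 0"
      unfolding trig_vec_diff_norm using N by simp
    then show ?case using euclid_norm_nonneg[of ?n "\<lambda>i. trig_vec s i - trig_vec t i"] by (simp add: less_le)
  qed
  have pw: "ennreal (euclid_norm ?n (\<lambda>i. trig_vec s i - trig_vec t i) powr e)
     = ennreal ((2 * real ?n) powr (e / 2)) * ennreal ((1 - cos_sum t s / real N) powr (e / 2))" for s t
  proof -
    have "2 * real ?n * (1 - cos_sum t s / real N) \<ge> 0"
      unfolding trig_vec_diff_norm[symmetric] by simp
    then have "1 - cos_sum t s / real N \<ge> 0" using N by (simp add: zero_le_mult_iff)
    then show ?thesis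
      using powr_of_square[OF euclid_norm_nonneg trig_vec_diff_norm, of t s e] by (simp add: ennreal_mult)
  qed
  have m [measurable]: "(\<lambda>(t, s). cos_sum t s) \<in> borel_measurable (unif_circle \<Otimes>\<^sub>M unif_circle)"
  proof -
    have id: "(\<lambda>t. t) \<in> borel_measurable unif_circle" by (rule measurable_unif_circle) simp
    note [measurable] = id
    show ?thesis unfolding cos_sum_def by measurable
  qed
  interpret P: prob_space unif_circle by (rule prob_space_unif_circle)
  have "radial_moment ?n e * (\<integral>\<^sup>+\<theta>. mutual_energy k (law \<theta>) (law \<theta>) \<partial>sphere_measure ?n)
   = (\<integral>\<^sup>+z. k z \<partial>std_normal_distribution) * (\<integral>\<^sup>+t. \<integral>\<^sup>+s. ennreal (euclid_norm ?n (\<lambda>i. trig_vec s i - trig_vec t i) powr e) \<partial>unif_circle \<partial>unif_circle)"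
    unfolding law_self_energy[OF k]
    by (rule sphere_average_energy[OF dim_ge_1 prob_space_unif_circle prob_space_unif_circle trig_vec_measurable trig_vec_measurable k hom ne])
  also have "(\<integral>\<^sup>+t. \<integral>\<^sup>+s. ennreal (euclid_norm ?n (\<lambda>i. trig_vec s i - trig_vec t i) powr e) \<partial>unif_circle \<partial>unif_circle)
    = ennreal ((2 * real ?n) powr (e / 2))
      * (\<integral>\<^sup>+t. \<integral>\<^sup>+s. ennreal ((1 - cos_sum t s / real N) powr (e / 2)) \<partial>unif_circle \<partial>unif_circle)"
    unfolding pw
    by (subst nn_integral_cmult[symmetric], measurable, intro nn_integral_cong, subst nn_integral_cmult[symmetric], measurable)
  finally show ?thesis .
qed

lemma average_normal_energy:
  fixes k :: "real \<Rightarrow> ennreal"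
  assumes k: "k \<in> borel_measurable borel" and hom: "\<And>c r. c > 0 \<Longrightarrow> k (c * r) = ennreal (c powr e) * k r"
  defines "\<zeta> \<equiv> \<lambda>t x. 1 - (euclid_norm (2 * N) (\<lambda>i. x i - trig_vec t i))\<^sup>2 / (2 * real (2 * N))"
  shows "radial_moment (2 * N) e * (\<integral>\<^sup>+\<theta>. mutual_energy k (law \<theta>) std_normal_distribution \<partial>sphere_measure (2 * N))
   = (\<integral>\<^sup>+z. k z \<partial>std_normal_distribution) * (ennreal ((2 * real (2 * N)) powr (e / 2))
      * (\<integral>\<^sup>+t. \<integral>\<^sup>+x. ennreal ((1 - \<zeta> t x) powr (e / 2)) \<partial>gauss (2 * N) \<partial>unif_circle))"
proof -
  let ?n = "2 * N"
  interpret P: prob_space unif_circle by (rule prob_space_unif_circle)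
  interpret G: prob_space "gauss ?n" by (rule prob_space_gauss)
  note [measurable] = component_measurable_gauss_borel[of _ ?n] trig_vec_measurable
  have pw: "ennreal (euclid_norm ?n (\<lambda>i. x i - trig_vec t i) powr e)
     = ennreal ((2 * real ?n) powr (e / 2)) * ennreal ((1 - \<zeta> t x) powr (e / 2))" for x t
  proof -
    have "(euclid_norm ?n (\<lambda>i. x i - trig_vec t i))\<^sup>2 = 2 * real ?n * (1 - \<zeta> t x)"
      using N by (simp add: \<zeta>_def)
    moreover have "1 - \<zeta> t x \<ge> 0" by (simp add: \<zeta>_def)
    ultimately show ?thesis
      using powr_of_square[OF euclid_norm_nonneg, of ?n "\<lambda>i. x i - trig_vec t i" "2 * real ?n" "1 - \<zeta> t x" e]
      by (simp add: ennreal_mult)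
  qed
  have "radial_moment ?n e * (\<integral>\<^sup>+\<theta>. mutual_energy k (law \<theta>) std_normal_distribution \<partial>sphere_measure ?n)
   = radial_moment ?n e * (\<integral>\<^sup>+\<theta>. \<integral>\<^sup>+t. \<integral>\<^sup>+x. k (euclid_inner ?n x \<theta> - euclid_inner ?n (trig_vec t) \<theta>) \<partial>gauss ?n \<partial>unif_circle \<partial>sphere_measure ?n)"
    by (intro arg_cong2[where f="(*)"] refl nn_integral_cong law_normal_energy[OF k])
  also have "\<dots> = (\<integral>\<^sup>+z. k z \<partial>std_normal_distribution) * (\<integral>\<^sup>+t. \<integral>\<^sup>+x. ennreal (euclid_norm ?n (\<lambda>i. x i - trig_vec t i) powr e) \<partial>gauss ?n \<partial>unif_circle)"
    by (rule sphere_average_energy[OF dim_ge_1 prob_space_unif_circle prob_space_gauss trig_vec_measurable component_measurable_gauss_borel k hom AE_gauss_neq[OF dim_ge_1]])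
  also have "(\<integral>\<^sup>+t. \<integral>\<^sup>+x. ennreal (euclid_norm ?n (\<lambda>i. x i - trig_vec t i) powr e) \<partial>gauss ?n \<partial>unif_circle)
    = ennreal ((2 * real ?n) powr (e / 2))
      * (\<integral>\<^sup>+t. \<integral>\<^sup>+x. ennreal ((1 - \<zeta> t x) powr (e / 2)) \<partial>gauss ?n \<partial>unif_circle)"
    unfolding pw \<zeta>_def
    by (subst nn_integral_cmult[symmetric], measurable, intro nn_integral_cong, subst nn_integral_cmult[symmetric], measurable)
  finally show ?thesis .
qed

end

text \<open>
  The difference of two independent Gaussian vectors has the law of \<open>sqrt 2 * G\<close>, with squared length
  \<open>2 n (1 - \<kappa>)\<close>. This brings the energy of the normal law to the same form as the other averaged energies.
\<close>

lemma normal_energy_radial: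
  fixes e :: real
  assumes n: "n \<ge> 1"
  defines "\<kappa> \<equiv> \<lambda>x. 1 - (euclid_norm n x)\<^sup>2 / real n"
  shows "ennreal (sqrt 2 powr e) * radial_moment n e
    = ennreal ((2 * real n) powr (e / 2)) * (\<integral>\<^sup>+x. ennreal ((1 - \<kappa> x) powr (e / 2)) \<partial>gauss n)"
proof -
  have pw: "ennreal (sqrt 2 powr e) * ennreal (euclid_norm n x powr e)
     = ennreal ((2 * real n) powr (e / 2)) * ennreal ((1 - \<kappa> x) powr (e / 2))" for x
  proof -
    have "(sqrt 2 * euclid_norm n x)\<^sup>2 = 2 * real n * (1 - \<kappa> x)" "1 - \<kappa> x \<ge> 0"
      using n by (simp_all add: \<kappa>_def power_mult_distrib)
    then have "(sqrt 2 * euclid_norm n x) powr e = (2 * real n) powr (e / 2) * (1 - \<kappa> x) powr (e / 2)"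
      by (intro powr_of_square) (simp_all add: euclid_norm_nonneg)
    moreover have "(sqrt 2 * euclid_norm n x) powr e = sqrt 2 powr e * euclid_norm n x powr e"
      by (rule powr_mult)
    ultimately show ?thesis by (simp add: ennreal_mult[symmetric])
  qed
  have "ennreal (sqrt 2 powr e) * radial_moment n e = (\<integral>\<^sup>+x. ennreal (sqrt 2 powr e) * ennreal (euclid_norm n x powr e) \<partial>gauss n)"
    unfolding radial_moment_def by (rule nn_integral_cmult[symmetric]) measurable
  also have "\<dots> = (\<integral>\<^sup>+x. ennreal ((2 * real n) powr (e / 2)) * ennreal ((1 - \<kappa> x) powr (e / 2)) \<partial>gauss n)"
    unfolding pw ..
  also have "\<dots> = ennreal ((2 * real n) powr (e / 2)) * (\<integral>\<^sup>+x. ennreal ((1 - \<kappa> x) powr (e / 2)) \<partial>gauss n)"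
    unfolding \<kappa>_def by (rule nn_integral_cmult) measurable
  finally show ?thesis .
qed

section \<open>Cancellation of the second-order terms\<close>

lemma pos_kernel_homogeneous: "c > 0 \<Longrightarrow> pos_kernel (c * r) = ennreal (c powr 1) * pos_kernel r"
  by (simp add: pos_kernel_def ennreal_mult'[symmetric] max_mult_distrib_left)

definition pos_mean :: real where
  "pos_mean = enn2real (\<integral>\<^sup>+z. pos_kernel z \<partial>std_normal_distribution)"

lemma pos_mean: "(\<integral>\<^sup>+z. pos_kernel z \<partial>std_normal_distribution) = ennreal pos_mean" "pos_mean \<ge> 0"
proof -
  have i: "integrable std_normal_distribution (\<lambda>z::real. max 0 z)"
    using std_normal_power_integrable[of 1] by simp
  have "(\<integral>\<^sup>+z. pos_kernel z \<partial>std_normal_distribution) = ennreal (\<integral>z. max 0 z \<partial>std_normal_distribution)"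
    unfolding pos_kernel_def by (rule nn_integral_eq_integral[OF i]) simp
  then show "(\<integral>\<^sup>+z. pos_kernel z \<partial>std_normal_distribution) = ennreal pos_mean"
    unfolding pos_mean_def by (simp add: less_top)
qed (simp add: pos_mean_def)

lemma neg_mean: "(\<integral>\<^sup>+z. pos_kernel (- z) \<partial>std_normal_distribution) = ennreal pos_mean"
proof -
  have "(\<integral>\<^sup>+z. pos_kernel (- z) \<partial>std_normal_distribution) = (\<integral>\<^sup>+z. std_normal_density z * pos_kernel (- z) \<partial>lborel)"
    by (subst nn_integral_density) simp_all
  also have "\<dots> = (\<integral>\<^sup>+z. std_normal_density (0 + -1 * z) * pos_kernel (- (0 + -1 * z)) \<partial>lborel)"
    by (subst nn_integral_real_affine[of _ "-1" 0]) simp_all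
  also have "\<dots> = (\<integral>\<^sup>+z. std_normal_density z * pos_kernel z \<partial>lborel)"
    by (simp add: std_normal_density_def)
  also have "\<dots> = (\<integral>\<^sup>+z. pos_kernel z \<partial>std_normal_distribution)"
    by (subst nn_integral_density) simp_all
  finally show ?thesis using pos_mean by simp
qed

lemma riesz_kernel_even: "riesz_kernel (- r) = riesz_kernel r"
  by (simp add: riesz_kernel_def tent_kernel_def)

definition riesz_mean :: real where
  "riesz_mean = enn2real (\<integral>\<^sup>+z. riesz_kernel z \<partial>std_normal_distribution)"

lemma riesz_mean: "(\<integral>\<^sup>+z. riesz_kernel z \<partial>std_normal_distribution) = ennreal riesz_mean" "riesz_mean \<ge> 0"
proof -
  interpret prob_space std_normal_distribution by (rule prob_space_normal_density) simp
  have "AE z in std_normal_distribution. z \<noteq> 0"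
    by (subst AE_density) (use AE_lborel_singleton[of "0::real"] in auto)
  then have "(\<integral>\<^sup>+z. riesz_kernel z \<partial>std_normal_distribution)
    \<le> (\<integral>\<^sup>+z. ennreal (5/2) * (1 + ennreal (\<bar>z\<bar> powr (-4/5))) \<partial>std_normal_distribution)"
  proof (intro nn_integral_mono_AE, eventually_elim)
    case (elim z)
    have "riesz_kernel z = riesz_kernel (\<bar>z\<bar> * 1)" using riesz_kernel_even[of z] by (auto simp: abs_if)
    also have "\<dots> = ennreal (\<bar>z\<bar> powr (-2/5)) * riesz_kernel 1"
      using elim by (intro riesz_kernel_homogeneous) simp
    also have "\<dots> \<le> ennreal (\<bar>z\<bar> powr (-2/5)) * ennreal (5/2)"
      by (intro mult_left_mono riesz_kernel_1) simp
    finally have "riesz_kernel z \<le> ennreal (\<bar>z\<bar> powr (-2/5)) * ennreal (5/2)" .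
    also have "\<dots> \<le> (1 + ennreal (\<bar>z\<bar> powr (-4/5))) * ennreal (5/2)"
    proof (rule mult_right_mono)
      show "ennreal (\<bar>z\<bar> powr (-2/5)) \<le> 1 + ennreal (\<bar>z\<bar> powr (-4/5))"
    proof -
      have "(\<bar>z\<bar> powr (-2/5))\<^sup>2 = \<bar>z\<bar> powr (-4/5)"
        using powr_add[of "\<bar>z\<bar>" "-2/5" "-2/5"] by (simp add: power2_eq_square)
      moreover have "\<bar>z\<bar> powr (-2/5) \<le> 1 + (\<bar>z\<bar> powr (-2/5))\<^sup>2"
      proof -
        have "p \<le> 1 + p\<^sup>2" if "p \<ge> 0" for p :: real
          using sum_squares_bound[of 1 p] that by simp
        then show ?thesis by simp
      qed
      ultimately have "\<bar>z\<bar> powr (-2/5) \<le> 1 + \<bar>z\<bar> powr (-4/5)" by simp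
      then have "ennreal (\<bar>z\<bar> powr (-2/5)) \<le> ennreal (1 + \<bar>z\<bar> powr (-4/5))" by (rule ennreal_leI)
      also have "\<dots> = 1 + ennreal (\<bar>z\<bar> powr (-4/5))" by (subst ennreal_plus) simp_all
      finally show ?thesis .
    qed
    qed simp
    finally show ?case by (simp only: mult.commute)
  qed
  also have "\<dots> = ennreal (5/2) * (1 + (\<integral>\<^sup>+z. ennreal (\<bar>z\<bar> powr (-4/5)) \<partial>std_normal_distribution))"
    by (subst nn_integral_cmult) (simp_all add: nn_integral_add emeasure_space_1[simplified])
  also have "\<dots> \<le> ennreal (5/2) * (1 + ennreal 11)"
    by (intro mult_left_mono add_left_mono std_normal_negative_moment) simp
  also have "\<dots> < \<top>" by (simp add: ennreal_mult_less_top)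
  finally show "(\<integral>\<^sup>+z. riesz_kernel z \<partial>std_normal_distribution) = ennreal riesz_mean"
    unfolding riesz_mean_def by simp
qed (simp add: riesz_mean_def)

text \<open>
  The last algebraic step, common to both distances. Here \<open>W\<close> is the averaged distance, \<open>H\<close> the radial moment and
  \<open>q\<close> the normalized energy of the normal law. The bound for \<open>Up - Lo\<close> carries over to \<open>W\<close> after division by
  \<open>H\<close>, which is bounded below because \<open>q \<ge> 1/2\<close>.
\<close>

lemma energy_cancellation:
  assumes c: "c \<ge> 0" and a: "a > 0" and r: "r \<ge> 0"
    and eq: "H * W + ennreal (c * a) * Lo = ennreal (c * a) * Up"
    and Lo: "ennreal l \<le> Lo" and Up: "Up \<le> ennreal u" and d: "u - l = d"
    and rad: "ennreal r * H = ennreal a * q" and q: "ennreal (1/2) \<le> q"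
  shows "W \<le> ennreal (2 * c * r * d)"
proof -
  have ca: "c * a \<ge> 0" using c a by simp
  have "H * W + ennreal (c * a * l) \<le> H * W + ennreal (c * a) * Lo"
    unfolding ennreal_mult'[OF ca] by (intro add_left_mono mult_left_mono Lo) simp
  also have "\<dots> \<le> ennreal (c * a * u)"
    unfolding eq ennreal_mult'[OF ca] by (intro mult_left_mono Up) simp
  finally have "H * W \<le> ennreal (c * a * u - c * a * l)" by (rule add_le_imp_le_diff_ennreal)
  then have W: "H * W \<le> ennreal (c * a * d)" by (simp only: d[symmetric] right_diff_distrib)
  have "ennreal a * ennreal (1/2) \<le> ennreal r * H" unfolding rad using q by (rule mult_left_mono) simp
  then have H: "ennreal (a / 2) \<le> ennreal r * H" using a by (subst (asm) ennreal_mult[symmetric]) simp_all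
  have "ennreal (a / 2) * W \<le> ennreal r * H * W" using H by (rule mult_right_mono) simp
  also have "\<dots> \<le> ennreal r * ennreal (c * a * d)"
    by (subst mult.assoc) (rule mult_left_mono[OF W], simp)
  also have "\<dots> = ennreal (r * (c * a * d))" using r by (rule ennreal_mult'[symmetric])
  finally have "ennreal (2 / a) * (ennreal (a / 2) * W) \<le> ennreal (2 / a) * ennreal (r * (c * a * d))"
    by (rule mult_left_mono) simp
  also have "\<dots> = ennreal (2 / a * (r * (c * a * d)))" using a by (intro ennreal_mult'[symmetric]) simp
  also have "2 / a * (r * (c * a * d)) = 2 * c * r * d" using a by simp
  also have "ennreal (2 / a) * (ennreal (a / 2) * W) = W"
    using a by (simp add: mult.assoc[symmetric] ennreal_mult'[symmetric])
  finally show ?thesis .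
qed

context
  fixes n :: nat
  assumes n2: "n \<ge> 2"
begin

text \<open>
  The quadratic minorant \<open>1 - x / 2 - x\<^sup>2 / 2\<close> of \<open>sqrt (1 - x)\<close>, valid for all \<open>x \<le> 1\<close>, has mean
  \<open>1 - 1 / n\<close>.
\<close>

lemma gauss_sqrt_moment_ge_half:
  "ennreal (1/2) \<le> (\<integral>\<^sup>+x. ennreal (sqrt (1 - (1 - (euclid_norm n x)\<^sup>2 / real n))) \<partial>gauss n)"
proof -
  have n1: "n \<ge> 1" using n2 by simp
  define \<kappa> where "\<kappa> x = 1 - (euclid_norm n x)\<^sup>2 / real n" for x
  interpret concentrated_perturbation "gauss n" \<kappa> n gauss_moment_const
    using gauss_norm_perturbation(1)[OF n1] by (simp add: \<kappa>_def[abs_def])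
  have "expectation (\<lambda>x. 1 + (-1/2) * \<kappa> x + (-1/2) * (\<kappa> x)\<^sup>2 + 0 * \<kappa> x ^ 3) = 1 - 1 / real n"
    unfolding expectation_cubic using gauss_norm_perturbation(2)[OF n1] by (simp add: \<kappa>_def)
  also have "\<dots> \<ge> 1/2" using n2 by (simp add: field_simps)
  finally have "ennreal (1/2) \<le> ennreal (expectation (\<lambda>x. 1 + (-1/2) * \<kappa> x + (-1/2) * (\<kappa> x)\<^sup>2 + 0 * \<kappa> x ^ 3))"
    by (rule ennreal_leI)
  also have "\<dots> \<le> (\<integral>\<^sup>+x. ennreal (sqrt (1 - \<kappa> x)) \<partial>gauss n)"
  proof (rule ennreal_integral_le_nn_integral)
    show "AE x in gauss n. 1 + (-1/2) * \<kappa> x + (-1/2) * (\<kappa> x)\<^sup>2 + 0 * \<kappa> x ^ 3 \<le> sqrt (1 - \<kappa> x)"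
    proof (rule AE_I2)
      fix x
      define s where "s = sqrt (1 - \<kappa> x)"
      have "1 - \<kappa> x \<ge> 0" by (simp add: \<kappa>_def)
      then have s: "s \<ge> 0" "\<kappa> x = 1 - s\<^sup>2" by (simp_all add: s_def)
      have "2 * (s - (1 - (1 - s\<^sup>2) / 2 - (1 - s\<^sup>2)\<^sup>2 / 2)) = s * ((s - 1)\<^sup>2 * (s + 2))"
        by (simp add: power2_eq_square field_simps)
      also have "\<dots> \<ge> 0" using s(1) by (intro mult_nonneg_nonneg) simp_all
      finally have "1 - (1 - s\<^sup>2) / 2 - (1 - s\<^sup>2)\<^sup>2 / 2 \<le> sqrt (1 - \<kappa> x)"
        unfolding s_def[symmetric] by (simp only: zero_le_mult_iff diff_ge_0_iff_ge) simp
      moreover have "1 + (-1/2) * \<kappa> x + (-1/2) * (\<kappa> x)\<^sup>2 + 0 * \<kappa> x ^ 3 = 1 - (1 - s\<^sup>2) / 2 - (1 - s\<^sup>2)\<^sup>2 / 2"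
        unfolding s(2) by simp
      ultimately show "1 + (-1/2) * \<kappa> x + (-1/2) * (\<kappa> x)\<^sup>2 + 0 * \<kappa> x ^ 3 \<le> sqrt (1 - \<kappa> x)"
        by linarith
    qed
  qed (rule expectation_cubic(1), simp)
  finally show ?thesis by (simp add: \<kappa>_def)
qed

lemma gauss_fifth_root_moment_ge_half:
  "ennreal (1/2) \<le> (\<integral>\<^sup>+x. ennreal ((1 - (1 - (euclid_norm n x)\<^sup>2 / real n)) powr (-1/5)) \<partial>gauss n)"
proof -
  have n1: "n \<ge> 1" using n2 by simp
  define \<kappa> where "\<kappa> x = 1 - (euclid_norm n x)\<^sup>2 / real n" for x
  note g = gauss_norm_perturbation[OF n1, folded \<kappa>_def]
  interpret concentrated_perturbation "gauss n" \<kappa> n gauss_moment_const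
    using g(1) by (simp add: \<kappa>_def[abs_def])
  have "1/2 \<le> 1 + 3/25 * (2 / real n) + 11/125 * (- 8 / (real n)\<^sup>2)"
  proof -
    have "8 / (real n)\<^sup>2 \<le> 8 / 2\<^sup>2" using n2 by (intro divide_left_mono power_mono) simp_all
    moreover have "2 / real n \<ge> 0" by simp
    moreover have "- 8 / (real n)\<^sup>2 = - (8 / (real n)\<^sup>2)" by simp
    moreover have "8 / 2\<^sup>2 = (2::real)" by simp
    ultimately show ?thesis by linarith
  qed
  then have "ennreal (1/2) \<le> ennreal (1 + 3/25 * (2 / real n) + 11/125 * (- 8 / (real n)\<^sup>2))" by (rule ennreal_leI)
  also have "\<dots> \<le> (\<integral>\<^sup>+x. ennreal ((1 - \<kappa> x) powr (-1/5)) \<partial>gauss n)"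
    using fifth_root_moment_lower[OF g(4)] unfolding g(2,3) .
  finally show ?thesis by (simp add: \<kappa>_def)
qed

end

context lacunary
begin

lemma law_cdf_eq: "cdf (law \<theta>) x = measure unif_circle {t \<in> space unif_circle. euclid_inner (2 * N) (trig_vec t) \<theta> \<le> x}"
proof -
  have "cdf (law \<theta>) x = measure unif_circle ((\<lambda>t. euclid_inner (2 * N) (trig_vec t) \<theta>) -` {..x} \<inter> space unif_circle)"
    unfolding cdf_def law_def by (rule measure_distr[OF inner_trig_vec_measurable]) simp
  also have "(\<lambda>t. euclid_inner (2 * N) (trig_vec t) \<theta>) -` {..x} \<inter> space unif_circle
    = {t \<in> space unif_circle. euclid_inner (2 * N) (trig_vec t) \<theta> \<le> x}" by auto
  finally show ?thesis .
qed

text \<open>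
  Joint measurability makes both distances measurable functions of the direction.
\<close>

lemma law_cdf_measurable:
  "(\<lambda>(\<theta>, x). cdf (law \<theta>) x) \<in> borel_measurable (sphere_measure (2 * N) \<Otimes>\<^sub>M borel)"
proof -
  interpret P: prob_space unif_circle by (rule prob_space_unif_circle)
  note [measurable] = component_measurable_sphere[of _ "2 * N"] trig_vec_measurable
  have "cdf (law \<theta>) x = enn2real (\<integral>\<^sup>+t. (if euclid_inner (2 * N) (trig_vec t) \<theta> \<le> x then 1 else 0) \<partial>unif_circle)" for \<theta> x
  proof -
    have [measurable]: "{t \<in> space unif_circle. euclid_inner (2 * N) (trig_vec t) \<theta> \<le> x} \<in> sets unif_circle"
      using inner_trig_vec_measurable by measurable
    have "(\<integral>\<^sup>+t. (if euclid_inner (2 * N) (trig_vec t) \<theta> \<le> x then 1 else 0) \<partial>unif_circle)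
      = (\<integral>\<^sup>+t. indicator {t \<in> space unif_circle. euclid_inner (2 * N) (trig_vec t) \<theta> \<le> x} t \<partial>unif_circle)"
      by (intro nn_integral_cong) (simp add: indicator_def)
    then show ?thesis by (simp add: law_cdf_eq measure_def)
  qed
  then show ?thesis by (simp add: split_def)
qed

definition cvm :: "(nat \<Rightarrow> real) \<Rightarrow> ennreal" where
  "cvm \<theta> = (\<integral>\<^sup>+z. ennreal ((cdf (law \<theta>) z - cdf std_normal_distribution z)\<^sup>2) \<partial>lborel)"

definition fractional_norm :: "(nat \<Rightarrow> real) \<Rightarrow> ennreal" where
  "fractional_norm \<theta> = (\<integral>\<^sup>+s. riesz_weight s * (\<integral>\<^sup>+z. ennreal (((cdf (law \<theta>) (z + s) - cdf std_normal_distribution (z + s))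
     - (cdf (law \<theta>) z - cdf std_normal_distribution z))\<^sup>2) \<partial>lborel) \<partial>lborel)"

lemma cvm_measurable [measurable]: "cvm \<in> borel_measurable (sphere_measure (2 * N))"
  and fractional_norm_measurable [measurable]: "fractional_norm \<in> borel_measurable (sphere_measure (2 * N))"
proof -
  note [measurable] = cdf_measurable[OF real_distribution_std_normal]
  have [measurable (raw)]: "(\<lambda>x. cdf (law (f x)) (g x)) \<in> borel_measurable M"
    if "f \<in> M \<rightarrow>\<^sub>M sphere_measure (2 * N)" "g \<in> borel_measurable M" for f M and g :: "_ \<Rightarrow> real"
    using measurable_compose[OF measurable_Pair[OF that] law_cdf_measurable] by simp
  show "cvm \<in> borel_measurable (sphere_measure (2 * N))"
    unfolding cvm_def[abs_def] by measurable
  show "fractional_norm \<in> borel_measurable (sphere_measure (2 * N))"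
    unfolding fractional_norm_def[abs_def] by measurable
qed

lemma energy_measurable:
  assumes [measurable]: "k \<in> borel_measurable borel"
  shows "(\<lambda>\<theta>. mutual_energy k (law \<theta>) (law \<theta>)) \<in> borel_measurable (sphere_measure (2 * N))"
    and "(\<lambda>\<theta>. mutual_energy k (law \<theta>) std_normal_distribution) \<in> borel_measurable (sphere_measure (2 * N))"
proof -
  interpret P: prob_space unif_circle by (rule prob_space_unif_circle)
  interpret Z: prob_space std_normal_distribution by (rule prob_space_normal_density) simp
  note [measurable] = component_measurable_sphere[of _ "2 * N"] trig_vec_measurable
  show "(\<lambda>\<theta>. mutual_energy k (law \<theta>) (law \<theta>)) \<in> borel_measurable (sphere_measure (2 * N))"
    unfolding law_self_energy[OF assms] by measurable
  have "mutual_energy k (law \<theta>) std_normal_distribution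
     = (\<integral>\<^sup>+t. \<integral>\<^sup>+y. k (y - euclid_inner (2 * N) (trig_vec t) \<theta>) \<partial>std_normal_distribution \<partial>unif_circle)" for \<theta>
    unfolding mutual_energy_def law_def using inner_trig_vec_measurable by (subst nn_integral_distr) simp_all
  then show "(\<lambda>\<theta>. mutual_energy k (law \<theta>) std_normal_distribution) \<in> borel_measurable (sphere_measure (2 * N))"
    by simp
qed

abbreviation xi where "xi t s \<equiv> cos_sum t s / real N"
abbreviation zeta where "zeta t x \<equiv> 1 - (euclid_norm (2 * N) (\<lambda>i. x i - trig_vec t i))\<^sup>2 / (2 * real (2 * N))"
abbreviation kappa where "kappa x \<equiv> 1 - (euclid_norm (2 * N) x)\<^sup>2 / real (2 * N)"

abbreviation mean_xi where
  "mean_xi g \<equiv> (\<integral>\<^sup>+t. \<integral>\<^sup>+s. ennreal (g (1 - xi t s)) \<partial>unif_circle \<partial>unif_circle)"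
abbreviation mean_zeta where
  "mean_zeta g \<equiv> (\<integral>\<^sup>+t. \<integral>\<^sup>+x. ennreal (g (1 - zeta t x)) \<partial>gauss (2 * N) \<partial>unif_circle)"
abbreviation mean_kappa where
  "mean_kappa g \<equiv> (\<integral>\<^sup>+x. ennreal (g (1 - kappa x)) \<partial>gauss (2 * N))"
abbreviation fifth :: "real \<Rightarrow> real" where "fifth y \<equiv> y powr (-1/5)"

lemma xi_le_1: "xi t s \<le> 1"
proof -
  have "2 * real (2 * N) * (1 - xi t s) \<ge> 0" unfolding trig_vec_diff_norm[symmetric] by simp
  then show ?thesis using N by (simp add: zero_le_mult_iff)
qed

lemma nn_integral_circle_const: "(\<integral>\<^sup>+t. c \<partial>unif_circle) = c"
  using prob_space.emeasure_space_1[OF prob_space_unif_circle] by simp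

text \<open>
  The second-order coefficient of \<open>sqrt (1 - x)\<close> is -1/8, multiplied by the variances \<open>1 / n\<close>, \<open>3 / (2 n)\<close>,
  \<open>2 / n\<close>. In the squared \<open>L\<^sup>2\<close> distance the mixed term occurs with positive sign, so it is bounded above and the
  other two below.
\<close>

lemma sqrt_energy_bounds:
  defines "n \<equiv> real (2 * N)"
  shows "ennreal (1 - 1 / (8 * n) - (3/8 * real L + 1 + moment_const) / n\<^sup>2) \<le> mean_xi sqrt"
    and "mean_zeta sqrt \<le> ennreal (1 - 3 / (16 * n) + 1 / (4 * n\<^sup>2))"
    and "ennreal (1 - 1 / (4 * n) - (1/2 + gauss_moment_const) / n\<^sup>2) \<le> mean_kappa sqrt"
proof -
  interpret P: prob_space unif_circle by (rule prob_space_unif_circle)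
  note lac = lacunary_perturbation
  let ?l = "1 - 1 / (8 * n) - (3/8 * real L + 1 + moment_const) / n\<^sup>2" and ?u = "1 - 3 / (16 * n) + 1 / (4 * n\<^sup>2)"
  have "ennreal ?l \<le> (\<integral>\<^sup>+s. ennreal (sqrt (1 - xi t s)) \<partial>unif_circle)" for t
  proof -
    interpret concentrated_perturbation unif_circle "xi t" "2 * N" moment_const by (rule lac(1))
    have "AE s in unif_circle. xi t s \<le> 1" by (simp add: xi_le_1)
    from sqrt_moment_lower[OF this]
    have "ennreal (1 - 1 / n / 8 - P.expectation (\<lambda>s. xi t s ^ 3) / 16 - (1 + moment_const) / n\<^sup>2) \<le> (\<integral>\<^sup>+s. ennreal (sqrt (1 - xi t s)) \<partial>unif_circle)"
      unfolding lac(2) n_def .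
    moreover have "?l \<le> 1 - 1 / n / 8 - P.expectation (\<lambda>s. xi t s ^ 3) / 16 - (1 + moment_const) / n\<^sup>2"
      using lac(3)[of t] by (simp add: n_def add_divide_distrib diff_divide_distrib)
    ultimately show ?thesis by (meson ennreal_leI order_trans)
  qed
  then have "(\<integral>\<^sup>+t. ennreal ?l \<partial>unif_circle) \<le> mean_xi sqrt" by (intro nn_integral_mono)
  then show "ennreal ?l \<le> mean_xi sqrt" by (simp only: nn_integral_circle_const)
  have "(\<integral>\<^sup>+x. ennreal (sqrt (1 - zeta t x)) \<partial>gauss (2 * N)) \<le> ennreal ?u" for t
  proof -
    note g = gauss_shift_perturbation[OF dim_ge_1 trig_vec_norm[of t]]
    interpret small_perturbation "gauss (2 * N)" "zeta t" by (rule g(1))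
    have "AE x in gauss (2 * N). zeta t x \<le> 1" using g(4) by eventually_elim simp
    from sqrt_moment_upper[OF this]
    have "(\<integral>\<^sup>+x. ennreal (sqrt (1 - zeta t x)) \<partial>gauss (2 * N)) \<le> ennreal (1 - 3 / (2 * n) / 8 - (- 4 / n\<^sup>2) / 16)"
      unfolding g(2,3) n_def .
    then show ?thesis by simp
  qed
  then have "mean_zeta sqrt \<le> (\<integral>\<^sup>+t. ennreal ?u \<partial>unif_circle)" by (intro nn_integral_mono)
  then show "mean_zeta sqrt \<le> ennreal ?u" by (simp only: nn_integral_circle_const)
  note k = gauss_norm_perturbation[OF dim_ge_1]
  interpret K: concentrated_perturbation "gauss (2 * N)" kappa "2 * N" gauss_moment_const by (rule k(1))
  have "AE x in gauss (2 * N). kappa x \<le> 1" using k(4) by eventually_elim simp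
  from K.sqrt_moment_lower[OF this]
  have "ennreal (1 - 2 / n / 8 - (- 8 / n\<^sup>2) / 16 - (1 + gauss_moment_const) / n\<^sup>2) \<le> mean_kappa sqrt"
    unfolding k(2,3) n_def .
  moreover have e: "1 - 1 / (4 * n) - (1/2 + gauss_moment_const) / n\<^sup>2 = 1 - 2 / n / 8 - (- 8 / n\<^sup>2) / 16 - (1 + gauss_moment_const) / n\<^sup>2"
    by (simp add: add_divide_distrib)
  ultimately show "ennreal (1 - 1 / (4 * n) - (1/2 + gauss_moment_const) / n\<^sup>2) \<le> mean_kappa sqrt"
    by (simp only: e)
qed

text \<open>
  The second-order coefficient of \<open>(1 - x) powr (-1/5)\<close> is 3/25. In the squared seminorm the self-energies have positive
  sign and the mixed term negative sign, so the directions of the bounds are reversed.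
\<close>

lemma fifth_root_energy_bounds:
  defines "n \<equiv> real (2 * N)"
  shows "mean_xi fifth \<le> ennreal (1 + 3 / (25 * n) + (66/125 * real L + 7 * (2 + 3 * moment_const + 480)) / n\<^sup>2)"
    and "ennreal (1 + 9 / (50 * n) - 44 / (125 * n\<^sup>2)) \<le> mean_zeta fifth"
    and "mean_kappa fifth \<le> ennreal (1 + 6 / (25 * n) - 88 / (125 * n\<^sup>2) + 7 * (2 + 3 * gauss_moment_const + 11) / n\<^sup>2)"
proof -
  interpret P: prob_space unif_circle by (rule prob_space_unif_circle)
  note lac = lacunary_perturbation
  let ?u = "1 + 3 / (25 * n) + (66/125 * real L + 7 * (2 + 3 * moment_const + 480)) / n\<^sup>2"
    and ?l = "1 + 9 / (50 * n) - 44 / (125 * n\<^sup>2)"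
  have "(\<integral>\<^sup>+s. ennreal (fifth (1 - xi t s)) \<partial>unif_circle) \<le> ennreal ?u" for t
  proof -
    interpret concentrated_perturbation unif_circle "xi t" "2 * N" moment_const by (rule lac(1))
    have "(\<integral>\<^sup>+s. ennreal (fifth (1 - xi t s)) \<partial>unif_circle)
      \<le> ennreal (1 + 3/25 * (1 / n) + 11/125 * P.expectation (\<lambda>s. xi t s ^ 3) + 7 * (2 + 3 * moment_const + 480) / n\<^sup>2)"
      using fifth_root_moment_upper[OF lac(4) lac(5)] unfolding lac(2) n_def by simp
    also have "\<dots> \<le> ennreal ?u"
    proof (rule ennreal_leI)
      have "11/125 * P.expectation (\<lambda>s. xi t s ^ 3) \<le> 11/125 * (6 * real L / n\<^sup>2)"
        using lac(3)[of t] unfolding n_def by (intro mult_left_mono) simp_all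
      then show "1 + 3/25 * (1 / n) + 11/125 * P.expectation (\<lambda>s. xi t s ^ 3) + 7 * (2 + 3 * moment_const + 480) / n\<^sup>2 \<le> ?u"
        by (simp add: add_divide_distrib)
    qed
    finally show ?thesis .
  qed
  then have "mean_xi fifth \<le> (\<integral>\<^sup>+t. ennreal ?u \<partial>unif_circle)" by (intro nn_integral_mono)
  then show "mean_xi fifth \<le> ennreal ?u" by (simp only: nn_integral_circle_const)
  have "ennreal ?l \<le> (\<integral>\<^sup>+x. ennreal (fifth (1 - zeta t x)) \<partial>gauss (2 * N))" for t
  proof -
    note g = gauss_shift_perturbation[OF dim_ge_1 trig_vec_norm[of t]]
    interpret small_perturbation "gauss (2 * N)" "zeta t" by (rule g(1))
    have "ennreal (1 + 3/25 * (3 / (2 * n)) + 11/125 * (- 4 / n\<^sup>2)) \<le> (\<integral>\<^sup>+x. ennreal (fifth (1 - zeta t x)) \<partial>gauss (2 * N))"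
      using fifth_root_moment_lower[OF g(4)] unfolding g(2,3) n_def .
    then show ?thesis by simp
  qed
  then have "(\<integral>\<^sup>+t. ennreal ?l \<partial>unif_circle) \<le> mean_zeta fifth" by (intro nn_integral_mono)
  then show "ennreal ?l \<le> mean_zeta fifth" by (simp only: nn_integral_circle_const)
  note k = gauss_norm_perturbation[OF dim_ge_1]
  interpret K: concentrated_perturbation "gauss (2 * N)" kappa "2 * N" gauss_moment_const by (rule k(1))
  have "mean_kappa fifth \<le> ennreal (1 + 3/25 * (2 / n) + 11/125 * (- 8 / n\<^sup>2) + 7 * (2 + 3 * gauss_moment_const + 11) / n\<^sup>2)"
    using K.fifth_root_moment_upper[OF k(4) k(5)] unfolding k(2,3) n_def by simp
  then show "mean_kappa fifth \<le> ennreal (1 + 6 / (25 * n) - 88 / (125 * n\<^sup>2) + 7 * (2 + 3 * gauss_moment_const + 11) / n\<^sup>2)"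
    by simp
qed

lemma const_nonneg: "moment_const \<ge> 0" "gauss_moment_const \<ge> 0"
  by (simp_all add: moment_const_def gauss_moment_const_def)

text \<open>
  The averaged identity \<open>cramer_von_mises_energy\<close>, divided by the common factors.
\<close>

lemma average_cvm:
  "(\<integral>\<^sup>+\<theta>. cvm \<theta> \<partial>sphere_measure (2 * N))
    \<le> ennreal (2 * pos_mean * sqrt 2 * ((2 + 3/8 * real L + moment_const + gauss_moment_const) / (real (2 * N))\<^sup>2))"
proof -
  interpret S: prob_space "sphere_measure (2 * N)" by (rule prob_space_sphere_measure[OF dim_ge_1])
  let ?S = "\<lambda>f. \<integral>\<^sup>+\<theta>. f \<theta> \<partial>sphere_measure (2 * N)"
  define n where "n = real (2 * N)"
  have n0: "n \<ge> 2" using N by (simp add: n_def)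
  define a where "a = (2 * n) powr (1 / 2)"
  have a0: "a > 0" using n0 by (simp add: a_def)
  let ?c = pos_mean and ?H = "radial_moment (2 * N) 1"
  let ?E1 = "\<lambda>\<theta>. mutual_energy pos_kernel (law \<theta>) (law \<theta>)"
  let ?E2 = "\<lambda>\<theta>. mutual_energy pos_kernel (law \<theta>) std_normal_distribution"
  let ?E3 = "\<lambda>\<theta>. mutual_energy (\<lambda>r. pos_kernel (- r)) (law \<theta>) std_normal_distribution"
  let ?E4 = "mutual_energy pos_kernel std_normal_distribution std_normal_distribution"
  have hom: "pos_kernel (- (c * r)) = ennreal (c powr 1) * pos_kernel (- r)" if "c > 0" for c r
    using pos_kernel_homogeneous[OF that, of "- r"] by simp
  have k1: "pos_kernel \<in> borel_measurable borel" and k2: "(\<lambda>r. pos_kernel (- r)) \<in> borel_measurable borel"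
    by measurable
  have pw: "(1 - xi t s) powr (1/2) = sqrt (1 - xi t s)" "(1 - zeta t x) powr (1/2) = sqrt (1 - zeta t x)"
    "(1 - kappa x) powr (1/2) = sqrt (1 - kappa x)" for t s x
    using xi_le_1[of t s] by (simp_all add: powr_half_sqrt)
  have e1: "?H * ?S ?E1 = ennreal ?c * (ennreal a * mean_xi sqrt)"
    using average_self_energy[OF k1 pos_kernel_homogeneous] by (simp only: pos_mean pw a_def n_def)
  have e2: "?H * ?S ?E2 = ennreal ?c * (ennreal a * mean_zeta sqrt)"
    using average_normal_energy[OF k1 pos_kernel_homogeneous] by (simp only: pos_mean pw a_def n_def)
  have e3: "?H * ?S ?E3 = ennreal ?c * (ennreal a * mean_zeta sqrt)"
    using average_normal_energy[OF k2 hom] by (simp only: neg_mean pw a_def n_def)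
  have rad: "ennreal (sqrt 2 powr 1) * ?H = ennreal a * mean_kappa sqrt"
    using normal_energy_radial[OF dim_ge_1, of 1] by (simp only: pw a_def n_def)
  have e4: "?H * ?E4 = ennreal ?c * (ennreal a * mean_kappa sqrt)"
    unfolding rad[symmetric] using std_normal_self_energy[OF k1 pos_kernel_homogeneous] by (simp only: pos_mean mult_ac)
  have "cvm \<theta> + ?E1 \<theta> + ?E4 = ?E2 \<theta> + ?E3 \<theta>" for \<theta>
    using cramer_von_mises_energy[OF real_distribution_law real_distribution_std_normal, of \<theta>]
    by (simp add: cvm_def normal_law_energy[OF k1])
  then have "?S (\<lambda>\<theta>. cvm \<theta> + ?E1 \<theta> + ?E4) = ?S (\<lambda>\<theta>. ?E2 \<theta> + ?E3 \<theta>)" by simp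
  then have "?S cvm + ?S ?E1 + ?E4 = ?S ?E2 + ?S ?E3"
    using energy_measurable[OF k1] energy_measurable[OF k2] by (simp add: nn_integral_add S.emeasure_space_1)
  then have "?H * ?S cvm + ?H * ?S ?E1 + ?H * ?E4 = ?H * ?S ?E2 + ?H * ?S ?E3"
    by (simp only: distrib_left[symmetric])
  then have main: "?H * ?S cvm + ennreal (?c * a) * (mean_xi sqrt + mean_kappa sqrt)
      = ennreal (?c * a) * (mean_zeta sqrt + mean_zeta sqrt)"
    unfolding e1 e2 e3 e4 using pos_mean(2) a0 by (simp add: ennreal_mult distrib_left add.assoc mult.assoc)
  define l1 where "l1 = 1 - 1 / (8 * n) - (3/8 * real L + 1 + moment_const) / n\<^sup>2"
  define l3 where "l3 = 1 - 1 / (4 * n) - (1/2 + gauss_moment_const) / n\<^sup>2"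
  define u where "u = 1 - 3 / (16 * n) + 1 / (4 * n\<^sup>2)"
  define d where "d = (2 + 3/8 * real L + moment_const + gauss_moment_const) / n\<^sup>2"
  have b: "ennreal l1 \<le> mean_xi sqrt" "mean_zeta sqrt \<le> ennreal u" "ennreal l3 \<le> mean_kappa sqrt"
    using sqrt_energy_bounds by (simp_all only: l1_def l3_def u_def n_def)
  have "?S cvm \<le> ennreal (2 * ?c * (sqrt 2 powr 1) * d)"
  proof (rule energy_cancellation[OF pos_mean(2) a0 _ main _ _ _ rad])
    show "ennreal (l1 + l3) \<le> mean_xi sqrt + mean_kappa sqrt"
      by (intro order_trans[OF ennreal_add_ge] add_mono b)
    have "3 / (16 * n) \<le> 1" using n0 by (simp add: field_simps)
    moreover have "1 / (4 * n\<^sup>2) \<ge> 0" by simp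
    ultimately have "u \<ge> 0" by (simp add: u_def)
    then have "ennreal (u + u) = ennreal u + ennreal u" by (simp only: ennreal_plus)
    then show "mean_zeta sqrt + mean_zeta sqrt \<le> ennreal (u + u)" by (simp only: add_mono b)
    \<comment> \<open>the terms of order \<open>1 / n\<close> cancel: \<open>2 \<cdot> 3/16 = 1/8 + 1/4\<close>\<close>
    define i j where "i = 1 / n" and "j = 1 / n\<^sup>2"
    have "u = 1 - 3/16 * i + 1/4 * j" "l1 = 1 - 1/8 * i - (3/8 * real L + 1 + moment_const) * j"
      "l3 = 1 - 1/4 * i - (1/2 + gauss_moment_const) * j" "d = (2 + 3/8 * real L + moment_const + gauss_moment_const) * j"
      by (simp_all add: u_def l1_def l3_def d_def i_def j_def)
    then show "u + u - (l1 + l3) = d" by (simp add: algebra_simps)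
    show "ennreal (1/2) \<le> mean_kappa sqrt" using N by (intro gauss_sqrt_moment_ge_half) simp
  qed simp
  then show ?thesis by (simp add: d_def n_def)
qed

text \<open>
  The averaged identity \<open>fractional_increment_energy\<close>, divided by the common factors.
\<close>

lemma average_fractional_norm:
  "(\<integral>\<^sup>+\<theta>. fractional_norm \<theta> \<partial>sphere_measure (2 * N))
    \<le> ennreal (2 * riesz_mean * sqrt 2 powr (-2/5)
      * ((66/125 * real L + 7 * (2 + 3 * moment_const + 480) + 7 * (2 + 3 * gauss_moment_const + 11)) / (real (2 * N))\<^sup>2))"
proof -
  interpret S: prob_space "sphere_measure (2 * N)" by (rule prob_space_sphere_measure[OF dim_ge_1])
  let ?S = "\<lambda>f. \<integral>\<^sup>+\<theta>. f \<theta> \<partial>sphere_measure (2 * N)"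
  define n where "n = real (2 * N)"
  have n0: "n > 0" using N by (simp add: n_def)
  define a where "a = (2 * n) powr (- 2 / 5 / 2)"
  have a0: "a > 0" using n0 by (simp add: a_def)
  let ?c = riesz_mean and ?H = "radial_moment (2 * N) (-2/5)"
  let ?E1 = "\<lambda>\<theta>. mutual_energy riesz_kernel (law \<theta>) (law \<theta>)"
  let ?E2 = "\<lambda>\<theta>. mutual_energy riesz_kernel (law \<theta>) std_normal_distribution"
  let ?E4 = "mutual_energy riesz_kernel std_normal_distribution std_normal_distribution"
  have half: "- 2 / 5 / 2 = (- 1 / 5 :: real)" by simp
  have k: "riesz_kernel \<in> borel_measurable borel" by measurable
  have e1: "?H * ?S ?E1 = ennreal ?c * (ennreal a * mean_xi fifth)"
    using average_self_energy[OF k riesz_kernel_homogeneous] by (simp only: riesz_mean half a_def n_def)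
  have e2: "?H * ?S ?E2 = ennreal ?c * (ennreal a * mean_zeta fifth)"
    using average_normal_energy[OF k riesz_kernel_homogeneous] by (simp only: riesz_mean half a_def n_def)
  have rad: "ennreal (sqrt 2 powr (-2/5)) * ?H = ennreal a * mean_kappa fifth"
    using normal_energy_radial[OF dim_ge_1, of "-2/5"] by (simp only: half a_def n_def)
  have e4: "?H * ?E4 = ennreal ?c * (ennreal a * mean_kappa fifth)"
    unfolding rad[symmetric] using std_normal_self_energy[OF k riesz_kernel_homogeneous] by (simp only: riesz_mean mult_ac)
  have "fractional_norm \<theta> + 2 * ?E2 \<theta> = ?E1 \<theta> + ?E4" for \<theta>
    using fractional_increment_energy[OF real_distribution_law real_distribution_std_normal, of \<theta>]
    by (simp add: fractional_norm_def)
  then have "?S (\<lambda>\<theta>. fractional_norm \<theta> + 2 * ?E2 \<theta>) = ?S (\<lambda>\<theta>. ?E1 \<theta> + ?E4)" by simp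
  then have "?S fractional_norm + 2 * ?S ?E2 = ?S ?E1 + ?E4"
    using energy_measurable[OF k] by (simp add: nn_integral_add nn_integral_cmult S.emeasure_space_1)
  then have "?H * ?S fractional_norm + 2 * (?H * ?S ?E2) = ?H * ?S ?E1 + ?H * ?E4"
    by (simp only: distrib_left[symmetric] mult.left_commute[of 2])
  then have main: "?H * ?S fractional_norm + ennreal (?c * a) * (2 * mean_zeta fifth)
      = ennreal (?c * a) * (mean_xi fifth + mean_kappa fifth)"
    unfolding e1 e2 e4 using riesz_mean(2) a0 by (simp add: ennreal_mult distrib_left mult_ac)
  define u1 where "u1 = 1 + 3 / (25 * n) + (66/125 * real L + 7 * (2 + 3 * moment_const + 480)) / n\<^sup>2"
  define u3 where "u3 = 1 + 6 / (25 * n) - 88 / (125 * n\<^sup>2) + 7 * (2 + 3 * gauss_moment_const + 11) / n\<^sup>2"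
  define l where "l = 1 + 9 / (50 * n) - 44 / (125 * n\<^sup>2)"
  define d where "d = (66/125 * real L + 7 * (2 + 3 * moment_const + 480) + 7 * (2 + 3 * gauss_moment_const + 11)) / n\<^sup>2"
  have b: "mean_xi fifth \<le> ennreal u1" "ennreal l \<le> mean_zeta fifth" "mean_kappa fifth \<le> ennreal u3"
    using fifth_root_energy_bounds by (simp_all only: l_def u1_def u3_def n_def)
  have "?S fractional_norm \<le> ennreal (2 * ?c * (sqrt 2 powr (-2/5)) * d)"
  proof (rule energy_cancellation[OF riesz_mean(2) a0 _ main _ _ _ rad])
    have "ennreal (2 * l) = 2 * ennreal l" by (subst ennreal_mult') simp_all
    then show "ennreal (2 * l) \<le> 2 * mean_zeta fifth"
      by (simp only: mult_left_mono[OF b(2) zero_le])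
    have "u1 \<ge> 0" unfolding u1_def using n0 const_nonneg by (intro add_nonneg_nonneg divide_nonneg_nonneg) simp_all
    moreover have "u3 \<ge> 0"
    proof -
      have "88 / (125 * n\<^sup>2) \<le> 7 * (2 + 3 * gauss_moment_const + 11) / n\<^sup>2"
        using n0 const_nonneg by (simp add: field_simps)
      moreover have "6 / (25 * n) \<ge> 0" using n0 by simp
      ultimately show ?thesis unfolding u3_def by linarith
    qed
    ultimately have "ennreal (u1 + u3) = ennreal u1 + ennreal u3" by (simp only: ennreal_plus)
    then show "mean_xi fifth + mean_kappa fifth \<le> ennreal (u1 + u3)" by (simp only: add_mono b)
    \<comment> \<open>the terms of order \<open>1 / n\<close> cancel: \<open>3/25 + 6/25 = 2 \<cdot> 9/50\<close>\<close>
    define i j where "i = 1 / n" and "j = 1 / n\<^sup>2"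
    have "u1 = 1 + 3/25 * i + (66/125 * real L + 7 * (2 + 3 * moment_const + 480)) * j"
      "u3 = 1 + 6/25 * i - 88/125 * j + 7 * (2 + 3 * gauss_moment_const + 11) * j" "l = 1 + 9/50 * i - 44/125 * j"
      "d = (66/125 * real L + 7 * (2 + 3 * moment_const + 480) + 7 * (2 + 3 * gauss_moment_const + 11)) * j"
      by (simp_all add: u1_def u3_def l_def d_def i_def j_def)
    then show "u1 + u3 - 2 * l = d" by (simp add: algebra_simps)
    show "ennreal (1/2) \<le> mean_kappa fifth" using N by (intro gauss_fifth_root_moment_ge_half) simp
  qed simp
  then show ?thesis by (simp add: d_def n_def)
qed

definition cvm_const :: real where
  "cvm_const = 2 * pos_mean * sqrt 2 * (2 + 3/8 * real L + moment_const + gauss_moment_const)"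

definition kolmogorov_const :: real where
  "kolmogorov_const = 2 * cvm_const + geom_const * (2 * riesz_mean * sqrt 2 powr (-2/5)
      * (66/125 * real L + 7 * (2 + 3 * moment_const + 480) + 7 * (2 + 3 * gauss_moment_const + 11)))"

lemma distance_const_nonneg: "cvm_const \<ge> 0" "kolmogorov_const \<ge> 0"
proof -
  show c: "cvm_const \<ge> 0"
    unfolding cvm_const_def using pos_mean(2) const_nonneg by (intro mult_nonneg_nonneg add_nonneg_nonneg) simp_all
  show "kolmogorov_const \<ge> 0" unfolding kolmogorov_const_def using c const_nonneg riesz_mean(2) geom_const_pos
    by (intro mult_nonneg_nonneg add_nonneg_nonneg) simp_all
qed

lemma average_omega:
  "(\<integral>\<^sup>+\<theta>. (omega_dist (cdf (law \<theta>)) std_normal_cdf)\<^sup>2 \<partial>sphere_measure (2 * N)) \<le> ennreal (cvm_const / (real (2 * N))\<^sup>2)"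
  using average_cvm by (simp add: omega_dist_def ennreal_sqrt_power2 std_normal_cdf_def cvm_def cvm_const_def)

lemma average_rho:
  "(\<integral>\<^sup>+\<theta>. (rho_dist (cdf (law \<theta>)) std_normal_cdf)\<^sup>2 \<partial>sphere_measure (2 * N)) \<le> ennreal (kolmogorov_const / (real (2 * N))\<^sup>2)"
proof -
  let ?\<sigma> = "sphere_measure (2 * N)"
  define R where "R = 2 * riesz_mean * sqrt 2 powr (-2/5)
      * (66/125 * real L + 7 * (2 + 3 * moment_const + 480) + 7 * (2 + 3 * gauss_moment_const + 11))"
  have R: "(\<integral>\<^sup>+\<theta>. fractional_norm \<theta> \<partial>?\<sigma>) \<le> ennreal (R / (real (2 * N))\<^sup>2)"
    using average_fractional_norm by (simp add: R_def)
  have C: "(\<integral>\<^sup>+\<theta>. cvm \<theta> \<partial>?\<sigma>) \<le> ennreal (cvm_const / (real (2 * N))\<^sup>2)"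
    using average_cvm by (simp add: cvm_const_def)
  have R0: "R \<ge> 0" unfolding R_def using riesz_mean(2) const_nonneg by (intro mult_nonneg_nonneg add_nonneg_nonneg) simp_all
  have "(\<integral>\<^sup>+\<theta>. (rho_dist (cdf (law \<theta>)) std_normal_cdf)\<^sup>2 \<partial>?\<sigma>) \<le> (\<integral>\<^sup>+\<theta>. 2 * cvm \<theta> + ennreal geom_const * fractional_norm \<theta> \<partial>?\<sigma>)"
    unfolding std_normal_cdf_def cvm_def fractional_norm_def
    by (intro nn_integral_mono rho_dist_square_le_energy real_distribution_law real_distribution_std_normal)
  also have "\<dots> = 2 * (\<integral>\<^sup>+\<theta>. cvm \<theta> \<partial>?\<sigma>) + ennreal geom_const * (\<integral>\<^sup>+\<theta>. fractional_norm \<theta> \<partial>?\<sigma>)"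
    by (simp add: nn_integral_add nn_integral_cmult)
  also have "\<dots> \<le> 2 * ennreal (cvm_const / (real (2 * N))\<^sup>2) + ennreal geom_const * ennreal (R / (real (2 * N))\<^sup>2)"
    by (intro add_mono mult_left_mono C R) simp_all
  also have "\<dots> = ennreal (2 * (cvm_const / (real (2 * N))\<^sup>2)) + ennreal (geom_const * (R / (real (2 * N))\<^sup>2))"
  proof -
    have "2 * ennreal x = ennreal (2 * x)" for x :: real
      by (subst ennreal_mult') simp_all
    moreover have "ennreal geom_const * ennreal x = ennreal (geom_const * x)" for x :: real
      using geom_const_pos by (intro ennreal_mult'[symmetric]) simp
    ultimately show ?thesis by simp
  qed
  also have "\<dots> = ennreal (2 * (cvm_const / (real (2 * N))\<^sup>2) + geom_const * (R / (real (2 * N))\<^sup>2))"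
    using geom_const_pos distance_const_nonneg R0 by (intro ennreal_plus[symmetric]) simp_all
  also have "2 * (cvm_const / (real (2 * N))\<^sup>2) + geom_const * (R / (real (2 * N))\<^sup>2) = kolmogorov_const / (real (2 * N))\<^sup>2"
    by (simp add: kolmogorov_const_def R_def add_divide_distrib)
  finally show ?thesis .
qed

lemma proj_cdf_eq_law:
  assumes X: "\<forall>k\<in>{1..N}. \<forall>t\<in>{-pi<..<pi}. X (2 * k - 1) t = sqrt 2 * cos (real (m k) * t) \<and> X (2 * k) t = sqrt 2 * sin (real (m k) * t)"
  shows "proj_cdf unif_circle (2 * N) X \<theta> = cdf (law \<theta>)"
proof
  fix x
  have "euclid_inner (2 * N) (\<lambda>i. X i t) \<theta> = euclid_inner (2 * N) (trig_vec t) \<theta>" if t: "t \<in> space unif_circle" for t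
  proof -
    have "t \<in> {-pi<..<pi}" using t by (simp only: space_unif_circle)
    with X show ?thesis
      unfolding euclid_inner_def sum_pairs by (intro sum.cong refl) (simp add: trig_vec_odd trig_vec_even)
  qed
  then show "proj_cdf unif_circle (2 * N) X \<theta> x = cdf (law \<theta>) x"
    unfolding proj_cdf_def law_cdf_eq by (intro arg_cong[where f="measure unif_circle"] Collect_cong) auto
qed

end

theorem proposition15p1:
  shows "\<forall>q::real. q > 1 \<longrightarrow> (\<exists>c::real. c > 0 \<and>
    (\<forall>(n::nat) (m :: nat \<Rightarrow> nat) (X :: nat \<Rightarrow> real \<Rightarrow> real).
       n \<ge> 2 \<longrightarrow> even n \<longrightarrow>
       (\<forall>k\<in>{1..n div 2}. m k > 0) \<longrightarrow>
       (\<forall>k. 1 \<le> k \<and> k < n div 2 \<longrightarrow> real (m (k + 1)) / real (m k) \<ge> q) \<longrightarrow>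
       (\<forall>k\<in>{1..n div 2}. \<forall>t\<in>{-pi<..<pi}.
          X (2 * k - 1) t = sqrt 2 * cos (real (m k) * t) \<and>
          X (2 * k) t = sqrt 2 * sin (real (m k) * t)) \<longrightarrow>
       (\<integral>\<^sup>+ \<theta>. (omega_dist (proj_cdf unif_circle n X \<theta>) std_normal_cdf)\<^sup>2 \<partial>sphere_measure n)
         \<le> ennreal (c / (real n)\<^sup>2) \<and>
       (\<integral>\<^sup>+ \<theta>. (rho_dist (proj_cdf unif_circle n X \<theta>) std_normal_cdf)\<^sup>2 \<partial>sphere_measure n)
         \<le> ennreal (c * (ln (real n))\<^sup>2 / (real n)\<^sup>2)))"
    (is "\<forall>q. q > 1 \<longrightarrow> (\<exists>c. c > 0 \<and> ?P q c)")
proof (intro allI impI)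
  fix q :: real assume q: "q > 1"
  define K1 where "K1 = lacunary.cvm_const q"
  define K2 where "K2 = lacunary.kolmogorov_const q"
  \<comment> \<open>both constants depend on \<open>q\<close> only, so a single frequency shows that they are nonnegative\<close>
  have "lacunary q 1 (\<lambda>_. 1)" using q by unfold_locales simp_all
  then have K: "K1 \<ge> 0" "K2 \<ge> 0"
    using lacunary.distance_const_nonneg by (auto simp: K1_def K2_def)
  \<comment> \<open>the quotient by the square of \<open>ln 2\<close> absorbs the logarithm, as \<open>n \<ge> 2\<close>\<close>
  define c where "c = K1 + K2 / (ln 2)\<^sup>2 + 1"
  have c: "c > 0" "K1 \<le> c" "K2 / (ln 2)\<^sup>2 \<le> c"
    using K by (auto simp: c_def intro!: add_nonneg_pos add_nonneg_nonneg)
  show "\<exists>c. c > 0 \<and> ?P q c"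
  proof (intro exI[of _ c] conjI[OF c(1)] allI impI)
    fix n :: nat and m :: "nat \<Rightarrow> nat" and X :: "nat \<Rightarrow> real \<Rightarrow> real"
    assume n: "n \<ge> 2" "even n" and pos: "\<forall>k\<in>{1..n div 2}. m k > 0"
      and ratio: "\<forall>k. 1 \<le> k \<and> k < n div 2 \<longrightarrow> real (m (k + 1)) / real (m k) \<ge> q"
      and X: "\<forall>k\<in>{1..n div 2}. \<forall>t\<in>{-pi<..<pi}.
          X (2 * k - 1) t = sqrt 2 * cos (real (m k) * t) \<and> X (2 * k) t = sqrt 2 * sin (real (m k) * t)"
    define N where "N = n div 2"
    have nN: "n = 2 * N" using n(2) by (simp add: N_def)
    interpret lacunary q N m
    proof
      show "N \<ge> 1" using n by (simp add: N_def)
      show "0 < m k" if "k \<in> {1..N}" for k using pos that by (simp add: N_def)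
      show "q * real (m k) \<le> real (m (k + 1))" if "1 \<le> k" "k < N" for k
      proof -
        have "m k > 0" using pos that by (simp add: N_def)
        moreover have "q \<le> real (m (k + 1)) / real (m k)" using ratio that by (simp add: N_def)
        ultimately show ?thesis by (simp add: pos_le_divide_eq)
      qed
    qed (rule q)
    have F: "proj_cdf unif_circle (2 * N) X \<theta> = cdf (law \<theta>)" for \<theta>
      by (rule proj_cdf_eq_law) (use X in \<open>simp only: N_def\<close>)
    have "(\<integral>\<^sup>+ \<theta>. (omega_dist (proj_cdf unif_circle n X \<theta>) std_normal_cdf)\<^sup>2 \<partial>sphere_measure n) \<le> ennreal (K1 / (real n)\<^sup>2)"
      using average_omega unfolding nN F K1_def .
    also have "\<dots> \<le> ennreal (c / (real n)\<^sup>2)"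
      using c(2) by (intro ennreal_leI divide_right_mono) simp_all
    finally have om: "(\<integral>\<^sup>+ \<theta>. (omega_dist (proj_cdf unif_circle n X \<theta>) std_normal_cdf)\<^sup>2 \<partial>sphere_measure n) \<le> ennreal (c / (real n)\<^sup>2)" .
    have "(\<integral>\<^sup>+ \<theta>. (rho_dist (proj_cdf unif_circle n X \<theta>) std_normal_cdf)\<^sup>2 \<partial>sphere_measure n) \<le> ennreal (K2 / (real n)\<^sup>2)"
      using average_rho unfolding nN F K2_def .
    also have "\<dots> \<le> ennreal (c * (ln (real n))\<^sup>2 / (real n)\<^sup>2)"
    proof (intro ennreal_leI divide_right_mono)
      have "(ln 2)\<^sup>2 \<le> (ln (real n))\<^sup>2" using n(1) by (intro power_mono) simp_all
      then have "K2 / (ln 2)\<^sup>2 * (ln 2)\<^sup>2 \<le> c * (ln (real n))\<^sup>2"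
        using c K by (intro mult_mono) simp_all
      then show "K2 \<le> c * (ln (real n))\<^sup>2" by simp
    qed simp
    finally have "(\<integral>\<^sup>+ \<theta>. (rho_dist (proj_cdf unif_circle n X \<theta>) std_normal_cdf)\<^sup>2 \<partial>sphere_measure n) \<le> ennreal (c * (ln (real n))\<^sup>2 / (real n)\<^sup>2)" .
    with om show "(\<integral>\<^sup>+ \<theta>. (omega_dist (proj_cdf unif_circle n X \<theta>) std_normal_cdf)\<^sup>2 \<partial>sphere_measure n) \<le> ennreal (c / (real n)\<^sup>2) \<and>
      (\<integral>\<^sup>+ \<theta>. (rho_dist (proj_cdf unif_circle n X \<theta>) std_normal_cdf)\<^sup>2 \<partial>sphere_measure n) \<le> ennreal (c * (ln (real n))\<^sup>2 / (real n)\<^sup>2)" ..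
  qed
qed

end
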